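(* Let $\mathbb G_2$ be the Grushin plane equipped with the Lebesgue measure, and let $N\in\mathbb R$. The inequality $$\beta_t(q_0,q)\ge t^N,\qquad\forall\,t\in[0,1],$$ holds for all points $q_0,q\in\mathbb G_2$ with $q\notin\mathrm{Cut}(q_0)$ if and only if $N\ge5$.
   Context: The Grushin plane $\mathbb G_2$ is the sub-Riemannian structure on $\mathbb R^2$ with generating vector fields $X_1=\partial_x$, $X_2=x\,\partial_y$: $\mathcal D_q=\mathrm{span}\{X_1(q),X_2(q)\}$ with $g_q(v,v)=\inf\{u_1^2+u_2^2:u_1X_1(q)+u_2X_2(q)=v\}$. A horizontal curve is an absolutely continuous $\gamma:[0,1]\to\mathbb R^2$ with $\dot\gamma=u_1(t)X_1(\gamma)+u_2(t)X_2(\gamma)$ a.e. for a control $u\in L^2([0,1],\mathbb R^2)$; its length is $\int_0^1\sqrt{g(\dot\gamma,\dot\gamma)}dt$, and $d_{SR}$ is the infimum of lengths of horizontal curves joining two points. A minimizing geodesic is a constant-speed horizontal curve whose length equals the distance between its endpoints. A horizontal curve starting at $q_0$ with control $u$ is abnormal if $u$ is a critical point of the end-point map $v\mapsto\gamma_v(1)$, $\gamma_v$ being the horizontal curve with control $v$ starting at $q_0$. The Hamiltonian is $H=\frac12(u^2+x^2v^2)$ in canonical coordinates $(u,v,x,y)$ of $T^*\mathbb R^2$ (here $(u,v)$ denote the momenta dual to $(x,y)$), $e^{t\vec H}$ is its Hamiltonian flow, and $\exp_{q_0}(\lambda)=\pi(e^{\vec H}(\lambda))$ for $\lambda\in T^*_{q_0}\mathbb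 R^2$, $\pi$ the bundle projection. Normal geodesics are $t\mapsto\exp_{q_0}(t\lambda)$, and $\exp_{q_0}(\lambda)$ is conjugate to $q_0$ along it if $\lambda$ is a critical point of $\exp_{q_0}$. $\mathrm{Cut}(q_0)$ is the complement of the set of smooth points, where $q$ is smooth with respect to $q_0$ if there is a unique minimizing geodesic joining $q_0$ with $q$, it is not abnormal, and $q_0,q$ are not conjugate along it. $Z_t(A,B)$ is the set of all $\gamma(t)$ with $\gamma:[0,1]\to\mathbb R^2$ a minimizing geodesic, $\gamma(0)\in A$, $\gamma(1)\in B$. With $\mathcal L^2$ the Lebesgue (outer) measure and $\mathcal B_r(q)$ the sub-Riemannian ball, $\beta_t(q_0,q)=\limsup_{r\downarrow0}\mathcal L^2(Z_t(\{q_0\},\mathcal B_r(q)))/\mathcal L^2(\mathcal B_r(q))$. *)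

theory Defs
  imports "HOL-Analysis.Analysis"
begin

type_synonym plane = "real \<times> real"

(* Covector (u, v) first, base point (x, y) second. *)
type_synonym cotangent = "(real \<times> real) \<times> plane"


section \<open>The Grushin structure\<close>

definition X1 :: "plane \<Rightarrow> plane" where
  "X1 q = (1, 0)"

definition X2 :: "plane \<Rightarrow> plane" where
  "X2 q = (0, fst q)"

(* Meaningful only for v in the span of X1 q and X2 q, otherwise the infimum is over the
   empty set.  Below it is only integrated along curves whose velocity is a.e. in the span. *)
definition grushin_metric :: "plane \<Rightarrow> plane \<Rightarrow> real" where
  "grushin_metric q v =
     Inf {u1\<^sup>2 + u2\<^sup>2 | u1 u2 :: real. u1 *\<^sub>R X1 q + u2 *\<^sub>R X2 q = v}"

definition absolutely_continuous_curve :: "(real \<Rightarrow> 'a::real_normed_vector) \<Rightarrow> bool" where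
  "absolutely_continuous_curve \<gamma> \<longleftrightarrow>
     (\<forall>\<epsilon>>0. \<exists>\<delta>>0. \<forall>(n::nat) a b.
        (\<forall>i<n. 0 \<le> a i \<and> a i \<le> b i \<and> b i \<le> 1) \<longrightarrow>
        disjoint_family_on (\<lambda>i. {a i<..<b i}) {..<n} \<longrightarrow>
        (\<Sum>i<n. b i - a i) < \<delta> \<longrightarrow>
        (\<Sum>i<n. norm (\<gamma> (b i) - \<gamma> (a i))) < \<epsilon>)"

(* L2 controls are represented by functions, not by classes modulo a.e. equality;
   l2_norm is then a seminorm on l2_controls. *)
definition l2_controls :: "(real \<Rightarrow> real \<times> real) set" where
  "l2_controls = {u. u \<in> borel_measurable (lebesgue_on {0..1}) \<and>
                     integrable (lebesgue_on {0..1}) (\<lambda>t. (norm (u t))\<^sup>2)}"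

definition l2_norm :: "(real \<Rightarrow> real \<times> real) \<Rightarrow> real" where
  "l2_norm u = sqrt (LINT t|lebesgue_on {0..1}. (norm (u t))\<^sup>2)"

definition has_control :: "(real \<Rightarrow> plane) \<Rightarrow> (real \<Rightarrow> real \<times> real) \<Rightarrow> bool" where
  "has_control \<gamma> u \<longleftrightarrow>
     absolutely_continuous_curve \<gamma> \<and> u \<in> l2_controls \<and>
     (AE t in lebesgue_on {0..1}.
        (\<gamma> has_vector_derivative (fst (u t) *\<^sub>R X1 (\<gamma> t) + snd (u t) *\<^sub>R X2 (\<gamma> t)))
          (at t within {0..1}))"

definition horizontal :: "(real \<Rightarrow> plane) \<Rightarrow> bool" where
  "horizontal \<gamma> \<longleftrightarrow> (\<exists>u. has_control \<gamma> u)"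

definition speed :: "(real \<Rightarrow> plane) \<Rightarrow> real \<Rightarrow> real" where
  "speed \<gamma> t = sqrt (grushin_metric (\<gamma> t) (vector_derivative \<gamma> (at t within {0..1})))"

definition sr_length :: "(real \<Rightarrow> plane) \<Rightarrow> real" where
  "sr_length \<gamma> = (LINT t|lebesgue_on {0..1}. speed \<gamma> t)"

definition d_SR :: "plane \<Rightarrow> plane \<Rightarrow> real" where
  "d_SR p q = Inf {sr_length \<gamma> | \<gamma>. horizontal \<gamma> \<and> \<gamma> 0 = p \<and> \<gamma> 1 = q}"

definition sr_ball :: "real \<Rightarrow> plane \<Rightarrow> plane set" where
  "sr_ball r q = {p. d_SR q p < r}"

definition minimizing_geodesic :: "(real \<Rightarrow> plane) \<Rightarrow> bool" where
  "minimizing_geodesic \<gamma> \<longleftrightarrow>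
     horizontal \<gamma> \<and> (\<exists>c. AE t in lebesgue_on {0..1}. speed \<gamma> t = c) \<and>
     sr_length \<gamma> = d_SR (\<gamma> 0) (\<gamma> 1)"


section \<open>Abnormal curves\<close>

definition end_point :: "plane \<Rightarrow> (real \<Rightarrow> real \<times> real) \<Rightarrow> plane" where
  "end_point q0 u = (THE q. \<exists>\<gamma>. has_control \<gamma> u \<and> \<gamma> 0 = q0 \<and> \<gamma> 1 = q)"

(* Frechet differentiability at u with respect to the seminorm l2_norm.  Boundedness makes L
   invariant under a.e. equality, so L is a bounded operator on the Hilbert space L2. *)
definition has_l2_derivative ::
  "((real \<Rightarrow> real \<times> real) \<Rightarrow> plane) \<Rightarrow> ((real \<Rightarrow> real \<times> real) \<Rightarrow> plane)
     \<Rightarrow> (real \<Rightarrow> real \<times> real) \<Rightarrow> bool" where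
  "has_l2_derivative F L u \<longleftrightarrow>
     (\<forall>v\<in>l2_controls. \<forall>w\<in>l2_controls. L (\<lambda>t. v t + w t) = L v + L w) \<and>
     (\<forall>c. \<forall>w\<in>l2_controls. L (\<lambda>t. c *\<^sub>R w t) = c *\<^sub>R L w) \<and>
     (\<exists>K. \<forall>w\<in>l2_controls. norm (L w) \<le> K * l2_norm w) \<and>
     (\<forall>\<epsilon>>0. \<exists>\<delta>>0. \<forall>w\<in>l2_controls. l2_norm w < \<delta> \<longrightarrow>
        norm (F (\<lambda>t. u t + w t) - F u - L w) \<le> \<epsilon> * l2_norm w)"

definition l2_critical_point ::
  "((real \<Rightarrow> real \<times> real) \<Rightarrow> plane) \<Rightarrow> (real \<Rightarrow> real \<times> real) \<Rightarrow> bool" where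
  "l2_critical_point F u \<longleftrightarrow> (\<exists>L. has_l2_derivative F L u \<and> L ` l2_controls \<noteq> UNIV)"

(* The control of a curve is determined a.e. only where X2 does not vanish, hence the
   existential quantifier. *)
definition abnormal :: "(real \<Rightarrow> plane) \<Rightarrow> bool" where
  "abnormal \<gamma> \<longleftrightarrow> (\<exists>u. has_control \<gamma> u \<and> l2_critical_point (end_point (\<gamma> 0)) u)"


section \<open>Hamiltonian flow and conjugate points\<close>

fun grushin_hamiltonian :: "cotangent \<Rightarrow> real" where
  "grushin_hamiltonian ((u, v), (x, y)) = (u\<^sup>2 + x\<^sup>2 * v\<^sup>2) / 2"

fun hamiltonian_field :: "(cotangent \<Rightarrow> real) \<Rightarrow> cotangent \<Rightarrow> cotangent" where
  "hamiltonian_field h ((u, v), (x, y)) =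
     ((- deriv (\<lambda>s. h ((u, v), (s, y))) x, - deriv (\<lambda>s. h ((u, v), (x, s))) y),
      (deriv (\<lambda>s. h ((s, v), (x, y))) u, deriv (\<lambda>s. h ((u, s), (x, y))) v))"

(* The time-t flow, for h whose Hamiltonian field is complete, as is the case for
   grushin_hamiltonian. *)
definition hamiltonian_flow :: "(cotangent \<Rightarrow> real) \<Rightarrow> real \<Rightarrow> cotangent \<Rightarrow> cotangent" where
  "hamiltonian_flow h t z =
     (THE w. \<exists>c. c 0 = z \<and> c t = w \<and>
        (\<forall>s. (c has_vector_derivative hamiltonian_field h (c s)) (at s)))"

definition sr_exp :: "plane \<Rightarrow> real \<times> real \<Rightarrow> plane" where
  "sr_exp q0 \<xi> = snd (hamiltonian_flow grushin_hamiltonian 1 (\<xi>, q0))"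

definition critical_point :: "('a::real_normed_vector \<Rightarrow> 'b::real_normed_vector) \<Rightarrow> 'a \<Rightarrow> bool" where
  "critical_point f x \<longleftrightarrow> (\<exists>D. (f has_derivative D) (at x) \<and> \<not> surj D)"

definition conjugate_along :: "(real \<Rightarrow> plane) \<Rightarrow> bool" where
  "conjugate_along \<gamma> \<longleftrightarrow>
     (\<exists>\<xi>. (\<forall>t\<in>{0..1}. \<gamma> t = sr_exp (\<gamma> 0) (t *\<^sub>R \<xi>)) \<and> critical_point (sr_exp (\<gamma> 0)) \<xi>)"


section \<open>Cut locus and distortion coefficient\<close>

(* Curves live on [0,1], so uniqueness is up to values outside that interval. *)
definition smooth_point :: "plane \<Rightarrow> plane \<Rightarrow> bool" where
  "smooth_point q0 q \<longleftrightarrow>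
     (\<exists>\<gamma>. minimizing_geodesic \<gamma> \<and> \<gamma> 0 = q0 \<and> \<gamma> 1 = q \<and>
        (\<forall>\<eta>. minimizing_geodesic \<eta> \<and> \<eta> 0 = q0 \<and> \<eta> 1 = q \<longrightarrow> (\<forall>t\<in>{0..1}. \<eta> t = \<gamma> t)) \<and>
        \<not> abnormal \<gamma> \<and> \<not> conjugate_along \<gamma>)"

definition Cut :: "plane \<Rightarrow> plane set" where
  "Cut q0 = - {q. smooth_point q0 q}"

definition Z :: "real \<Rightarrow> plane set \<Rightarrow> plane set \<Rightarrow> plane set" where
  "Z t A B = {\<gamma> t | \<gamma>. minimizing_geodesic \<gamma> \<and> \<gamma> 0 \<in> A \<and> \<gamma> 1 \<in> B}"

definition beta :: "real \<Rightarrow> plane \<Rightarrow> plane \<Rightarrow> ennreal" where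
  "beta t q0 q =
     Limsup (at_right 0) (\<lambda>r. outer_measure_of lebesgue (Z t {q0} (sr_ball r q)) /
                               outer_measure_of lebesgue (sr_ball r q))"

end

theory Submission
  imports Defs
begin

text \<open>
  Fix a base point with abscissa \<open>a\<close>.  The Hamiltonian flow is solved by elementary functions: the
  covector \<open>(u, v)\<close> gives \<open>x(s) = a cos(vs) + (u/v) sin(vs)\<close> and \<open>y' = v x\<^sup>2\<close>.  Let \<open>exp\<close> denote the
  resulting exponential map and \<open>J\<close> its Jacobian determinant.  The theorem rests on the formula

    \<open>\<beta>\<^sub>t(q\<^sub>0, exp(\<xi>)) = t\<^sup>2 J(t\<xi>) / J(\<xi>)\<close>   for \<open>0 < t \<le> 1\<close>, \<open>\<bar>v\<bar> < \<pi>\<close>,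

  valid unless \<open>a = u = 0\<close> (\<open>beta_grushin_exp\<close>), on the fact that every point outside the cut locus is such
  an \<open>exp(\<xi>)\<close> (\<open>smooth_point_is_grushin_exp\<close>), and on the inequality \<open>J(t\<xi>) \<ge> t\<^sup>3 J(\<xi>)\<close> (\<open>jac_scaling\<close>).
  Together they give \<open>\<beta>\<^sub>t \<ge> t\<^sup>5\<close>.

  Minimality of the extremals with \<open>\<bar>v\<bar> < \<pi>\<close> is shown by calibration.  The function
  \<open>S(s, x, y) = v y + A(s) x\<^sup>2 + B(s) x + C(s)\<close> with \<open>A(s) = - (v/2) tan(v(s - 1/2))\<close> and suitable \<open>B\<close>, \<open>C\<close>
  solves the Hamilton-Jacobi equation on the whole of \<open>[0,1] \<times> \<real>\<^sup>2\<close>, precisely because \<open>\<bar>v\<bar> < \<pi>\<close> keeps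
  the tangent finite.  Its increment between the end points therefore bounds half the squared length of
  every horizontal curve (\<open>calib_length_bound\<close>), and among curves of constant speed only the extremal
  attains the bound (\<open>calib_equality\<close>).  So the exponential map is injective for \<open>\<bar>v\<bar> < \<pi>\<close>, except where
  \<open>a = u = 0\<close>, and the minimizers from \<open>q\<^sub>0\<close> to
  points near \<open>exp(\<xi>)\<close> are the curves \<open>s \<mapsto> exp(s\<zeta>)\<close> with \<open>\<zeta>\<close> near \<open>\<xi>\<close>.  Hence \<open>Z\<^sub>t\<close> and the small ball
  are images of one and the same set of covectors, and the change of variables formula yields \<open>\<beta>\<^sub>t\<close>.
  The remaining points lie on the opposite vertical line \<open>x = -a\<close> at height at least
  \<open>\<pi> a\<^sup>2 / 2\<close> above or below \<open>q\<^sub>0\<close>.  There the extremals with \<open>v = \<plusminus>\<pi>\<close> are minimizing, by letting \<open>v \<rightarrow> \<plusminus>\<pi>\<close>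
  in the calibration.  For \<open>u \<noteq> 0\<close> the covectors with \<open>u\<close> and \<open>-u\<close> lead to the same point, and for \<open>u = 0\<close>
  the end point is conjugate.

  The inequality for \<open>J\<close> says that a quadratic form in \<open>(a, u/v)\<close> with coefficients depending on
  \<open>\<theta> = vt\<close>, divided by \<open>\<theta>\<^sup>4\<close>, is nonincreasing on \<open>(0, \<pi>)\<close>.  The discriminant of its derivative factors,
  and the factorization reduces everything to one bound for \<open>\<theta> cot \<theta>\<close> (\<open>cot_bound\<close>).

  No smaller exponent works: along the horizontal segment from \<open>(1, 0)\<close> to \<open>(-2, 0)\<close> one finds
  \<open>\<beta>\<^sub>t = t\<^sup>2 (1 - 3t + 3t\<^sup>2)\<close>, whose derivative at \<open>t = 1\<close> is \<open>5\<close>, so that \<open>\<beta>\<^sub>t < t\<^sup>N\<close> for \<open>t\<close> slightly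
  below \<open>1\<close> when \<open>N < 5\<close>.
\<close>


section \<open>Absolutely continuous curves\<close>

text \<open>
  A \<open>\<delta>\<close> that answers a given \<open>\<epsilon>\<close> in the definition of absolute continuity.  Naming this relation
  keeps the quantification over finite families of intervals out of the arguments below.
\<close>
definition ac_modulus :: "(real \<Rightarrow> 'a::real_normed_vector) \<Rightarrow> real \<Rightarrow> real \<Rightarrow> bool" where
  "ac_modulus \<gamma> \<epsilon> \<delta> \<longleftrightarrow> \<delta> > 0 \<and> (\<forall>(n::nat) a b.
        (\<forall>i<n. 0 \<le> a i \<and> a i \<le> b i \<and> b i \<le> 1) \<longrightarrow>
        disjoint_family_on (\<lambda>i. {a i<..<b i}) {..<n} \<longrightarrow>
        (\<Sum>i<n. b i - a i) < \<delta> \<longrightarrow>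
        (\<Sum>i<n. norm (\<gamma> (b i) - \<gamma> (a i))) < \<epsilon>)"

lemma ac_modulusD:
  assumes "ac_modulus \<gamma> \<epsilon> \<delta>" "\<And>i. i < n \<Longrightarrow> 0 \<le> a i \<and> a i \<le> b i \<and> b i \<le> 1"
    and "disjoint_family_on (\<lambda>i. {a i<..<b i}) {..<n::nat}" "(\<Sum>i<n. b i - a i) < \<delta>"
  shows "(\<Sum>i<n. norm (\<gamma> (b i) - \<gamma> (a i))) < \<epsilon>"
  using assms(1)[unfolded ac_modulus_def, THEN conjunct2, rule_format] assms(2-) by (simp add: lessThan_def)

lemma ac_curve_modulus:
  "absolutely_continuous_curve \<gamma> \<longleftrightarrow> (\<forall>\<epsilon>>0. \<exists>\<delta>. ac_modulus \<gamma> \<epsilon> \<delta>)"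
  unfolding absolutely_continuous_curve_def ac_modulus_def ..

text \<open>
  Absolute continuity passes to everything that depends on the curve and on time in a Lipschitz way.
  Components, sums and products are all obtained from this.
\<close>
lemma ac_curve_compose:
  fixes \<gamma> :: "real \<Rightarrow> 'a::real_normed_vector" and f :: "real \<Rightarrow> 'b::real_normed_vector"
  assumes ac: "absolutely_continuous_curve \<gamma>"
    and le: "\<And>a b. 0 \<le> a \<Longrightarrow> a \<le> b \<Longrightarrow> b \<le> 1 \<Longrightarrow>
               norm (f b - f a) \<le> K * (norm (\<gamma> b - \<gamma> a) + (b - a))"
  shows "absolutely_continuous_curve f"
  unfolding ac_curve_modulus
proof (intro allI impI)
  fix \<epsilon> :: real assume "\<epsilon> > 0"
  define K' where "K' = max K 1"
  have K': "K' > 0" "K \<le> K'" by (auto simp: K'_def)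
  have "\<epsilon> / (2 * K') > 0" using \<open>\<epsilon> > 0\<close> K' by simp
  then obtain \<delta> where mod: "ac_modulus \<gamma> (\<epsilon> / (2 * K')) \<delta>"
    using ac unfolding ac_curve_modulus by blast
  have \<delta>: "\<delta> > 0" using mod by (simp add: ac_modulus_def)
  show "\<exists>\<delta>. ac_modulus f \<epsilon> \<delta>"
    unfolding ac_modulus_def
  proof (intro exI[of _ "min \<delta> (\<epsilon> / (2 * K'))"] conjI allI impI)
    show "min \<delta> (\<epsilon> / (2 * K')) > 0" using \<delta> \<open>\<epsilon> / (2 * K') > 0\<close> by simp
    fix n :: nat and a b :: "nat \<Rightarrow> real"
    assume *: "\<forall>i<n. 0 \<le> a i \<and> a i \<le> b i \<and> b i \<le> 1"
      "disjoint_family_on (\<lambda>i. {a i<..<b i}) {..<n}" "(\<Sum>i<n. b i - a i) < min \<delta> (\<epsilon> / (2 * K'))"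
    have "(\<Sum>i<n. norm (f (b i) - f (a i))) \<le> (\<Sum>i<n. K' * (norm (\<gamma> (b i) - \<gamma> (a i)) + (b i - a i)))"
    proof (rule sum_mono)
      fix i assume "i \<in> {..<n}"
      then have i: "0 \<le> a i" "a i \<le> b i" "b i \<le> 1" using * by auto
      have "norm (f (b i) - f (a i)) \<le> K * (norm (\<gamma> (b i) - \<gamma> (a i)) + (b i - a i))"
        using le[OF i] .
      also have "\<dots> \<le> K' * (norm (\<gamma> (b i) - \<gamma> (a i)) + (b i - a i))"
        by (rule mult_right_mono) (use K' i in auto)
      finally show "norm (f (b i) - f (a i)) \<le> K' * (norm (\<gamma> (b i) - \<gamma> (a i)) + (b i - a i))" .
    qed
    also have "\<dots> = K' * ((\<Sum>i<n. norm (\<gamma> (b i) - \<gamma> (a i))) + (\<Sum>i<n. b i - a i))"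
      by (simp add: sum_distrib_left[symmetric] sum.distrib[symmetric])
    also have "\<dots> < K' * (\<epsilon> / (2 * K') + \<epsilon> / (2 * K'))"
      using ac_modulusD[OF mod *(1)[rule_format] *(2)] *(3) K' by (intro mult_strict_left_mono add_strict_mono) auto
    also have "\<dots> = \<epsilon>" using K' by (simp add: field_simps)
    finally show "(\<Sum>i<n. norm (f (b i) - f (a i))) < \<epsilon>" .
  qed
qed

lemma ac_curve_Pair:
  assumes f: "absolutely_continuous_curve f" and g: "absolutely_continuous_curve g"
  shows "absolutely_continuous_curve (\<lambda>s. (f s, g s))"
  unfolding ac_curve_modulus
proof (intro allI impI)
  fix \<epsilon> :: real assume "\<epsilon> > 0"
  then have "\<epsilon> / 2 > 0" by simp
  then obtain \<delta>1 \<delta>2 where mod: "ac_modulus f (\<epsilon> / 2) \<delta>1" "ac_modulus g (\<epsilon> / 2) \<delta>2"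
    using f g unfolding ac_curve_modulus by blast
  have "\<delta>1 > 0" "\<delta>2 > 0" using mod by (simp_all add: ac_modulus_def)
  show "\<exists>\<delta>. ac_modulus (\<lambda>s. (f s, g s)) \<epsilon> \<delta>"
    unfolding ac_modulus_def
  proof (intro exI[of _ "min \<delta>1 \<delta>2"] conjI allI impI)
    show "min \<delta>1 \<delta>2 > 0" using \<open>\<delta>1 > 0\<close> \<open>\<delta>2 > 0\<close> by simp
    fix n :: nat and a b :: "nat \<Rightarrow> real"
    assume *: "\<forall>i<n. 0 \<le> a i \<and> a i \<le> b i \<and> b i \<le> 1"
      "disjoint_family_on (\<lambda>i. {a i<..<b i}) {..<n}" "(\<Sum>i<n. b i - a i) < min \<delta>1 \<delta>2"
    have "(\<Sum>i<n. norm ((f (b i), g (b i)) - (f (a i), g (a i))))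
        \<le> (\<Sum>i<n. norm (f (b i) - f (a i)) + norm (g (b i) - g (a i)))"
      by (intro sum_mono) (simp add: norm_Pair_le)
    also have "\<dots> < \<epsilon> / 2 + \<epsilon> / 2"
      unfolding sum.distrib
      using ac_modulusD[OF mod(1) *(1)[rule_format] *(2)] ac_modulusD[OF mod(2) *(1)[rule_format] *(2)] *(3)
      by (intro add_strict_mono) auto
    finally show "(\<Sum>i<n. norm ((f (b i), g (b i)) - (f (a i), g (a i)))) < \<epsilon>" by simp
  qed
qed

lemma ac_curve_lipschitz:
  fixes f :: "real \<Rightarrow> 'b::real_normed_vector"
  assumes "\<And>a b. 0 \<le> a \<Longrightarrow> a \<le> b \<Longrightarrow> b \<le> 1 \<Longrightarrow> norm (f b - f a) \<le> K * (b - a)"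
  shows "absolutely_continuous_curve f"
proof -
  have "absolutely_continuous_curve (\<lambda>s. 0 :: real)"
    unfolding absolutely_continuous_curve_def by (auto intro: exI[of _ 1])
  then show ?thesis
    by (rule ac_curve_compose[where K=K]) (use assms in simp)
qed

lemma ac_curve_C1:
  fixes f :: "real \<Rightarrow> 'b::real_normed_vector"
  assumes d: "\<And>s. s \<in> {0..1} \<Longrightarrow> (f has_vector_derivative f' s) (at s within {0..1})"
    and c: "continuous_on {0..1} f'"
  shows "absolutely_continuous_curve f"
proof -
  have "bounded (f' ` {0..1})"
    by (intro compact_imp_bounded compact_continuous_image c) auto
  then obtain K where K: "\<And>s. s \<in> {0..1} \<Longrightarrow> norm (f' s) \<le> K"
    unfolding bounded_iff by (metis imageI)
  have "norm (f b - f a) \<le> K * (b - a)" if "0 \<le> a" "a \<le> b" "b \<le> 1" for a b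
  proof -
    have "norm (f b - f a) \<le> K * norm (b - a)"
    proof (rule differentiable_bound[where S="{0..1}" and f'="\<lambda>s h. h *\<^sub>R f' s"])
      fix x :: real assume x: "x \<in> {0..1}"
      show "(f has_derivative (\<lambda>h. h *\<^sub>R f' x)) (at x within {0..1})"
        using d[OF x] by (simp add: has_vector_derivative_def)
      show "onorm (\<lambda>h. h *\<^sub>R f' x) \<le> K"
        by (rule onorm_bound) (use K[OF x] order_trans[OF norm_ge_zero K[OF x]] in \<open>auto simp: mult.commute[of "\<bar>_\<bar>"] mult_right_mono\<close>)
    qed (use that in auto)
    then show ?thesis using that by simp
  qed
  then show ?thesis by (rule ac_curve_lipschitz)
qed

lemma ac_curve_continuous:
  fixes f :: "real \<Rightarrow> 'b::real_normed_vector"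
  assumes ac: "absolutely_continuous_curve f"
  shows "continuous_on {0..1} f"
  unfolding continuous_on_iff
proof (intro ballI allI impI)
  fix x \<epsilon> :: real assume x: "x \<in> {0..1}" and "\<epsilon> > 0"
  then obtain \<delta> where mod: "ac_modulus f (\<epsilon>) \<delta>"
    using ac unfolding ac_curve_modulus by blast
  have \<delta>: "\<delta> > 0" using mod by (simp add: ac_modulus_def)
  have *: "norm (f b - f a) < \<epsilon>" if "0 \<le> a" "a \<le> b" "b \<le> 1" "b - a < \<delta>" for a b
    using ac_modulusD[OF mod, of "Suc 0" "\<lambda>_. a" "\<lambda>_. b"] that by (simp add: disjoint_family_on_def)
  show "\<exists>d>0. \<forall>x'\<in>{0..1}. dist x' x < d \<longrightarrow> dist (f x') (f x) < \<epsilon>"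
  proof (intro exI[of _ \<delta>] conjI ballI impI \<delta>)
    fix x' assume "x' \<in> {0..1}" "dist x' x < \<delta>"
    then show "dist (f x') (f x) < \<epsilon>"
      using *[of x x'] *[of x' x] x by (cases "x \<le> x'") (auto simp: dist_norm norm_minus_commute)
  qed
qed

lemma ac_curve_add:
  fixes f g :: "real \<Rightarrow> real"
  assumes "absolutely_continuous_curve f" "absolutely_continuous_curve g"
  shows "absolutely_continuous_curve (\<lambda>s. f s + g s)"
proof (rule ac_curve_compose[OF ac_curve_Pair[OF assms], where K = 2])
  fix a b :: real assume "a \<le> b"
  have "\<bar>f b - f a\<bar> \<le> norm (f b - f a, g b - g a)" "\<bar>g b - g a\<bar> \<le> norm (f b - f a, g b - g a)"
    by (metis norm_fst_le real_norm_def) (metis norm_snd_le real_norm_def)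
  then show "norm (f b + g b - (f a + g a)) \<le> 2 * (norm ((f b, g b) - (f a, g a)) + (b - a))"
    using \<open>a \<le> b\<close> by auto
qed

lemma ac_curve_mult:
  fixes f g :: "real \<Rightarrow> real"
  assumes f: "absolutely_continuous_curve f" and g: "absolutely_continuous_curve g"
  shows "absolutely_continuous_curve (\<lambda>s. f s * g s)"
proof -
  have "bounded (f ` {0..1})" "bounded (g ` {0..1})"
    by (intro compact_imp_bounded compact_continuous_image ac_curve_continuous assms; simp)+
  then obtain M1 M2 where M: "\<And>s. s \<in> {0..1} \<Longrightarrow> \<bar>f s\<bar> \<le> M1" "\<And>s. s \<in> {0..1} \<Longrightarrow> \<bar>g s\<bar> \<le> M2"
    unfolding bounded_iff by (metis imageI real_norm_def)
  show ?thesis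
  proof (rule ac_curve_compose[OF ac_curve_Pair[OF f g], where K = "M1 + M2"])
    fix a b :: real assume ab: "0 \<le> a" "a \<le> b" "b \<le> 1"
    have *: "\<bar>f b - f a\<bar> \<le> norm (f b - f a, g b - g a)" "\<bar>g b - g a\<bar> \<le> norm (f b - f a, g b - g a)"
      by (metis norm_fst_le real_norm_def) (metis norm_snd_le real_norm_def)
    have M0: "\<bar>f b\<bar> \<le> M1" "\<bar>g a\<bar> \<le> M2" using M ab by auto
    have "f b * g b - f a * g a = f b * (g b - g a) + (f b - f a) * g a" by (simp add: algebra_simps)
    then have "\<bar>f b * g b - f a * g a\<bar> \<le> \<bar>f b\<bar> * \<bar>g b - g a\<bar> + \<bar>f b - f a\<bar> * \<bar>g a\<bar>"
      using abs_triangle_ineq[of "f b * (g b - g a)" "(f b - f a) * g a"] by (simp add: abs_mult)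
    also have "\<dots> \<le> M1 * norm (f b - f a, g b - g a) + norm (f b - f a, g b - g a) * M2"
      using * M0 by (intro add_mono mult_mono) auto
    also have "\<dots> = (M1 + M2) * norm (f b - f a, g b - g a)" by (simp add: algebra_simps)
    also have "\<dots> \<le> (M1 + M2) * (norm (f b - f a, g b - g a) + (b - a))"
      using M0 ab by (intro mult_left_mono) auto
    finally show "norm (f b * g b - f a * g a) \<le> (M1 + M2) * (norm ((f b, g b) - (f a, g a)) + (b - a))"
      by simp
  qed
qed

lemma ac_curve_fst:
  fixes \<gamma> :: "real \<Rightarrow> 'a::real_normed_vector \<times> 'b::real_normed_vector"
  assumes "absolutely_continuous_curve \<gamma>"
  shows "absolutely_continuous_curve (\<lambda>s. fst (\<gamma> s))"
proof (rule ac_curve_compose[OF assms, where K = 1])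
  fix a b :: real assume "a \<le> b"
  have "norm (fst (\<gamma> b - \<gamma> a)) \<le> norm (\<gamma> b - \<gamma> a)" by (metis norm_fst_le prod.collapse)
  with \<open>a \<le> b\<close> show "norm (fst (\<gamma> b) - fst (\<gamma> a)) \<le> 1 * (norm (\<gamma> b - \<gamma> a) + (b - a))" by simp
qed

lemma ac_curve_snd:
  fixes \<gamma> :: "real \<Rightarrow> 'a::real_normed_vector \<times> 'b::real_normed_vector"
  assumes "absolutely_continuous_curve \<gamma>"
  shows "absolutely_continuous_curve (\<lambda>s. snd (\<gamma> s))"
proof (rule ac_curve_compose[OF assms, where K = 1])
  fix a b :: real assume "a \<le> b"
  have "norm (snd (\<gamma> b - \<gamma> a)) \<le> norm (\<gamma> b - \<gamma> a)" by (metis norm_snd_le prod.collapse)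
  with \<open>a \<le> b\<close> show "norm (snd (\<gamma> b) - snd (\<gamma> a)) \<le> 1 * (norm (\<gamma> b - \<gamma> a) + (b - a))" by simp
qed

lemma ac_curve_diff:
  fixes f g :: "real \<Rightarrow> real"
  assumes f: "absolutely_continuous_curve f" and g: "absolutely_continuous_curve g"
  shows "absolutely_continuous_curve (\<lambda>s. f s - g s)"
proof -
  have "absolutely_continuous_curve (\<lambda>s. - g s)"
    by (rule ac_curve_compose[OF g, where K = 1]) (simp add: norm_minus_commute)
  from ac_curve_add[OF f this] show ?thesis by simp
qed

text \<open>
  The fundamental theorem of calculus for absolutely continuous functions, in gauge form.  Off the
  null set \<open>N\<close> where the derivative fails to exist, the gauge makes each increment close to derivative
  times length.  The intervals tagged in \<open>N\<close> all lie in one open set of measure less than \<open>\<delta>\<close>, so their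
  increments add up to little by absolute continuity.
\<close>
theorem ac_curve_has_integral:
  fixes f g :: "real \<Rightarrow> real"
  assumes ac: "absolutely_continuous_curve f"
    and ae: "AE s in lebesgue_on {0..1}. (f has_vector_derivative g s) (at s within {0..1})"
    and t: "0 \<le> t" "t \<le> 1"
  shows "(g has_integral f t - f 0) {0..t}"
proof -
  obtain N where N: "N \<in> null_sets (lebesgue_on {0..1})"
    and der: "\<And>s. s \<in> {0..1} - N \<Longrightarrow> (f has_vector_derivative g s) (at s within {0..1})"
    using AE_E3[OF ae] by (metis Diff_iff space_lebesgue_on)
  have negN: "negligible N"
    using N by (simp add: negligible_iff_null_sets null_sets_restrict_space)
  define h where "h s = (if s \<in> N then 0 else g s)" for s
  have "(h has_integral f t - f 0) {0..t}"
    unfolding has_integral_real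
  proof (intro allI impI)
    fix e :: real assume "e > 0"
    then obtain \<delta> where mod: "ac_modulus f (e / 2) \<delta>"
      using ac unfolding ac_curve_modulus by (metis half_gt_zero)
    have \<delta>: "\<delta> > 0" using mod by (simp add: ac_modulus_def)
    obtain T where T: "open T" "N \<subseteq> T" "T - N \<in> lmeasurable" "emeasure lebesgue (T - N) < ennreal \<delta>"
      using sets_lebesgue_outer_open[OF _ \<delta>, of N] negN
      by (metis negligible_iff_null_sets null_setsD2)
    have Tm: "T \<in> lmeasurable" "measure lebesgue T < \<delta>"
    proof -
      have eq: "T = (T - N) \<union> N" using T(2) by auto
      have "N \<in> lmeasurable" using negN by (simp add: negligible_imp_measurable)
      then show "T \<in> lmeasurable" using T(3) eq by (metis fmeasurable.Un)
      have "measure lebesgue T = measure lebesgue (T - N)"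
        by (metis negN negligible_iff_null_sets measure_Diff_null_set \<open>T \<in> lmeasurable\<close> fmeasurableD)
      also have "\<dots> < \<delta>"
        using T(3,4) \<delta> by (simp add: emeasure_eq_measure2 ennreal_less_iff)
      finally show "measure lebesgue T < \<delta>" .
    qed
    have "\<exists>d>0. \<forall>z\<in>{0..1}. \<bar>z - s\<bar> < d \<longrightarrow> \<bar>f z - f s - (z - s) * g s\<bar> \<le> e / 4 * \<bar>z - s\<bar>" if "s \<in> {0..1} - N" for s
    proof -
      have "e / 4 > 0" using \<open>e > 0\<close> by simp
      then show ?thesis
        using der[OF that] unfolding has_vector_derivative_def has_derivative_within_alt
        by (simp only: real_norm_def real_scaleR_def)
    qed
    then obtain d1 where d1: "\<And>s. s \<in> {0..1} - N \<Longrightarrow> d1 s > 0 \<and>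
        (\<forall>z\<in>{0..1}. \<bar>z - s\<bar> < d1 s \<longrightarrow> \<bar>f z - f s - (z - s) * g s\<bar> \<le> e / 4 * \<bar>z - s\<bar>)"
      by metis
    have "\<exists>d>0. ball s d \<subseteq> T" if "s \<in> N" for s
      using T(1,2) that unfolding open_contains_ball by blast
    then obtain d2 where d2: "\<And>s. s \<in> N \<Longrightarrow> d2 s > 0 \<and> ball s (d2 s) \<subseteq> T" by metis
    define dd where "dd s = (if s \<in> N then d2 s else if s \<in> {0..1} then d1 s else 1)" for s
    have dd: "dd s > 0" for s using d1 d2 by (auto simp: dd_def)
    show "\<exists>\<gamma>. gauge \<gamma> \<and> (\<forall>\<D>. \<D> tagged_division_of {0..t} \<and> \<gamma> fine \<D> \<longrightarrow>
            norm ((\<Sum>(x, k)\<in>\<D>. measure lborel k *\<^sub>R h x) - (f t - f 0)) < e)"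
    proof (intro exI[of _ "\<lambda>s. ball s (dd s)"] conjI allI impI)
      show "gauge (\<lambda>s. ball s (dd s))" using dd by (rule gauge_ball_dependent[rule_format])
      fix \<D> assume "\<D> tagged_division_of {0..t} \<and> (\<lambda>s. ball s (dd s)) fine \<D>"
      then have D: "\<D> tagged_division_of {0..t}" and fine: "(\<lambda>s. ball s (dd s)) fine \<D>" by auto
      have finD: "finite \<D>" using D by auto
      have tele: "(\<Sum>(x, k)\<in>\<D>. f (Sup k) - f (Inf k)) = f t - f 0"
        using additive_tagged_division_1[OF t(1) D, of f] .
      have Dk: "x \<in> k \<and> k \<subseteq> {0..t} \<and> (\<exists>c d. k = {c..d} \<and> c \<le> d)" if "(x, k) \<in> \<D>" for x k
        using tagged_division_ofD(2,3,4)[OF D that] by (metis atLeastatMost_empty_iff box_real(2) empty_iff)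
      define E where "E p = (case p of (x, k) \<Rightarrow> measure lborel k *\<^sub>R h x - (f (Sup k) - f (Inf k)))" for p
      have sumE: "(\<Sum>(x, k)\<in>\<D>. measure lborel k *\<^sub>R h x) - (f t - f 0) = (\<Sum>p\<in>\<D>. E p)"
        unfolding tele[symmetric] sum_subtractf[symmetric] E_def by (rule sum.cong) auto
      define D1 where "D1 = {p\<in>\<D>. fst p \<notin> N}"
      define D2 where "D2 = {p\<in>\<D>. fst p \<in> N}"
      have split: "(\<Sum>p\<in>\<D>. E p) = (\<Sum>p\<in>D1. E p) + (\<Sum>p\<in>D2. E p)"
        unfolding D1_def D2_def by (subst sum.union_disjoint[symmetric]) (auto simp: finD intro: sum.cong)
      have E1: "\<bar>E p\<bar> \<le> e / 4 * measure lborel (snd p)" if "p \<in> D1" for p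
      proof -
        obtain x k where p: "p = (x, k)" by force
        have xk: "(x, k) \<in> \<D>" "x \<notin> N" using that p by (auto simp: D1_def)
        obtain c d where cd: "x \<in> k" "k \<subseteq> {0..t}" "k = {c..d}" "c \<le> d" using Dk[OF xk(1)] by auto
        have x01: "x \<in> {0..1}" using cd t by auto
        have "k \<subseteq> ball x (dd x)" using fine xk(1) by (auto simp: fine_def)
        then have "c \<in> ball x (dd x)" "d \<in> ball x (dd x)" using cd(3,4) by fastforce+
        then have *: "\<bar>c - x\<bar> < d1 x" "\<bar>d - x\<bar> < d1 x" using xk(2) x01 by (auto simp: dd_def dist_real_def)
        have c01: "c \<in> {0..1}" "d \<in> {0..1}" "c \<le> x" "x \<le> d" using cd t by auto
        have "\<bar>f c - f x - (c - x) * g x\<bar> \<le> e / 4 * \<bar>c - x\<bar>" "\<bar>f d - f x - (d - x) * g x\<bar> \<le> e / 4 * \<bar>d - x\<bar>"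
          using d1[of x, THEN conjunct2, rule_format, of c] d1[of x, THEN conjunct2, rule_format, of d] x01 xk(2) * c01(1,2)
          by blast+
        then have "\<bar>(d - c) * g x - (f d - f c)\<bar> \<le> e / 4 * \<bar>c - x\<bar> + e / 4 * \<bar>d - x\<bar>"
        proof -
          have "(d - c) * g x - (f d - f c) = (f c - f x - (c - x) * g x) - (f d - f x - (d - x) * g x)"
            by (simp add: algebra_simps)
          then show ?thesis
            using abs_triangle_ineq4[of "f c - f x - (c - x) * g x" "f d - f x - (d - x) * g x"]
              \<open>\<bar>f c - f x - (c - x) * g x\<bar> \<le> e / 4 * \<bar>c - x\<bar>\<close> \<open>\<bar>f d - f x - (d - x) * g x\<bar> \<le> e / 4 * \<bar>d - x\<bar>\<close>
            by linarith
        qed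
        also have "\<dots> = e / 4 * (d - c)" using c01 by (simp add: abs_if field_simps)
        finally show ?thesis using cd xk(2) by (simp add: p E_def h_def)
      qed
      have "\<bar>\<Sum>p\<in>D1. E p\<bar> \<le> (\<Sum>p\<in>D1. e / 4 * measure lborel (snd p))"
        by (rule order_trans[OF sum_abs sum_mono]) (use E1 in auto)
      also have "\<dots> \<le> (\<Sum>p\<in>\<D>. e / 4 * measure lborel (snd p))"
        by (rule sum_mono2) (use finD \<open>e > 0\<close> in \<open>auto simp: D1_def\<close>)
      also have "\<dots> = e / 4 * t"
        using additive_content_tagged_division[of \<D> 0 t] D t
        unfolding sum_distrib_left[symmetric] by (simp add: split_beta)
      also have "\<dots> \<le> e / 4 * 1" using t \<open>e > 0\<close> by (intro mult_left_mono) auto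
      finally have S1: "\<bar>\<Sum>p\<in>D1. E p\<bar> \<le> e / 4" by simp
      obtain \<phi> where bij: "bij_betw \<phi> {..<card D2} D2"
        using ex_bij_betw_nat_finite[of D2] finD by (auto simp: D2_def atLeast0LessThan)
      define A where "A i = Inf (snd (\<phi> i))" for i
      define B where "B i = Sup (snd (\<phi> i))" for i
      have phi: "\<exists>x k. \<phi> i = (x, k) \<and> (x, k) \<in> \<D> \<and> x \<in> N \<and> k = {A i..B i} \<and> A i \<le> B i \<and> 0 \<le> A i \<and> B i \<le> 1
             \<and> {A i..B i} \<subseteq> T" if "i < card D2" for i
      proof -
        have "\<phi> i \<in> D2" using bij that by (auto simp: bij_betw_def)
        then obtain x k where xk: "\<phi> i = (x, k)" "(x, k) \<in> \<D>" "x \<in> N"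
          unfolding D2_def by (metis (mono_tags, lifting) fst_conv mem_Collect_eq surj_pair)
        obtain c d where cd: "x \<in> k" "k \<subseteq> {0..t}" "k = {c..d}" "c \<le> d" using Dk[OF xk(2)] by auto
        have AB: "A i = c" "B i = d" using cd xk by (auto simp: A_def B_def)
        have "k \<subseteq> ball x (dd x)" using fine xk(2) by (auto simp: fine_def)
        then have "k \<subseteq> T" using d2[OF xk(3)] xk(3) by (auto simp: dd_def)
        then show ?thesis using xk cd AB t by auto
      qed
      have disj: "disjoint_family_on (\<lambda>i. {A i<..<B i}) {..<card D2}"
        unfolding disjoint_family_on_def
      proof (intro ballI impI)
        fix i j assume ij: "i \<in> {..<card D2}" "j \<in> {..<card D2}" "i \<noteq> j"
        have "\<phi> i \<noteq> \<phi> j" using bij ij by (auto simp: bij_betw_def inj_on_def)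
        moreover obtain x k x' k' where "\<phi> i = (x, k)" "(x, k) \<in> \<D>" "k = {A i..B i}" "\<phi> j = (x', k')" "(x', k') \<in> \<D>" "k' = {A j..B j}"
          using phi ij by (metis lessThan_iff)
        ultimately show "{A i<..<B i} \<inter> {A j<..<B j} = {}"
          using tagged_division_ofD(5)[OF D, of x k x' k'] by (auto simp: interior_atLeastAtMost_real)
      qed
      have fin: "emeasure lebesgue {A i<..<B i} \<noteq> \<infinity>" if "i < card D2" for i
      proof -
        have "A i \<le> B i" using phi[OF that] by blast
        then show ?thesis by simp
      qed
      have "(\<Sum>i<card D2. B i - A i) = (\<Sum>i<card D2. measure lebesgue {A i<..<B i})"
        by (rule sum.cong) (use phi in \<open>force+\<close>)
      also have "\<dots> = measure lebesgue (\<Union>i<card D2. {A i<..<B i})"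
        by (rule measure_finite_Union[symmetric]) (use disj fin in auto)
      also have "\<dots> \<le> measure lebesgue T"
        by (rule measure_mono_fmeasurable) (use phi Tm in \<open>force+\<close>)
      finally have small: "(\<Sum>i<card D2. B i - A i) < \<delta>" using Tm by linarith
      have "\<bar>\<Sum>p\<in>D2. E p\<bar> \<le> (\<Sum>p\<in>D2. \<bar>E p\<bar>)" by (rule sum_abs)
      also have "\<dots> = (\<Sum>i<card D2. \<bar>E (\<phi> i)\<bar>)"
        using sum.reindex_bij_betw[OF bij, of "\<lambda>p. \<bar>E p\<bar>"] by simp
      also have "\<dots> = (\<Sum>i<card D2. norm (f (B i) - f (A i)))"
      proof (rule sum.cong[OF refl])
        fix i assume "i \<in> {..<card D2}"
        then obtain x k where "\<phi> i = (x, k)" "x \<in> N" "k = {A i..B i}" "A i \<le> B i" using phi by (metis lessThan_iff)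
        then show "\<bar>E (\<phi> i)\<bar> = norm (f (B i) - f (A i))" by (simp add: E_def h_def abs_minus_commute)
      qed
      also have "\<dots> < e / 2"
        by (rule ac_modulusD[OF mod _ disj small]) (use phi in blast)
      finally have S2: "\<bar>\<Sum>p\<in>D2. E p\<bar> < e / 2" .
      show "norm ((\<Sum>(x, k)\<in>\<D>. measure lborel k *\<^sub>R h x) - (f t - f 0)) < e"
        unfolding sumE split real_norm_def using S1 S2 \<open>e > 0\<close> by linarith
    qed
  qed
  then show ?thesis
    by (rule has_integral_spike[OF negN, rotated]) (auto simp: h_def)
qed

lemma ac_curve_const:
  fixes f :: "real \<Rightarrow> real"
  assumes ac: "absolutely_continuous_curve f"
    and ae: "AE s in lebesgue_on {0..1}. (f has_vector_derivative 0) (at s within {0..1})"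
    and t: "t \<in> {0..1}"
  shows "f t = f 0"
  using has_integral_unique[OF ac_curve_has_integral[OF ac ae, of t] has_integral_0[of "{0..t}"]] t by auto


section \<open>Area of injective images in the plane\<close>

text \<open>
  Neither \<open>Z\<close> nor the balls are known to be measurable.  Outer regularity allows sets to be compared
  through their open supersets, which behave well under images and preimages.
\<close>
lemma outer_measure_lebesgue_open:
  fixes S :: "'a::euclidean_space set"
  shows "outer_measure_of lebesgue S = (INF T\<in>{T. open T \<and> S \<subseteq> T}. emeasure lborel T)"
proof (rule antisym)
  show "outer_measure_of lebesgue S \<le> (INF T\<in>{T. open T \<and> S \<subseteq> T}. emeasure lborel T)"
  proof (rule INF_greatest)
    fix T assume "T \<in> {T. open T \<and> S \<subseteq> T}"
    then show "outer_measure_of lebesgue S \<le> emeasure lborel T"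
      using outer_measure_of_mono[of S T lebesgue] by simp
  qed
  show "(INF T\<in>{T. open T \<and> S \<subseteq> T}. emeasure lborel T) \<le> outer_measure_of lebesgue S"
    unfolding outer_measure_of_def
  proof (rule INF_greatest)
    fix B assume "B \<in> {B \<in> sets lebesgue. S \<subseteq> B}"
    then have B: "B \<in> sets lebesgue" "S \<subseteq> B" by auto
    show "(INF T\<in>{T. open T \<and> S \<subseteq> T}. emeasure lborel T) \<le> emeasure lebesgue B"
    proof (rule ennreal_le_epsilon)
      fix e :: real assume "e > 0"
      obtain T where T: "open T" "B \<subseteq> T" "(T - B) \<in> lmeasurable" "emeasure lebesgue (T - B) < ennreal e"
        using sets_lebesgue_outer_open[OF B(1) \<open>e > 0\<close>] .
      have "(INF T\<in>{T. open T \<and> S \<subseteq> T}. emeasure lborel T) \<le> emeasure lborel T"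
        by (rule INF_lower) (use T B in auto)
      also have "\<dots> = emeasure lebesgue T" using T(1) by simp
      also have "\<dots> = emeasure lebesgue (B \<union> (T - B))" using T(2) by (metis Diff_partition)
      also have "\<dots> \<le> emeasure lebesgue B + emeasure lebesgue (T - B)"
        by (rule emeasure_subadditive) (use B T in auto)
      also have "\<dots> \<le> emeasure lebesgue B + ennreal e"
        using T(4) by (intro add_left_mono) simp
      finally show "(INF T\<in>{T. open T \<and> S \<subseteq> T}. emeasure lborel T) \<le> emeasure lebesgue B + ennreal e" .
    qed
  qed
qed

lemma injective_image_open_measure:
  fixes F :: "real^2 \<Rightarrow> real^2"
  assumes U: "open U" "bounded U" and inj: "inj_on F U"
    and der: "\<And>x. x \<in> U \<Longrightarrow> (F has_derivative F' x) (at x)"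
    and cont: "continuous_on U (\<lambda>x. det (matrix (F' x)))"
    and m: "\<And>x. x \<in> U \<Longrightarrow> m \<le> \<bar>det (matrix (F' x))\<bar>" "\<And>x. x \<in> U \<Longrightarrow> \<bar>det (matrix (F' x))\<bar> \<le> M"
    and T: "open T" "T \<subseteq> U"
  shows "F ` T \<in> lmeasurable" "m * measure lebesgue T \<le> measure lebesgue (F ` T)"
    "measure lebesgue (F ` T) \<le> M * measure lebesgue T"
proof -
  have bT: "bounded T" using T(2) U(2) by (rule bounded_subset[rotated])
  have Tm: "T \<in> lmeasurable" using T(1) bT by (rule lmeasurable_open[rotated])
  have der': "(F has_derivative F' x) (at x within T)" if "x \<in> T" for x
    using der T(2) that by (meson has_derivative_at_withinI subsetD)
  have "(\<lambda>x. \<bar>det (matrix (F' x))\<bar>) absolutely_integrable_on T"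
  proof (rule measurable_bounded_by_integrable_imp_absolutely_integrable)
    have "continuous_on T (\<lambda>x. \<bar>det (matrix (F' x))\<bar>)"
      using continuous_on_subset[OF cont T(2)] by (intro continuous_intros)
    then show "(\<lambda>x. \<bar>det (matrix (F' x))\<bar>) \<in> borel_measurable (lebesgue_on T)"
      by (rule continuous_imp_measurable_on_sets_lebesgue) (use Tm in auto)
    show "(\<lambda>x. M) integrable_on T" using Tm by (simp add: integrable_on_const)
    show "T \<in> sets lebesgue" using Tm by auto
  qed (use m T(2) in auto)
  then have int: "(\<lambda>x. \<bar>det (matrix (F' x))\<bar>) integrable_on T"
    by (simp add: absolutely_integrable_on_def)
  have "F ` T \<in> lmeasurable \<and> measure lebesgue (F ` T) = integral T (\<lambda>x. \<bar>det (matrix (F' x))\<bar>)"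
    using has_measure_differentiable_image[OF fmeasurableD[OF Tm] der' inj_on_subset[OF inj T(2)]] int
    by (meson integrable_integral)
  moreover have "m * measure lebesgue T \<le> integral T (\<lambda>x. \<bar>det (matrix (F' x))\<bar>)"
  proof -
    have "m * measure lebesgue T = integral T (\<lambda>x. m)"
      using Tm integral_mult_right[of T m "\<lambda>x. 1"] by (simp add: lmeasure_integral)
    also have "\<dots> \<le> integral T (\<lambda>x. \<bar>det (matrix (F' x))\<bar>)"
      by (rule integral_le) (use Tm int m T(2) in \<open>auto simp: integrable_on_const\<close>)
    finally show ?thesis .
  qed
  moreover have "integral T (\<lambda>x. \<bar>det (matrix (F' x))\<bar>) \<le> M * measure lebesgue T"
  proof -
    have "integral T (\<lambda>x. \<bar>det (matrix (F' x))\<bar>) \<le> integral T (\<lambda>x. M)"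
      by (rule integral_le) (use Tm int m T(2) in \<open>auto simp: integrable_on_const\<close>)
    also have "\<dots> = M * measure lebesgue T"
      using Tm integral_mult_right[of T M "\<lambda>x. 1"] by (simp add: lmeasure_integral)
    finally show ?thesis .
  qed
  ultimately show "F ` T \<in> lmeasurable" "m * measure lebesgue T \<le> measure lebesgue (F ` T)"
    "measure lebesgue (F ` T) \<le> M * measure lebesgue T" by auto
qed

text \<open>
  For the lower bound an open superset of the image is pulled back to an open superset of \<open>W\<close>; for the
  upper bound an open superset of \<open>W\<close> is pushed forward.  Both steps stay inside \<open>U\<close>, where the Jacobian
  is controlled.
\<close>
lemma injective_image_outer_measure_vec:
  fixes F :: "real^2 \<Rightarrow> real^2"
  assumes U: "open U" "bounded U" and inj: "inj_on F U"
    and der: "\<And>x. x \<in> U \<Longrightarrow> (F has_derivative F' x) (at x)"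
    and cont: "continuous_on U (\<lambda>x. det (matrix (F' x)))"
    and m: "\<And>x. x \<in> U \<Longrightarrow> m \<le> \<bar>det (matrix (F' x))\<bar>" "\<And>x. x \<in> U \<Longrightarrow> \<bar>det (matrix (F' x))\<bar> \<le> M"
    and m0: "0 < m" "0 < M"
    and W: "W \<subseteq> U"
  shows "ennreal m * outer_measure_of lebesgue W \<le> outer_measure_of lebesgue (F ` W)"
    and "outer_measure_of lebesgue (F ` W) \<le> ennreal M * outer_measure_of lebesgue W"
proof -
  have im: "F ` T \<in> lmeasurable" "m * measure lebesgue T \<le> measure lebesgue (F ` T)"
    "measure lebesgue (F ` T) \<le> M * measure lebesgue T" if "open T" "T \<subseteq> U" for T
    using injective_image_open_measure[OF U inj _ cont _ _ that, of m M] der m by blast+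
  show "ennreal m * outer_measure_of lebesgue W \<le> outer_measure_of lebesgue (F ` W)"
    unfolding outer_measure_lebesgue_open[of "F ` W"]
  proof (rule INF_greatest)
    fix T assume "T \<in> {T. open T \<and> F ` W \<subseteq> T}"
    then have T: "open T" "F ` W \<subseteq> T" by auto
    define V where "V = U \<inter> F -` T"
    have contF: "continuous_on U F"
      by (intro continuous_at_imp_continuous_on ballI has_derivative_continuous[OF der])
    have V: "open V" "V \<subseteq> U" unfolding V_def
      using continuous_open_preimage[OF contF U(1) T(1)] by auto
    have Vm: "V \<in> lmeasurable" using V U by (meson bounded_subset lmeasurable_open)
    have "ennreal m * outer_measure_of lebesgue W \<le> ennreal m * outer_measure_of lebesgue V"
      by (intro mult_left_mono outer_measure_of_mono) (use W T in \<open>auto simp: V_def\<close>)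
    also have "\<dots> = ennreal (m * measure lebesgue V)"
      using Vm m0 by (simp add: emeasure_eq_measure2 ennreal_mult fmeasurableD)
    also have "\<dots> \<le> ennreal (measure lebesgue (F ` V))"
      by (rule ennreal_leI) (rule im[OF V])
    also have "\<dots> = emeasure lebesgue (F ` V)"
      using im(1)[OF V] by (simp add: emeasure_eq_measure2)
    also have "\<dots> \<le> emeasure lebesgue T"
      by (rule emeasure_mono) (use T in \<open>auto simp: V_def\<close>)
    finally show "ennreal m * outer_measure_of lebesgue W \<le> emeasure lborel T" using T(1) by simp
  qed
  have "outer_measure_of lebesgue (F ` W) / ennreal M \<le> outer_measure_of lebesgue W"
    unfolding outer_measure_lebesgue_open[of W]
  proof (rule INF_greatest)
    fix T assume "T \<in> {T. open T \<and> W \<subseteq> T}"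
    then have T: "open T" "W \<subseteq> T" by auto
    define V where "V = U \<inter> T"
    have V: "open V" "V \<subseteq> U" "W \<subseteq> V" using T W U by (auto simp: V_def)
    have Vm: "V \<in> lmeasurable" using V U by (meson bounded_subset lmeasurable_open)
    have "outer_measure_of lebesgue (F ` W) \<le> outer_measure_of lebesgue (F ` V)"
      by (intro outer_measure_of_mono) (use V in auto)
    also have "\<dots> = ennreal (measure lebesgue (F ` V))"
      using im(1)[OF V(1,2)] by (simp add: emeasure_eq_measure2 fmeasurableD)
    also have "\<dots> \<le> ennreal (M * measure lebesgue V)"
      by (rule ennreal_leI) (rule im[OF V(1,2)])
    also have "\<dots> = ennreal M * emeasure lebesgue V"
      using Vm m0 by (simp add: emeasure_eq_measure2 ennreal_mult)
    also have "\<dots> \<le> ennreal M * emeasure lebesgue T"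
      by (intro mult_left_mono emeasure_mono) (use T in \<open>auto simp: V_def\<close>)
    finally show "outer_measure_of lebesgue (F ` W) / ennreal M \<le> emeasure lborel T" using T(1) m0
      by (simp add: divide_le_posI_ennreal)
  qed
  then have "ennreal M * (outer_measure_of lebesgue (F ` W) / ennreal M) \<le> ennreal M * outer_measure_of lebesgue W"
    by (intro mult_left_mono) auto
  moreover have "ennreal M * (outer_measure_of lebesgue (F ` W) / ennreal M) = outer_measure_of lebesgue (F ` W)"
    using m0 by (simp add: ennreal_times_divide mult.commute[of "ennreal M"] mult_divide_eq_ennreal)
  ultimately show "outer_measure_of lebesgue (F ` W) \<le> ennreal M * outer_measure_of lebesgue W"
    by simp
qed

text \<open>
  The change of variables formula concerns vectors of type \<^typ>\<open>real^2\<close>; this identification with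
  pairs transports it to the plane without changing areas.
\<close>
definition pair_of_vec :: "real^2 \<Rightarrow> plane" where "pair_of_vec v = (v $ 1, v $ 2)"
definition vec_of_pair :: "plane \<Rightarrow> real^2" where "vec_of_pair p = vector [fst p, snd p]"

lemma pair_of_vec_vec_of_pair [simp]: "pair_of_vec (vec_of_pair p) = p" "vec_of_pair (pair_of_vec v) = v"
  by (auto simp: pair_of_vec_def vec_of_pair_def vec_eq_iff forall_2)

lemma linear_pair_of_vec: "linear pair_of_vec" "linear vec_of_pair"
  by (rule linearI; auto simp: pair_of_vec_def vec_of_pair_def vec_eq_iff forall_2)+

lemma bij_pair_of_vec: "inj pair_of_vec" "inj vec_of_pair" "pair_of_vec ` vec_of_pair ` S = S" "vec_of_pair ` pair_of_vec ` T = T"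
  by (auto simp: image_image) (metis injI pair_of_vec_vec_of_pair)+

lemma open_pair_of_vec: "open (pair_of_vec ` T) \<longleftrightarrow> open T"
proof -
  have "continuous_on UNIV pair_of_vec" "continuous_on UNIV vec_of_pair" using linear_pair_of_vec by (auto intro: linear_continuous_on linear_conv_bounded_linear[THEN iffD1])
  moreover have "pair_of_vec ` T = vec_of_pair -` T" "T = pair_of_vec -` (pair_of_vec ` T)" by (auto simp: image_iff) (metis pair_of_vec_vec_of_pair)+
  ultimately show ?thesis by (metis continuous_on_open_vimage open_UNIV Int_UNIV_right Int_UNIV_left)
qed

lemma lborel_pair_of_vec: "distr lborel borel vec_of_pair = lborel"
proof (rule lborel_eqI[symmetric])
  have meas: "vec_of_pair \<in> borel_measurable borel"
    using linear_pair_of_vec by (intro borel_measurable_continuous_onI) (auto intro: linear_continuous_on linear_conv_bounded_linear[THEN iffD1])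
  show "sets (distr lborel borel vec_of_pair) = sets borel" by simp
  fix l u :: "real^2" assume lu: "\<And>b. b \<in> Basis \<Longrightarrow> l \<bullet> b \<le> u \<bullet> b"
  have lu': "l $ 1 \<le> u $ 1" "l $ 2 \<le> u $ 2"
    using lu[of "axis 1 1"] lu[of "axis 2 1"] by (auto simp: Basis_vec_def inner_axis)
  have "vec_of_pair -` box l u = box (pair_of_vec l) (pair_of_vec u)"
    by (auto simp: mem_box Basis_vec_def inner_axis vec_of_pair_def pair_of_vec_def Basis_prod_def exhaust_2 forall_2)
  then have "emeasure (distr lborel borel vec_of_pair) (box l u) = emeasure lborel (box (pair_of_vec l) (pair_of_vec u))"
    using meas by (simp add: emeasure_distr)
  also have "\<dots> = (\<Prod>b\<in>Basis. (pair_of_vec u - pair_of_vec l) \<bullet> b)"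
    using lu' by (intro emeasure_lborel_box) (auto simp: Basis_prod_def pair_of_vec_def)
  also have "(\<Prod>b\<in>Basis. (pair_of_vec u - pair_of_vec l) \<bullet> b) = (u $ 1 - l $ 1) * (u $ 2 - l $ 2)"
    by (simp add: Basis_prod_def pair_of_vec_def)
  also have "\<dots> = (\<Prod>b\<in>Basis. (u - l) \<bullet> b)"
  proof -
    have "(Basis :: (real^2) set) = {axis 1 1, axis 2 1}"
      by (auto simp: Basis_vec_def) (metis exhaust_2)
    moreover have "axis (1::2) (1::real) \<noteq> axis 2 1" by (simp add: axis_eq_axis)
    ultimately have "(\<Prod>b\<in>Basis. (u - l) \<bullet> b) = (\<Prod>b\<in>{axis 1 1, axis 2 1}. (u - l) \<bullet> b)" by simp
    also have "\<dots> = (u $ 1 - l $ 1) * (u $ 2 - l $ 2)"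
      using \<open>axis (1::2) (1::real) \<noteq> axis 2 1\<close> by (simp add: inner_axis)
    finally show ?thesis by simp
  qed
  finally show "emeasure (distr lborel borel vec_of_pair) (box l u) = ennreal (\<Prod>b\<in>Basis. (u - l) \<bullet> b)" .
qed

lemma outer_measure_pair_of_vec: "outer_measure_of lebesgue (pair_of_vec ` S) = outer_measure_of lebesgue S"
proof -
  have meas: "vec_of_pair \<in> borel_measurable borel"
    using linear_pair_of_vec by (intro borel_measurable_continuous_onI) (auto intro: linear_continuous_on linear_conv_bounded_linear[THEN iffD1])
  have em: "emeasure lborel (pair_of_vec ` T) = emeasure lborel T" if "open T" for T
  proof -
    have "emeasure lborel T = emeasure (distr lborel borel vec_of_pair) T" by (simp add: lborel_pair_of_vec)
    also have "\<dots> = emeasure lborel (vec_of_pair -` T)" using that meas by (simp add: emeasure_distr)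
    also have "vec_of_pair -` T = pair_of_vec ` T" by (auto simp: image_iff) (metis pair_of_vec_vec_of_pair)
    finally show ?thesis by simp
  qed
  have "(emeasure lborel) ` {T. open T \<and> pair_of_vec ` S \<subseteq> T} = (emeasure lborel) ` {T. open T \<and> S \<subseteq> T}"
  proof (rule set_eqI, rule iffI)
    fix z assume "z \<in> emeasure lborel ` {T. open T \<and> pair_of_vec ` S \<subseteq> T}"
    then obtain T where T: "open T" "pair_of_vec ` S \<subseteq> T" "z = emeasure lborel T" by auto
    have "open (vec_of_pair ` T)" using T(1) open_pair_of_vec[of "vec_of_pair ` T"] by (simp add: bij_pair_of_vec)
    moreover have "S \<subseteq> vec_of_pair ` T" using T(2) by (metis bij_pair_of_vec(4) image_mono)
    moreover have "z = emeasure lborel (vec_of_pair ` T)" using em[OF \<open>open (vec_of_pair ` T)\<close>] T by (simp add: bij_pair_of_vec)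
    ultimately show "z \<in> emeasure lborel ` {T. open T \<and> S \<subseteq> T}" by auto
  next
    fix z assume "z \<in> emeasure lborel ` {T. open T \<and> S \<subseteq> T}"
    then obtain T where T: "open T" "S \<subseteq> T" "z = emeasure lborel T" by auto
    then have "open (pair_of_vec ` T)" "pair_of_vec ` S \<subseteq> pair_of_vec ` T" "z = emeasure lborel (pair_of_vec ` T)"
      using em open_pair_of_vec by auto
    then show "z \<in> emeasure lborel ` {T. open T \<and> pair_of_vec ` S \<subseteq> T}" by auto
  qed
  then show ?thesis unfolding outer_measure_lebesgue_open by simp
qed

theorem injective_image_outer_measure:
  fixes f :: "plane \<Rightarrow> plane" and A B C D :: "plane \<Rightarrow> real"
  assumes U: "open U" "bounded U" and inj: "inj_on f U"
    and der: "\<And>x. x \<in> U \<Longrightarrow> (f has_derivative (\<lambda>h. (A x * fst h + B x * snd h, C x * fst h + D x * snd h))) (at x)"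
    and cont: "continuous_on U (\<lambda>x. A x * D x - B x * C x)"
    and m: "\<And>x. x \<in> U \<Longrightarrow> m \<le> \<bar>A x * D x - B x * C x\<bar>" "\<And>x. x \<in> U \<Longrightarrow> \<bar>A x * D x - B x * C x\<bar> \<le> M"
    and m0: "0 < m" "0 < M"
    and W: "W \<subseteq> U"
  shows "ennreal m * outer_measure_of lebesgue W \<le> outer_measure_of lebesgue (f ` W)"
    and "outer_measure_of lebesgue (f ` W) \<le> ennreal M * outer_measure_of lebesgue W"
proof -
  define F where "F = vec_of_pair \<circ> f \<circ> pair_of_vec"
  define F' where "F' v = (\<lambda>h::real^2. vec_of_pair (A (pair_of_vec v) * h $ 1 + B (pair_of_vec v) * h $ 2, C (pair_of_vec v) * h $ 1 + D (pair_of_vec v) * h $ 2))" for v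
  define V where "V = vec_of_pair ` U"
  have bl: "bounded_linear pair_of_vec" "bounded_linear vec_of_pair"
    using linear_pair_of_vec by (auto intro: linear_conv_bounded_linear[THEN iffD1])
  have prV: "pair_of_vec v \<in> U" if "v \<in> V" for v using that by (auto simp: V_def)
  have V: "open V" "bounded V"
    using U open_pair_of_vec[of V] bounded_linear_image[OF U(2) bl(2)] by (auto simp: V_def bij_pair_of_vec)
  have det: "det (matrix (F' v)) = A (pair_of_vec v) * D (pair_of_vec v) - B (pair_of_vec v) * C (pair_of_vec v)" for v
    by (simp add: det_2 matrix_def F'_def vec_of_pair_def axis_def)
  have injF: "inj_on F V"
  proof (rule inj_onI)
    fix x y assume xy: "x \<in> V" "y \<in> V" "F x = F y"
    then have "f (pair_of_vec x) = f (pair_of_vec y)" unfolding F_def o_def by (metis pair_of_vec_vec_of_pair(1))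
    then have "pair_of_vec x = pair_of_vec y" using inj prV xy by (auto dest: inj_onD)
    then show "x = y" by (metis pair_of_vec_vec_of_pair(2))
  qed
  have derF: "(F has_derivative F' v) (at v)" if "v \<in> V" for v
  proof -
    have "(f has_derivative (\<lambda>h. (A (pair_of_vec v) * fst h + B (pair_of_vec v) * snd h, C (pair_of_vec v) * fst h + D (pair_of_vec v) * snd h))) (at (pair_of_vec v))"
      using der[OF prV[OF that]] .
    then have "((f \<circ> pair_of_vec) has_derivative (\<lambda>h. (A (pair_of_vec v) * fst h + B (pair_of_vec v) * snd h, C (pair_of_vec v) * fst h + D (pair_of_vec v) * snd h)) \<circ> pair_of_vec) (at v)"
      by (rule diff_chain_at[OF bounded_linear_imp_has_derivative[OF bl(1)]])
    then have "(vec_of_pair \<circ> (f \<circ> pair_of_vec) has_derivative vec_of_pair \<circ> ((\<lambda>h. (A (pair_of_vec v) * fst h + B (pair_of_vec v) * snd h, C (pair_of_vec v) * fst h + D (pair_of_vec v) * snd h)) \<circ> pair_of_vec)) (at v)"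
      by (rule diff_chain_at[OF _ bounded_linear_imp_has_derivative[OF bl(2)]])
    then show ?thesis by (simp add: F_def F'_def o_def pair_of_vec_def)
  qed
  have contF: "continuous_on V (\<lambda>v. det (matrix (F' v)))"
    unfolding det
    using continuous_on_compose2[OF cont, of V pair_of_vec] prV bl(1) by (auto simp: linear_continuous_on)
  have W': "vec_of_pair ` W \<subseteq> V" using W by (auto simp: V_def)
  have eqs: "outer_measure_of lebesgue W = outer_measure_of lebesgue (vec_of_pair ` W)"
    "outer_measure_of lebesgue (f ` W) = outer_measure_of lebesgue (F ` vec_of_pair ` W)"
    using outer_measure_pair_of_vec[of "vec_of_pair ` W"] outer_measure_pair_of_vec[of "F ` vec_of_pair ` W"]
    by (simp_all add: bij_pair_of_vec) (simp add: F_def image_image)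
  have m': "\<And>v. v \<in> V \<Longrightarrow> m \<le> \<bar>det (matrix (F' v))\<bar>" "\<And>v. v \<in> V \<Longrightarrow> \<bar>det (matrix (F' v))\<bar> \<le> M"
    unfolding det using m prV by auto
  show "ennreal m * outer_measure_of lebesgue W \<le> outer_measure_of lebesgue (f ` W)"
    "outer_measure_of lebesgue (f ` W) \<le> ennreal M * outer_measure_of lebesgue W"
    unfolding eqs using injective_image_outer_measure_vec[OF V injF _ contF _ _ m0 W'] derF m' by blast+
qed


section \<open>Horizontal curves and calibrations\<close>

text \<open>
  On the axis \<open>x = 0\<close> the field \<open>X\<^sub>2\<close> vanishes, so the cheapest second control is \<open>0\<close>.
\<close>
lemma grushin_metric_eq:
  "grushin_metric q (a, fst q * b) = a\<^sup>2 + (if fst q = 0 then 0 else b\<^sup>2)"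
proof (cases "fst q = 0")
  case True
  then have eq: "{u1\<^sup>2 + u2\<^sup>2 | u1 u2 :: real. u1 *\<^sub>R X1 q + u2 *\<^sub>R X2 q = (a, fst q * b)} = {a\<^sup>2 + u2\<^sup>2 | u2. True}"
    by (auto simp: X1_def X2_def)
  have "Inf {a\<^sup>2 + u2\<^sup>2 | u2 :: real. True} = a\<^sup>2"
    by (rule cInf_eq_minimum) (auto intro: exI[of _ 0])
  then show ?thesis using True unfolding grushin_metric_def eq by simp
next
  case False
  then have eq: "{u1\<^sup>2 + u2\<^sup>2 | u1 u2 :: real. u1 *\<^sub>R X1 q + u2 *\<^sub>R X2 q = (a, fst q * b)} = {a\<^sup>2 + b\<^sup>2}"
    by (auto simp: X1_def X2_def)
  then show ?thesis using False unfolding grushin_metric_def eq by simp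
qed

lemma has_control_AE:
  assumes "has_control \<gamma> w"
  shows "AE t in lebesgue_on {0..1}. (\<gamma> has_vector_derivative (fst (w t), fst (\<gamma> t) * snd (w t))) (at t within {0..1})"
  using assms unfolding has_control_def by (simp add: X1_def X2_def mult.commute)

lemma has_controlI:
  assumes "absolutely_continuous_curve \<gamma>" "w \<in> l2_controls"
    and "AE t in lebesgue_on {0..1}. (\<gamma> has_vector_derivative (fst (w t), fst (\<gamma> t) * snd (w t))) (at t within {0..1})"
  shows "has_control \<gamma> w"
  using assms unfolding has_control_def by (simp add: X1_def X2_def mult.commute)

lemma speed_AE:
  assumes c: "has_control \<gamma> w"
  shows "AE t in lebesgue_on {0..1}.
    speed \<gamma> t = sqrt ((fst (w t))\<^sup>2 + (if fst (\<gamma> t) = 0 then 0 else (snd (w t))\<^sup>2))"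
proof -
  have "AE t in lebesgue_on {0..1}. t \<in> {0..1::real}" by (metis AE_space space_lebesgue_on)
  then show ?thesis using has_control_AE[OF c]
  proof eventually_elim
    fix t :: real assume "t \<in> {0..1}" "(\<gamma> has_vector_derivative (fst (w t), fst (\<gamma> t) * snd (w t))) (at t within {0..1})"
    then have "vector_derivative \<gamma> (at t within {0..1}) = (fst (w t), fst (\<gamma> t) * snd (w t))"
      by (intro vector_derivative_within_cbox[of 0 1, simplified]) auto
    then show "speed \<gamma> t = sqrt ((fst (w t))\<^sup>2 + (if fst (\<gamma> t) = 0 then 0 else (snd (w t))\<^sup>2))"
      unfolding speed_def by (simp only: grushin_metric_eq)
  qed
qed

lemma norm_fst_le': "norm (fst p) \<le> norm p" and norm_snd_le': "norm (snd p) \<le> norm p"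
  by (metis norm_fst_le prod.collapse) (metis norm_snd_le prod.collapse)

lemma norm_pair_real: "norm (p :: real \<times> real) = sqrt ((fst p)\<^sup>2 + (snd p)\<^sup>2)"
  by (cases p) (simp add: norm_Pair)

lemma norm_pair_sq: "(norm (p :: real \<times> real))\<^sup>2 = (fst p)\<^sup>2 + (snd p)\<^sup>2"
  by (simp add: norm_pair_real)

text \<open>
  Switching the second control off where \<open>X\<^sub>2\<close> vanishes does not change the curve, and turns the norm of
  the control into the speed.
\<close>
lemma horizontal_normalised:
  assumes h: "horizontal \<gamma>"
  obtains w where "has_control \<gamma> w" "AE t in lebesgue_on {0..1}. speed \<gamma> t = norm (w t)"
proof -
  obtain u where u: "has_control \<gamma> u" using h by (auto simp: horizontal_def)
  have um: "u \<in> borel_measurable (lebesgue_on {0..1})" and ui: "integrable (lebesgue_on {0..1}) (\<lambda>t. (norm (u t))\<^sup>2)"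
    and ac: "absolutely_continuous_curve \<gamma>"
    using u by (auto simp: has_control_def l2_controls_def)
  define w where "w t = (fst (u t), if fst (\<gamma> t) = 0 then 0 else snd (u t))" for t
  have cont: "continuous_on {0..1} (\<lambda>t. fst (\<gamma> t))"
    using ac_curve_continuous[OF ac] by (intro continuous_intros)
  have xm: "(\<lambda>t. fst (\<gamma> t)) \<in> borel_measurable (lebesgue_on {0..1})"
    by (rule continuous_imp_measurable_on_sets_lebesgue[OF cont]) auto
  have fm: "(\<lambda>t. fst (u t)) \<in> borel_measurable (lebesgue_on {0..1})"
     "(\<lambda>t. snd (u t)) \<in> borel_measurable (lebesgue_on {0..1})"
    by (rule measurable_compose[OF um], intro borel_measurable_continuous_onI continuous_intros)+
  have wm: "w \<in> borel_measurable (lebesgue_on {0..1})"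
    unfolding w_def using xm fm by measurable
  have le: "norm (w t) \<le> norm (u t)" for t
    by (simp add: w_def norm_pair_real)
  have "integrable (lebesgue_on {0..1}) (\<lambda>t. (norm (w t))\<^sup>2)"
    by (rule Bochner_Integration.integrable_bound[OF ui])
       (use wm le in \<open>auto intro!: power_mono AE_I2\<close>)
  then have l2: "w \<in> l2_controls" using wm by (simp add: l2_controls_def)
  have c: "has_control \<gamma> w"
  proof (rule has_controlI[OF ac l2])
    show "AE t in lebesgue_on {0..1}. (\<gamma> has_vector_derivative (fst (w t), fst (\<gamma> t) * snd (w t))) (at t within {0..1})"
      using has_control_AE[OF u] by eventually_elim (auto simp: w_def split: if_splits)
  qed
  moreover have "AE t in lebesgue_on {0..1}. speed \<gamma> t = norm (w t)"
    using speed_AE[OF c] by eventually_elim (simp add: norm_pair_real w_def)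
  ultimately show ?thesis using that by blast
qed

lemma control_norm_integrable:
  assumes "w \<in> l2_controls"
  shows "integrable (lebesgue_on {0..1}) (\<lambda>t. norm (w t))"
proof -
  have "integrable (lebesgue_on {0..1}) (\<lambda>t. 1 + (norm (w t))\<^sup>2)"
    using assms by (auto simp: l2_controls_def)
  then show ?thesis
  proof (rule Bochner_Integration.integrable_bound)
    show "(\<lambda>t. norm (w t)) \<in> borel_measurable (lebesgue_on {0..1})"
      using assms by (auto simp: l2_controls_def)
    have "z \<le> 1 + z\<^sup>2" if "z \<ge> 0" for z :: real
      using zero_le_power2[of "z - 1"] that by (simp add: power2_diff)
    from this[OF norm_ge_zero] show "AE t in lebesgue_on {0..1}. norm (norm (w t)) \<le> norm (1 + (norm (w t))\<^sup>2)"
      by (intro AE_I2) (simp add: abs_of_nonneg add_nonneg_nonneg)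
  qed
qed

lemma sr_length_nonneg: "horizontal \<gamma> \<Longrightarrow> 0 \<le> sr_length \<gamma>"
proof -
  assume "horizontal \<gamma>"
  then obtain w where "has_control \<gamma> w" and w: "AE t in lebesgue_on {0..1}. speed \<gamma> t = norm (w t)"
    by (rule horizontal_normalised)
  from w have "AE t in lebesgue_on {0..1}. 0 \<le> speed \<gamma> t" by eventually_elim simp
  then show ?thesis unfolding sr_length_def by (rule integral_nonneg_AE)
qed

text \<open>
  The coefficients of the calibration \<open>S(s, x, y) = v y + A(s) x\<^sup>2 + B(s) x + C(s)\<close>.  Here \<open>A\<close> is a solution
  of the Riccati equation \<open>A' = - 2A\<^sup>2 - v\<^sup>2/2\<close>, and its poles are placed symmetrically about the midpoint
  \<open>1/2\<close>, so that it is finite on \<open>[0,1]\<close> for all \<open>\<bar>v\<bar> < \<pi>\<close>.  The free parameter \<open>\<beta>\<close> is the value of \<open>x'\<close> at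
  time \<open>1/2\<close> along the calibrated extremals.
\<close>
definition calib_quad :: "real \<Rightarrow> real \<Rightarrow> real" where
  "calib_quad v s = - (v / 2) * tan (v * (s - 1/2))"
definition calib_lin :: "real \<Rightarrow> real \<Rightarrow> real \<Rightarrow> real" where
  "calib_lin v \<beta> s = \<beta> / cos (v * (s - 1/2))"

text \<open>
  For \<open>v = 0\<close> the quotient is replaced by its limit up to an additive constant; only increments of
  the calibration enter below.
\<close>
definition calib_const :: "real \<Rightarrow> real \<Rightarrow> real \<Rightarrow> real" where
  "calib_const v \<beta> s = - (\<beta>\<^sup>2 / 2) * (if v = 0 then s else tan (v * (s - 1/2)) / v)"

definition calib :: "real \<Rightarrow> real \<Rightarrow> real \<Rightarrow> plane \<Rightarrow> real" where
  "calib v \<beta> s q = v * snd q + calib_quad v s * (fst q)\<^sup>2 + calib_lin v \<beta> s * fst q + calib_const v \<beta> s"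

text \<open>
  The gradient of the calibration evaluated on \<open>X\<^sub>1\<close> and \<open>X\<^sub>2\<close>.
\<close>
definition calib_momentum :: "real \<Rightarrow> real \<Rightarrow> real \<Rightarrow> plane \<Rightarrow> real \<times> real" where
  "calib_momentum v \<beta> s q = (2 * calib_quad v s * fst q + calib_lin v \<beta> s, v * fst q)"

lemma cos_calib_pos:
  assumes "\<bar>v\<bar> < pi" "s \<in> {0..1}"
  shows "0 < cos (v * (s - 1/2))"
proof (rule cos_gt_zero_pi)
  have "\<bar>s - 1/2\<bar> \<le> 1/2" using assms(2) unfolding abs_le_iff by auto
  have "\<bar>v * (s - 1/2)\<bar> \<le> \<bar>v\<bar> * (1/2)"
    unfolding abs_mult using assms \<open>\<bar>s - 1/2\<bar> \<le> 1/2\<close> by (intro mult_left_mono) auto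
  also have "\<dots> < pi / 2" using assms by simp
  finally show "- (pi / 2) < v * (s - 1/2)" "v * (s - 1/2) < pi / 2" by auto
qed

text \<open>
  These three equations are the Hamilton-Jacobi equation \<open>S\<^sub>s + \<bar>p\<bar>\<^sup>2 / 2 = 0\<close> with
  \<open>p = (2Ax + B, vx)\<close>, sorted by powers of \<open>x\<close>.
\<close>
lemma calib_coeff_derivs:
  assumes "\<bar>v\<bar> < pi" "s \<in> {0..1}"
  shows "(calib_quad v has_real_derivative (- 2 * (calib_quad v s)\<^sup>2 - v\<^sup>2 / 2)) (at s)"
    and "(calib_lin v \<beta> has_real_derivative (- 2 * calib_quad v s * calib_lin v \<beta> s)) (at s)"
    and "(calib_const v \<beta> has_real_derivative (- (calib_lin v \<beta> s)\<^sup>2 / 2)) (at s)"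
proof -
  define \<theta> where "\<theta> = v * (s - 1/2)"
  have c: "cos \<theta> \<noteq> 0" using cos_calib_pos[OF assms] by (simp add: \<theta>_def)
  have d\<theta>: "((\<lambda>s. v * (s - 1/2)) has_real_derivative v) (at s)"
    by (auto intro!: derivative_eq_intros)
  have dtan: "((\<lambda>s. tan (v * (s - 1/2))) has_real_derivative inverse ((cos \<theta>)\<^sup>2) * v) (at s)"
    using DERIV_chain2[OF DERIV_tan d\<theta>] c by (simp add: \<theta>_def)
  have dcos: "((\<lambda>s. cos (v * (s - 1/2))) has_real_derivative - sin \<theta> * v) (at s)"
    using DERIV_chain2[OF DERIV_cos d\<theta>] by (simp add: \<theta>_def)
  have s2: "(sin \<theta>)\<^sup>2 = 1 - (cos \<theta>)\<^sup>2" by (simp add: sin_squared_eq)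
  have "((\<lambda>s. - (v / 2) * tan (v * (s - 1/2))) has_real_derivative - (v / 2) * (inverse ((cos \<theta>)\<^sup>2) * v)) (at s)"
    by (rule DERIV_cmult[OF dtan])
  moreover have "- (v / 2) * (inverse ((cos \<theta>)\<^sup>2) * v) = - 2 * (calib_quad v s)\<^sup>2 - v\<^sup>2 / 2"
    using c unfolding calib_quad_def \<theta>_def[symmetric]
    by (simp add: tan_def power_mult_distrib power_divide s2 field_simps) (simp add: power2_eq_square algebra_simps)
  ultimately show "(calib_quad v has_real_derivative (- 2 * (calib_quad v s)\<^sup>2 - v\<^sup>2 / 2)) (at s)"
    unfolding calib_quad_def[abs_def] by simp
  have "((\<lambda>s. \<beta> / cos (v * (s - 1/2))) has_real_derivative (0 * cos \<theta> - \<beta> * (- sin \<theta> * v)) / (cos \<theta> * cos \<theta>)) (at s)"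
    unfolding \<theta>_def by (rule DERIV_divide) (use dcos c in \<open>auto simp: \<theta>_def\<close>)
  moreover have "(0 * cos \<theta> - \<beta> * (- sin \<theta> * v)) / (cos \<theta> * cos \<theta>) = - 2 * calib_quad v s * calib_lin v \<beta> s"
    using c unfolding calib_quad_def calib_lin_def \<theta>_def[symmetric] by (simp add: tan_def field_simps)
  ultimately show "(calib_lin v \<beta> has_real_derivative (- 2 * calib_quad v s * calib_lin v \<beta> s)) (at s)"
    unfolding calib_lin_def[abs_def] by simp
  show "(calib_const v \<beta> has_real_derivative (- (calib_lin v \<beta> s)\<^sup>2 / 2)) (at s)"
  proof (cases "v = 0")
    case True
    then show ?thesis unfolding calib_const_def[abs_def] calib_lin_def
      by (auto intro!: derivative_eq_intros)
  next
    case False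
    have "((\<lambda>s. - (\<beta>\<^sup>2 / 2) * (tan (v * (s - 1/2)) / v)) has_real_derivative - (\<beta>\<^sup>2 / 2) * (inverse ((cos \<theta>)\<^sup>2) * v / v)) (at s)"
      by (rule DERIV_cmult[OF DERIV_cdivide[OF dtan]])
    moreover have "- (\<beta>\<^sup>2 / 2) * (inverse ((cos \<theta>)\<^sup>2) * v / v) = - (calib_lin v \<beta> s)\<^sup>2 / 2"
      using False unfolding calib_lin_def \<theta>_def[symmetric] by (simp add: field_simps)
    ultimately show ?thesis unfolding calib_const_def[abs_def] using False by simp
  qed
qed

text \<open>
  The chain rule and the Hamilton-Jacobi equation give the derivative of the calibration along a
  horizontal curve.  The time variable of the calibration runs on a separate clock \<open>\<tau>\<close>: taking
  \<open>\<tau>(s) = s\<close> leads to the energy of the curve, a clock close to normalised arc length to its length.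
\<close>
lemma calib_along:
  assumes c: "has_control \<gamma> w" and v: "\<bar>v\<bar> < pi"
    and \<tau>: "\<And>s. s \<in> {0..1} \<Longrightarrow> \<tau> s \<in> {0..1}"
    and d\<tau>: "\<And>s. s \<in> {0..1} \<Longrightarrow> (\<tau> has_real_derivative \<tau>' s) (at s within {0..1})"
    and cont: "continuous_on {0..1} \<tau>'"
  shows "((\<lambda>s. calib_momentum v \<beta> (\<tau> s) (\<gamma> s) \<bullet> w s - (norm (calib_momentum v \<beta> (\<tau> s) (\<gamma> s)))\<^sup>2 / 2 * \<tau>' s)
     has_integral calib v \<beta> (\<tau> 1) (\<gamma> 1) - calib v \<beta> (\<tau> 0) (\<gamma> 0)) {0..1}"
proof -
  have ac: "absolutely_continuous_curve \<gamma>" using c by (simp add: has_control_def)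
  note acx = ac_curve_fst[OF ac] and acy = ac_curve_snd[OF ac]
  have cont\<tau>: "continuous_on {0..1} \<tau>"
    by (rule DERIV_continuous_on[OF d\<tau>])
  have dA: "((\<lambda>s. calib_quad v (\<tau> s)) has_real_derivative (- 2 * (calib_quad v (\<tau> s))\<^sup>2 - v\<^sup>2 / 2) * \<tau>' s) (at s within {0..1})"
    "((\<lambda>s. calib_lin v \<beta> (\<tau> s)) has_real_derivative (- 2 * calib_quad v (\<tau> s) * calib_lin v \<beta> (\<tau> s)) * \<tau>' s) (at s within {0..1})"
    "((\<lambda>s. calib_const v \<beta> (\<tau> s)) has_real_derivative (- (calib_lin v \<beta> (\<tau> s))\<^sup>2 / 2) * \<tau>' s) (at s within {0..1})"
    if s: "s \<in> {0..1}" for s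
    using DERIV_chain2[OF calib_coeff_derivs(1)[OF v \<tau>[OF s]] d\<tau>[OF s]]
      DERIV_chain2[OF calib_coeff_derivs(2)[OF v \<tau>[OF s]] d\<tau>[OF s]]
      DERIV_chain2[OF calib_coeff_derivs(3)[OF v \<tau>[OF s]] d\<tau>[OF s]] by auto
  have contA: "continuous_on {0..1} (\<lambda>s. calib_quad v (\<tau> s))" "continuous_on {0..1} (\<lambda>s. calib_lin v \<beta> (\<tau> s))"
    using DERIV_continuous_on[OF dA(1)] DERIV_continuous_on[OF dA(2)] by auto
  have acA: "absolutely_continuous_curve (\<lambda>s. calib_quad v (\<tau> s))"
    by (rule ac_curve_C1[OF dA(1)[unfolded has_real_derivative_iff_has_vector_derivative]])
       (auto intro!: continuous_intros contA cont)
  have acB: "absolutely_continuous_curve (\<lambda>s. calib_lin v \<beta> (\<tau> s))"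
    by (rule ac_curve_C1[OF dA(2)[unfolded has_real_derivative_iff_has_vector_derivative]])
       (auto intro!: continuous_intros contA cont)
  have acC: "absolutely_continuous_curve (\<lambda>s. calib_const v \<beta> (\<tau> s))"
    by (rule ac_curve_C1[OF dA(3)[unfolded has_real_derivative_iff_has_vector_derivative]])
       (auto intro!: continuous_intros contA cont)
  have acv: "absolutely_continuous_curve (\<lambda>s. v :: real)"
    by (rule ac_curve_lipschitz[where K=0]) auto
  have acf: "absolutely_continuous_curve (\<lambda>s. calib v \<beta> (\<tau> s) (\<gamma> s))"
    unfolding calib_def power2_eq_square
    by (intro ac_curve_add ac_curve_mult acx acy acA acB acC acv)
  have "AE t in lebesgue_on {0..1}. t \<in> {0..1::real}" by (metis AE_space space_lebesgue_on)
  then have ae: "AE s in lebesgue_on {0..1}. ((\<lambda>s. calib v \<beta> (\<tau> s) (\<gamma> s)) has_vector_derivative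
      (calib_momentum v \<beta> (\<tau> s) (\<gamma> s) \<bullet> w s - (norm (calib_momentum v \<beta> (\<tau> s) (\<gamma> s)))\<^sup>2 / 2 * \<tau>' s)) (at s within {0..1})"
    using has_control_AE[OF c]
  proof eventually_elim
    fix s :: real assume s: "s \<in> {0..1}"
      and d: "(\<gamma> has_vector_derivative (fst (w s), fst (\<gamma> s) * snd (w s))) (at s within {0..1})"
    have dx: "((\<lambda>s. fst (\<gamma> s)) has_real_derivative fst (w s)) (at s within {0..1})"
      using bounded_linear.has_vector_derivative[OF bounded_linear_fst d]
      by (simp add: has_real_derivative_iff_has_vector_derivative)
    have dy: "((\<lambda>s. snd (\<gamma> s)) has_real_derivative fst (\<gamma> s) * snd (w s)) (at s within {0..1})"
      using bounded_linear.has_vector_derivative[OF bounded_linear_snd d]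
      by (simp add: has_real_derivative_iff_has_vector_derivative)
    have "((\<lambda>s. calib v \<beta> (\<tau> s) (\<gamma> s)) has_real_derivative
       v * (fst (\<gamma> s) * snd (w s)) +
       ((- 2 * (calib_quad v (\<tau> s))\<^sup>2 - v\<^sup>2 / 2) * \<tau>' s * (fst (\<gamma> s))\<^sup>2 + calib_quad v (\<tau> s) * (2 * fst (\<gamma> s) * fst (w s)))
       + ((- 2 * calib_quad v (\<tau> s) * calib_lin v \<beta> (\<tau> s)) * \<tau>' s * fst (\<gamma> s) + calib_lin v \<beta> (\<tau> s) * fst (w s))
       + (- (calib_lin v \<beta> (\<tau> s))\<^sup>2 / 2) * \<tau>' s) (at s within {0..1})"
      unfolding calib_def
      by (rule derivative_eq_intros dx dy dA[OF s] refl)+ (simp add: algebra_simps)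
    moreover have "v * (fst (\<gamma> s) * snd (w s)) +
       ((- 2 * (calib_quad v (\<tau> s))\<^sup>2 - v\<^sup>2 / 2) * \<tau>' s * (fst (\<gamma> s))\<^sup>2 + calib_quad v (\<tau> s) * (2 * fst (\<gamma> s) * fst (w s)))
       + ((- 2 * calib_quad v (\<tau> s) * calib_lin v \<beta> (\<tau> s)) * \<tau>' s * fst (\<gamma> s) + calib_lin v \<beta> (\<tau> s) * fst (w s))
       + (- (calib_lin v \<beta> (\<tau> s))\<^sup>2 / 2) * \<tau>' s
      = calib_momentum v \<beta> (\<tau> s) (\<gamma> s) \<bullet> w s - (norm (calib_momentum v \<beta> (\<tau> s) (\<gamma> s)))\<^sup>2 / 2 * \<tau>' s"
      unfolding norm_pair_sq calib_momentum_def by (cases "w s") (simp add: field_simps power2_eq_square)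
    ultimately show "((\<lambda>s. calib v \<beta> (\<tau> s) (\<gamma> s)) has_vector_derivative
      (calib_momentum v \<beta> (\<tau> s) (\<gamma> s) \<bullet> w s - (norm (calib_momentum v \<beta> (\<tau> s) (\<gamma> s)))\<^sup>2 / 2 * \<tau>' s)) (at s within {0..1})"
      unfolding has_real_derivative_iff_has_vector_derivative by simp
  qed
  show ?thesis
    using ac_curve_has_integral[OF acf ae, of 1] by simp
qed

text \<open>
  For constant speed \<open>k\<close> and the clock \<open>\<tau>(s) = s\<close> the integrand of \<open>calib_along\<close> equals
  \<open>k\<^sup>2/2 - \<bar>w - p\<bar>\<^sup>2/2\<close>, so the extreme value \<open>k\<^sup>2/2\<close> of the increment forces \<open>w = p\<close>.
\<close>
lemma calib_equality:
  assumes c: "has_control \<gamma> w" and v: "\<bar>v\<bar> < pi"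
    and k: "AE s in lebesgue_on {0..1}. norm (w s) = k"
    and eq: "calib v \<beta> 1 (\<gamma> 1) - calib v \<beta> 0 (\<gamma> 0) = k\<^sup>2 / 2"
  shows "AE s in lebesgue_on {0..1}. w s = calib_momentum v \<beta> s (\<gamma> s)"
proof -
  let ?p = "\<lambda>s. calib_momentum v \<beta> s (\<gamma> s)"
  have "((\<lambda>s. ?p s \<bullet> w s - (norm (?p s))\<^sup>2 / 2 * 1) has_integral calib v \<beta> 1 (\<gamma> 1) - calib v \<beta> 0 (\<gamma> 0)) {0..1}"
    by (rule calib_along[OF c v, where \<tau> = "\<lambda>s. s"]) auto
  then have i1: "((\<lambda>s. ?p s \<bullet> w s - (norm (?p s))\<^sup>2 / 2) has_integral k\<^sup>2 / 2) {0..1}"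
    by (simp add: eq)
  have i2: "((\<lambda>s::real. k\<^sup>2 / 2) has_integral k\<^sup>2 / 2) {0..1}"
    using has_integral_const_real[of "k\<^sup>2 / 2" 0 1] by simp
  have i3: "((\<lambda>s. k\<^sup>2 / 2 - (?p s \<bullet> w s - (norm (?p s))\<^sup>2 / 2)) has_integral 0) {0..1}"
    using has_integral_diff[OF i2 i1] by simp
  obtain N where N: "N \<in> null_sets (lebesgue_on {0..1})" "\<And>s. s \<in> {0..1} - N \<Longrightarrow> norm (w s) = k"
    using AE_E3[OF k] by (metis Diff_iff space_lebesgue_on)
  have negN: "negligible N"
    using N(1) by (simp add: negligible_iff_null_sets null_sets_restrict_space)
  have i4: "((\<lambda>s. (norm (w s - ?p s))\<^sup>2 / 2) has_integral 0) {0..1}"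
  proof (rule has_integral_spike[OF negN _ i3])
    fix s assume s: "s \<in> {0..1} - N"
    have "(norm (w s - ?p s))\<^sup>2 = (norm (w s))\<^sup>2 - 2 * (?p s \<bullet> w s) + (norm (?p s))\<^sup>2"
      by (simp add: power2_norm_eq_inner inner_diff inner_commute)
    then show "(norm (w s - ?p s))\<^sup>2 / 2 = k\<^sup>2 / 2 - (?p s \<bullet> w s - (norm (?p s))\<^sup>2 / 2)"
      using N(2)[OF s] by (simp add: field_simps)
  qed
  have ai: "(\<lambda>s. (norm (w s - ?p s))\<^sup>2 / 2) absolutely_integrable_on {0..1}"
    by (rule nonnegative_absolutely_integrable_1) (use i4 in \<open>auto simp: has_integral_integrable\<close>)
  then have li: "integrable (lebesgue_on {0..1}) (\<lambda>s. (norm (w s - ?p s))\<^sup>2 / 2)"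
    by (simp add: set_integrable_def integrable_restrict_space)
  have "integral\<^sup>L (lebesgue_on {0..1}) (\<lambda>s. (norm (w s - ?p s))\<^sup>2 / 2) = 0"
    unfolding lebesgue_integral_eq_integral[OF li lmeasurable_interval(1)[THEN fmeasurableD]] by (rule integral_unique[OF i4])
  then have "AE s in lebesgue_on {0..1}. (norm (w s - ?p s))\<^sup>2 / 2 = 0"
    using integral_nonneg_eq_0_iff_AE[OF li] by simp
  then show ?thesis by eventually_elim simp
qed

text \<open>
  Supplies continuously differentiable clocks that run almost like arc length.  The function is first
  truncated; the bounded function is an almost everywhere limit of continuous ones, which converge in
  mean by dominated convergence.
\<close>
lemma continuous_L1_approximation:
  fixes f :: "real \<Rightarrow> real"
  assumes f: "integrable (lebesgue_on {0..1}) f" and nn: "\<And>t. 0 \<le> f t" and e: "0 < \<epsilon>"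
  obtains g where "continuous_on {0..1} g" "\<And>t. 0 < g t"
    "integral\<^sup>L (lebesgue_on {0..1}) (\<lambda>t. \<bar>f t - g t\<bar>) < \<epsilon>"
proof -
  let ?M = "lebesgue_on {0..1::real}"
  have fin: "finite_measure ?M" by (rule finite_measure_lebesgue_on) auto
  have const: "integrable ?M (\<lambda>_. c :: real)" for c
    using fin by (simp add: finite_measure.integrable_const)
  have fm: "f \<in> borel_measurable ?M" using f by auto
  \<comment> \<open>Truncation makes dominated convergence with a constant majorant possible.\<close>
  define h where "h k t = min (f t) (real k)" for k t
  have hm: "h k \<in> borel_measurable ?M" for k unfolding h_def using fm by measurable
  have hk: "0 \<le> h k t" "h k t \<le> real k" "h k t \<le> f t" for k t using nn by (auto simp: h_def)
  have "(\<lambda>k. integral\<^sup>L ?M (\<lambda>t. \<bar>f t - h k t\<bar>)) \<longlonglongrightarrow> integral\<^sup>L ?M (\<lambda>t. 0 :: real)"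
  proof (rule integral_dominated_convergence[where w = f])
    show "AE t in ?M. (\<lambda>k. \<bar>f t - h k t\<bar>) \<longlonglongrightarrow> 0"
    proof (intro AE_I2 tendsto_eventually)
      fix t
      obtain K where "f t \<le> real K" using real_arch_simple by blast
      then have "\<bar>f t - h k t\<bar> = 0" if "k \<ge> K" for k
        using that by (simp add: h_def)
      then show "\<forall>\<^sub>F k in sequentially. \<bar>f t - h k t\<bar> = 0"
        unfolding eventually_sequentially by blast
    qed
    show "AE t in ?M. norm \<bar>f t - h k t\<bar> \<le> f t" for k
      using hk nn by (intro AE_I2) (auto simp: abs_le_iff)
  qed (use f fm hm in \<open>auto\<close>)
  then have "\<forall>\<^sub>F k in sequentially. integral\<^sup>L ?M (\<lambda>t. \<bar>f t - h k t\<bar>) < \<epsilon> / 2"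
    using e by (intro order_tendstoD) auto
  then obtain k where k: "integral\<^sup>L ?M (\<lambda>t. \<bar>f t - h k t\<bar>) < \<epsilon> / 2"
    by (auto simp: eventually_sequentially)
  have "h k measurable_on {0..1}"
    using measurable_on_iff_borel_measurable[of "{0..1}" "h k"] hm by auto
  then obtain N G where N: "negligible N" and G: "\<And>n. continuous_on UNIV (G n)"
    "\<And>x. x \<notin> N \<Longrightarrow> (\<lambda>n. G n x) \<longlonglongrightarrow> (if x \<in> {0..1} then h k x else 0)"
    unfolding measurable_on_def by metis
  define H where "H n t = max 0 (min (real k) (G n t)) + 1 / real (Suc n)" for n t
  have H: "0 < H n t" "H n t \<le> real k + 1" "continuous_on {0..1} (H n)" for n t
  proof -
    have "1 / real (Suc n) \<le> 1" "0 < 1 / real (Suc n)" by auto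
    then show "0 < H n t" "H n t \<le> real k + 1" unfolding H_def by linarith+
    show "continuous_on {0..1} (H n)" unfolding H_def
      by (intro continuous_intros continuous_on_subset[OF G(1)]) auto
  qed
  have Hm: "H n \<in> borel_measurable ?M" for n
    by (rule continuous_imp_measurable_on_sets_lebesgue[OF H(3)]) auto
  have NM: "N \<inter> {0..1} \<in> null_sets ?M"
  proof -
    have "negligible (N \<inter> {0..1})" using N by (rule negligible_subset) auto
    then show ?thesis by (simp add: negligible_iff_null_sets null_sets_restrict_space)
  qed
  have "(\<lambda>n. integral\<^sup>L ?M (\<lambda>t. \<bar>h k t - H n t\<bar>)) \<longlonglongrightarrow> integral\<^sup>L ?M (\<lambda>t. 0 :: real)"
  proof (rule integral_dominated_convergence[where w = "\<lambda>t. real k + (real k + 1)"])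
    show "AE t in ?M. (\<lambda>n. \<bar>h k t - H n t\<bar>) \<longlonglongrightarrow> 0"
    proof (rule AE_I'[OF NM], safe)
      fix t :: real assume t: "t \<in> space ?M" "\<not> (\<lambda>n. \<bar>h k t - H n t\<bar>) \<longlonglongrightarrow> 0"
      then have t01: "t \<in> {0..1}" by simp
      then show "t \<in> {0..1}" .
      show "t \<in> N"
      proof (rule ccontr)
        assume "t \<notin> N"
        have "(\<lambda>n. G n t) \<longlonglongrightarrow> h k t" using G(2)[OF \<open>t \<notin> N\<close>] unfolding if_P[OF t01] .
        then have "(\<lambda>n. max 0 (min (real k) (G n t)) + 1 / real (Suc n)) \<longlonglongrightarrow> max 0 (min (real k) (h k t)) + 0"
          by (intro tendsto_intros LIMSEQ_Suc[OF lim_1_over_n])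
        then have "(\<lambda>n. H n t) \<longlonglongrightarrow> h k t" using hk[of k t] by (simp add: H_def)
        then have "(\<lambda>n. \<bar>h k t - H n t\<bar>) \<longlonglongrightarrow> \<bar>h k t - h k t\<bar>" by (intro tendsto_intros)
        then show False using t(2) by simp
      qed
    qed
    show "AE t in ?M. norm \<bar>h k t - H n t\<bar> \<le> real k + (real k + 1)" for n
    proof (intro AE_I2)
      fix t show "norm \<bar>h k t - H n t\<bar> \<le> real k + (real k + 1)"
        using hk(1,2)[of k t] H(1,2)[of n t] by simp
    qed
  qed (use hm Hm const in auto)
  then have "\<forall>\<^sub>F n in sequentially. integral\<^sup>L ?M (\<lambda>t. \<bar>h k t - H n t\<bar>) < \<epsilon> / 2"
    using e by (intro order_tendstoD) auto
  then obtain n where n: "integral\<^sup>L ?M (\<lambda>t. \<bar>h k t - H n t\<bar>) < \<epsilon> / 2"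
    by (auto simp: eventually_sequentially)
  have ih: "integrable ?M (h k)"
    by (rule Bochner_Integration.integrable_bound[OF const[of "real k"]]) (use hm hk in auto)
  have iH: "integrable ?M (H n)"
    by (rule Bochner_Integration.integrable_bound[OF const[of "real k + 1"]])
       (use Hm H(1,2) in \<open>auto intro!: AE_I2 simp: less_imp_le\<close>)
  have "integral\<^sup>L ?M (\<lambda>t. \<bar>f t - H n t\<bar>) \<le> integral\<^sup>L ?M (\<lambda>t. \<bar>f t - h k t\<bar> + \<bar>h k t - H n t\<bar>)"
    by (rule integral_mono) (use f ih iH in auto)
  also have "\<dots> = integral\<^sup>L ?M (\<lambda>t. \<bar>f t - h k t\<bar>) + integral\<^sup>L ?M (\<lambda>t. \<bar>h k t - H n t\<bar>)"
    by (rule Bochner_Integration.integral_add) (use f ih iH in auto)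
  also have "\<dots> < \<epsilon>" using k n by simp
  finally show ?thesis using that[of "H n"] H by blast
qed

text \<open>
  With a clock \<open>\<tau>\<close> proportional to arc length, \<open>\<tau>' = \<bar>w\<bar>/L\<close>, the integrand \<open>p \<bullet> w - \<bar>p\<bar>\<^sup>2 \<tau>'/2\<close> is at most
  \<open>\<bar>w\<bar> (\<bar>p\<bar> - \<bar>p\<bar>\<^sup>2/(2L)) \<le> \<bar>w\<bar> L/2\<close>, and integration gives \<open>L\<^sup>2/2\<close>.  Since the speed is merely integrable,
  the clock is driven by a continuous function close to it in mean, and the error tends to zero.
\<close>
theorem calib_length_bound:
  assumes h: "horizontal \<gamma>" and v: "\<bar>v\<bar> < pi"
  shows "calib v \<beta> 1 (\<gamma> 1) - calib v \<beta> 0 (\<gamma> 0) \<le> (sr_length \<gamma>)\<^sup>2 / 2"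
proof -
  let ?M = "lebesgue_on {0..1::real}"
  obtain w where w: "has_control \<gamma> w" "AE t in ?M. speed \<gamma> t = norm (w t)"
    by (rule horizontal_normalised[OF h])
  have wl: "w \<in> l2_controls" and ac: "absolutely_continuous_curve \<gamma>" using w(1) by (auto simp: has_control_def)
  have ni: "integrable ?M (\<lambda>t. norm (w t))" by (rule control_norm_integrable[OF wl])
  define L where "L = integral\<^sup>L ?M (\<lambda>t. norm (w t))"
  have L: "L = sr_length \<gamma>"
    unfolding L_def sr_length_def
  proof (rule integral_cong_AE[symmetric])
    show nm: "(\<lambda>t. norm (w t)) \<in> borel_measurable ?M" using ni by auto
    show "AE t in ?M. speed \<gamma> t = norm (w t)" by (rule w(2))
    show "speed \<gamma> \<in> borel_measurable ?M"
    proof -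
      have "(\<lambda>t. if t \<in> {0..1} then norm (w t) else 0) \<in> borel_measurable lebesgue"
        by (rule iffD2[OF borel_measurable_if nm]) auto
      moreover have "AE t in lebesgue. (if t \<in> {0..1} then norm (w t) else 0) = (if t \<in> {0..1} then speed \<gamma> t else 0)"
        using w(2) by (subst (asm) AE_restrict_space_iff) auto
      ultimately have "(\<lambda>t. if t \<in> {0..1} then speed \<gamma> t else 0) \<in> borel_measurable lebesgue"
        by (rule borel_measurable_AE)
      then show ?thesis by (rule borel_measurable_if_D)
    qed
  qed
  have "bounded (\<gamma> ` {0..1})" by (intro compact_imp_bounded compact_continuous_image ac_curve_continuous ac) auto
  then obtain R where R: "\<And>s. s \<in> {0..1} \<Longrightarrow> norm (\<gamma> s) \<le> R" unfolding bounded_iff by (metis imageI)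
  have "continuous_on {0..1} (\<lambda>s. \<bar>calib_quad v s\<bar> + \<bar>calib_lin v \<beta> s\<bar>)"
    by (intro continuous_intros continuous_at_imp_continuous_on ballI DERIV_isCont[OF calib_coeff_derivs(1)[OF v]] DERIV_isCont[OF calib_coeff_derivs(2)[OF v]])
  then have "bounded ((\<lambda>s. \<bar>calib_quad v s\<bar> + \<bar>calib_lin v \<beta> s\<bar>) ` {0..1})" by (intro compact_imp_bounded compact_continuous_image) auto
  then obtain K where "\<forall>z\<in>(\<lambda>s. \<bar>calib_quad v s\<bar> + \<bar>calib_lin v \<beta> s\<bar>) ` {0..1}. norm z \<le> K"
    unfolding bounded_iff by blast
  then have K: "\<bar>calib_quad v s\<bar> + \<bar>calib_lin v \<beta> s\<bar> \<le> K" if "s \<in> {0..1}" for s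
    using that by fastforce
  define P where "P = 2 * K * R + K + \<bar>v\<bar> * R"
  have P: "norm (calib_momentum v \<beta> r (\<gamma> s)) \<le> P" if rs: "r \<in> {0..1}" "s \<in> {0..1}" for r s
  proof -
    have x: "\<bar>fst (\<gamma> s)\<bar> \<le> R" using norm_fst_le'[of "\<gamma> s"] R[OF rs(2)] by simp
    have k: "\<bar>calib_quad v r\<bar> \<le> K" "\<bar>calib_lin v \<beta> r\<bar> \<le> K" using K[OF rs(1)] by auto
    have "norm (calib_momentum v \<beta> r (\<gamma> s)) \<le> \<bar>2 * calib_quad v r * fst (\<gamma> s) + calib_lin v \<beta> r\<bar> + \<bar>v * fst (\<gamma> s)\<bar>"
      unfolding calib_momentum_def by (rule order_trans[OF norm_Pair_le]) simp
    also have "\<dots> \<le> 2 * (\<bar>calib_quad v r\<bar> * \<bar>fst (\<gamma> s)\<bar>) + \<bar>calib_lin v \<beta> r\<bar> + \<bar>v\<bar> * \<bar>fst (\<gamma> s)\<bar>"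
      using abs_triangle_ineq[of "2 * calib_quad v r * fst (\<gamma> s)" "calib_lin v \<beta> r"] by (simp add: abs_mult)
    also have "\<dots> \<le> 2 * (K * R) + K + \<bar>v\<bar> * R"
      using x k by (intro add_mono mult_mono mult_left_mono) auto
    finally show ?thesis by (simp add: P_def)
  qed
  have P0: "0 \<le> P" using order_trans[OF norm_ge_zero P[of 0 0]] by simp
  let ?D = "calib v \<beta> 1 (\<gamma> 1) - calib v \<beta> 0 (\<gamma> 0)"
  have key: "?D \<le> P * \<epsilon> + (L + \<epsilon>)\<^sup>2 / 2" if \<epsilon>: "\<epsilon> > 0" for \<epsilon>
  proof -
    obtain g where g: "continuous_on {0..1} g" "\<And>t. 0 < g t"
      and gi: "integral\<^sup>L ?M (\<lambda>t. \<bar>norm (w t) - g t\<bar>) < \<epsilon>"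
      using continuous_L1_approximation[OF ni _ \<epsilon>] by (metis norm_ge_zero)
    have gint: "integrable ?M g"
      by (rule continuous_imp_integrable_real[OF g(1)])
    define G where "G = integral {0..1} g"
    have GL: "G = integral\<^sup>L ?M g"
      unfolding G_def by (rule lebesgue_integral_eq_integral[OF gint, symmetric]) auto
    define \<tau> where "\<tau> s = integral {0..s} g / G" for s
    have gio: "g integrable_on {0..1}" using g(1) by (rule integrable_continuous_real)
    have Gpos: "G > 0"
    proof -
      have "G \<ge> 0" unfolding G_def by (rule integral_nonneg[OF gio]) (use g(2) in \<open>auto intro: less_imp_le\<close>)
      moreover have "G \<noteq> 0"
        using integral_eq_0_iff[OF g(1)] g(2) unfolding G_def by (auto simp: less_imp_le) (metis atLeastAtMost_iff less_irrefl order_refl zero_le_one)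
      ultimately show ?thesis by simp
    qed
    have d\<tau>: "(\<tau> has_real_derivative g s / G) (at s within {0..1})" if "s \<in> {0..1}" for s
      unfolding \<tau>_def[abs_def]
      by (rule DERIV_cdivide) (use integral_has_vector_derivative[OF g(1) that] in \<open>simp add: has_real_derivative_iff_has_vector_derivative\<close>)
    have \<tau>01: "\<tau> 0 = 0" "\<tau> 1 = 1" using Gpos by (auto simp: \<tau>_def G_def)
    have \<tau>: "\<tau> s \<in> {0..1}" if s: "s \<in> {0..1}" for s
    proof -
      have i: "g integrable_on {0..s}" using gio s by (auto intro: integrable_subinterval_real)
      have "0 \<le> integral {0..s} g" by (rule integral_nonneg[OF i]) (use g(2) in \<open>auto intro: less_imp_le\<close>)
      moreover have "integral {0..s} g \<le> G" unfolding G_def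
        by (rule integral_subset_le[OF _ i gio]) (use s g(2) in \<open>auto intro: less_imp_le\<close>)
      ultimately show ?thesis using Gpos by (auto simp: \<tau>_def)
    qed
    let ?p = "\<lambda>s. calib_momentum v \<beta> (\<tau> s) (\<gamma> s)"
    have i1: "((\<lambda>s. ?p s \<bullet> w s - (norm (?p s))\<^sup>2 / 2 * (g s / G)) has_integral ?D) {0..1}"
    proof -
      have "continuous_on {0..1} (\<lambda>s. g s / G)" using Gpos by (intro continuous_intros g(1)) auto
      from calib_along[OF w(1) v \<tau> d\<tau> this, of \<beta>] show ?thesis by (simp only: \<tau>01)
    qed
    have li: "integrable ?M (\<lambda>t. P * \<bar>norm (w t) - g t\<bar> + G / 2 * g t)" using ni gint by auto
    then have i2: "((\<lambda>t. P * \<bar>norm (w t) - g t\<bar> + G / 2 * g t) has_integral integral\<^sup>L ?M (\<lambda>t. P * \<bar>norm (w t) - g t\<bar> + G / 2 * g t)) {0..1}"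
      by (rule has_integral_integral_lebesgue_on) auto
    have "?D \<le> integral\<^sup>L ?M (\<lambda>t. P * \<bar>norm (w t) - g t\<bar> + G / 2 * g t)"
    proof (rule has_integral_le[OF i1 i2])
      fix s :: real assume s: "s \<in> {0..1}"
      have pP: "norm (?p s) \<le> P" using P[OF \<tau>[OF s] s] .
      have "?p s \<bullet> w s \<le> norm (?p s) * norm (w s)" by (rule norm_cauchy_schwarz)
      also have "\<dots> = norm (?p s) * (norm (w s) - g s) + norm (?p s) * g s" by (simp add: algebra_simps)
      also have "norm (?p s) * (norm (w s) - g s) \<le> P * \<bar>norm (w s) - g s\<bar>"
        by (rule order_trans[OF mult_left_mono[OF abs_ge_self] mult_right_mono[OF pP]]) auto
      finally have 1: "?p s \<bullet> w s \<le> P * \<bar>norm (w s) - g s\<bar> + norm (?p s) * g s" by simp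
      have "norm (?p s) - (norm (?p s))\<^sup>2 / (2 * G) \<le> G / 2"
        using zero_le_power2[of "norm (?p s) - G"] Gpos by (simp add: field_simps power2_eq_square)
      then have "g s * (norm (?p s) - (norm (?p s))\<^sup>2 / (2 * G)) \<le> g s * (G / 2)"
        by (intro mult_left_mono less_imp_le[OF g(2)])
      then show "?p s \<bullet> w s - (norm (?p s))\<^sup>2 / 2 * (g s / G) \<le> P * \<bar>norm (w s) - g s\<bar> + G / 2 * g s"
        using 1 by (simp add: algebra_simps)
    qed
    also have "\<dots> = P * integral\<^sup>L ?M (\<lambda>t. \<bar>norm (w t) - g t\<bar>) + G / 2 * G"
      using ni gint by (simp add: GL)
    also have "\<dots> \<le> P * \<epsilon> + (L + \<epsilon>)\<^sup>2 / 2"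
    proof (rule add_mono)
      show "P * integral\<^sup>L ?M (\<lambda>t. \<bar>norm (w t) - g t\<bar>) \<le> P * \<epsilon>" using gi P0 by (intro mult_left_mono) auto
      have "G - L = integral\<^sup>L ?M (\<lambda>t. g t - norm (w t))"
        unfolding GL L_def by (rule Bochner_Integration.integral_diff[OF gint ni, symmetric])
      also have "\<dots> \<le> integral\<^sup>L ?M (\<lambda>t. \<bar>norm (w t) - g t\<bar>)"
        by (rule integral_mono) (use ni gint in auto)
      finally have "G \<le> L + \<epsilon>" using gi by simp
      then have "G\<^sup>2 \<le> (L + \<epsilon>)\<^sup>2" using Gpos by (intro power_mono) auto
      then show "G / 2 * G \<le> (L + \<epsilon>)\<^sup>2 / 2" by (simp add: power2_eq_square)
    qed
    finally show ?thesis .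
  qed
  have lim: "(\<lambda>n. P * (1 / real (Suc n)) + (L + 1 / real (Suc n))\<^sup>2 / 2) \<longlonglongrightarrow> P * 0 + (L + 0)\<^sup>2 / 2"
    by (intro tendsto_intros LIMSEQ_Suc[OF lim_1_over_n]) auto
  have "?D \<le> P * 0 + (L + 0)\<^sup>2 / 2"
    by (rule LIMSEQ_le_const[OF lim], rule exI[of _ 0], intro allI impI key) simp
  then show ?thesis by (simp add: L)
qed


section \<open>Extremals and their minimality\<close>

definition sinc :: "real \<Rightarrow> real" where
  "sinc v = (if v = 0 then 1 else sin v / v)"

definition sin_rem :: "real \<Rightarrow> real" where
  "sin_rem v = (if v = 0 then 0 else (2 * v - sin (2 * v)) / (4 * v\<^sup>2))"

text \<open>
  The end point at time \<open>1\<close> of the extremal from \<open>q0\<close> with initial covector \<open>\<xi>\<close>.  It is written with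
  functions that have a removable singularity, so that it is smooth across \<open>v = 0\<close>.
\<close>
definition grushin_exp :: "plane \<Rightarrow> real \<times> real \<Rightarrow> plane" where
  "grushin_exp q0 \<xi> = (fst q0 * cos (snd \<xi>) + fst \<xi> * sinc (snd \<xi>),
     snd q0 + (fst q0)\<^sup>2 * (snd \<xi> + sin (snd \<xi>) * cos (snd \<xi>)) / 2
       + fst q0 * fst \<xi> * sin (snd \<xi>) * sinc (snd \<xi>) + (fst \<xi>)\<^sup>2 * sin_rem (snd \<xi>))"

text \<open>
  Abscissa, velocity of the abscissa, and height gained at time \<open>s\<close> along the extremal.
\<close>
definition ext_x :: "real \<Rightarrow> real \<Rightarrow> real \<Rightarrow> real \<Rightarrow> real" where
  "ext_x a u v s = a * cos (v * s) + (if v = 0 then u * s else u / v * sin (v * s))"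
definition ext_dx :: "real \<Rightarrow> real \<Rightarrow> real \<Rightarrow> real \<Rightarrow> real" where
  "ext_dx a u v s = u * cos (v * s) - a * v * sin (v * s)"
definition ext_y :: "real \<Rightarrow> real \<Rightarrow> real \<Rightarrow> real \<Rightarrow> real" where
  "ext_y a u v s = (if v = 0 then 0 else a\<^sup>2 * (v * s + sin (v * s) * cos (v * s)) / 2
     + a * (u / v) * (sin (v * s))\<^sup>2 + (u / v)\<^sup>2 * (v * s - sin (v * s) * cos (v * s)) / 2)"

lemma sin_rem_alt: "v \<noteq> 0 \<Longrightarrow> sin_rem v = (v - sin v * cos v) / (2 * v\<^sup>2)"
  using sin_double[of v] by (simp add: sin_rem_def field_simps)

text \<open>
  Multiplying the covector by \<open>s\<close> amounts to following the same extremal up to time \<open>s\<close>.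
\<close>
lemma grushin_exp_scale: "grushin_exp (a, y0) (s *\<^sub>R (u, v)) = (ext_x a u v s, y0 + ext_y a u v s)"
proof (cases "s = 0")
  case True
  then show ?thesis by (simp add: grushin_exp_def ext_x_def ext_y_def sin_rem_def sinc_def)
next
  case False
  then show ?thesis
  proof (cases "v = 0")
    case True
    then show ?thesis by (simp add: grushin_exp_def ext_x_def ext_y_def sinc_def sin_rem_def)
  next
    case v: False
    then show ?thesis using False
      by (simp add: grushin_exp_def ext_x_def ext_y_def sin_rem_alt sinc_def field_simps power2_eq_square)
  qed
qed

lemma grushin_exp_scale': "grushin_exp q0 (s *\<^sub>R \<xi>) = (ext_x (fst q0) (fst \<xi>) (snd \<xi>) s, snd q0 + ext_y (fst q0) (fst \<xi>) (snd \<xi>) s)"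
  using grushin_exp_scale[of "fst q0" "snd q0" s "fst \<xi>" "snd \<xi>"] by simp

lemma grushin_exp_zero [simp]: "grushin_exp q0 0 = q0"
  by (cases q0) (simp add: grushin_exp_def sinc_def sin_rem_def)

lemma ext_x_deriv: "(ext_x a u v has_real_derivative ext_dx a u v s) (at s within S)"
  unfolding ext_x_def[abs_def] ext_dx_def
  by (cases "v = 0") (auto intro!: derivative_eq_intros simp: field_simps)

lemma ext_dx_deriv: "(ext_dx a u v has_real_derivative - v\<^sup>2 * ext_x a u v s) (at s within S)"
  unfolding ext_x_def ext_dx_def[abs_def]
  by (cases "v = 0") (auto intro!: derivative_eq_intros simp: field_simps power2_eq_square)

lemma ext_y_deriv: "(ext_y a u v has_real_derivative v * (ext_x a u v s)\<^sup>2) (at s within S)"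
proof (cases "v = 0")
  case True
  then show ?thesis unfolding ext_y_def[abs_def] by simp
next
  case False
  define C where "C = cos (v * s)"
  define D where "D = sin (v * s)"
  define c where "c = u / v"
  have CD: "D\<^sup>2 = 1 - C\<^sup>2" by (simp add: C_def D_def sin_squared_eq)
  have "((\<lambda>s. a\<^sup>2 * (v * s + sin (v * s) * cos (v * s)) / 2 + a * c * (sin (v * s))\<^sup>2
      + c\<^sup>2 * (v * s - sin (v * s) * cos (v * s)) / 2) has_real_derivative
      a\<^sup>2 * (v + (v * C * C - v * D * D)) / 2 + a * c * (2 * D * (v * C)) + c\<^sup>2 * (v - (v * C * C - v * D * D)) / 2) (at s within S)"
    unfolding C_def D_def
    by (auto intro!: derivative_eq_intros simp: field_simps power2_eq_square)
  moreover have "a\<^sup>2 * (v + (v * C * C - v * D * D)) / 2 + a * c * (2 * D * (v * C)) + c\<^sup>2 * (v - (v * C * C - v * D * D)) / 2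
     = v * (a * C + c * D)\<^sup>2"
  proof -
    have "2 * (a\<^sup>2 * (v + (v * C * C - v * D * D)) / 2 + a * c * (2 * D * (v * C)) + c\<^sup>2 * (v - (v * C * C - v * D * D)) / 2)
      = a\<^sup>2 * (v + (v * C * C - v * D * D)) + 2 * a * c * (2 * D * (v * C)) + c\<^sup>2 * (v - (v * C * C - v * D * D))"
      by simp
    also have "\<dots> = 2 * (v * (a * C + c * D)\<^sup>2)" using CD by algebra
    finally show ?thesis by simp
  qed
  ultimately show ?thesis using False unfolding ext_y_def[abs_def] ext_x_def c_def C_def D_def by simp
qed

lemma ext_x_speed_sq: "(ext_dx a u v s)\<^sup>2 + (v * ext_x a u v s)\<^sup>2 = u\<^sup>2 + (v * a)\<^sup>2"
proof -
  have *: "v * ext_x a u v s = a * v * cos (v * s) + u * sin (v * s)"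
    by (simp add: ext_x_def field_simps)
  have "(C * u - a * v * D)\<^sup>2 + (a * v * C + u * D)\<^sup>2 = u\<^sup>2 + (v * a)\<^sup>2" if "D\<^sup>2 = 1 - C\<^sup>2" for C D :: real
    using that by algebra
  from this[OF sin_squared_eq[of "v * s"]] show ?thesis unfolding * ext_dx_def by (simp add: mult_ac)
qed

definition ext_control :: "plane \<Rightarrow> real \<times> real \<Rightarrow> real \<Rightarrow> real \<times> real" where
  "ext_control q0 \<xi> s = (ext_dx (fst q0) (fst \<xi>) (snd \<xi>) s, snd \<xi> * ext_x (fst q0) (fst \<xi>) (snd \<xi>) s)"

text \<open>
  The constant squared speed of the extremal, which is twice its Hamiltonian.
\<close>
definition speed_sq :: "plane \<Rightarrow> real \<times> real \<Rightarrow> real" where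
  "speed_sq q0 \<xi> = (fst \<xi>)\<^sup>2 + (snd \<xi> * fst q0)\<^sup>2"

lemma norm_ext_control: "norm (ext_control q0 \<xi> s) = sqrt (speed_sq q0 \<xi>)"
  unfolding norm_pair_real ext_control_def speed_sq_def by (simp add: ext_x_speed_sq)

lemma grushin_exp_has_vector_derivative:
  "((\<lambda>s. grushin_exp q0 (s *\<^sub>R \<xi>)) has_vector_derivative
     (fst (ext_control q0 \<xi> s), fst (grushin_exp q0 (s *\<^sub>R \<xi>)) * snd (ext_control q0 \<xi> s))) (at s within S)"
proof -
  have "((\<lambda>s. snd q0 + ext_y (fst q0) (fst \<xi>) (snd \<xi>) s) has_real_derivative snd \<xi> * (ext_x (fst q0) (fst \<xi>) (snd \<xi>) s)\<^sup>2) (at s within S)"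
    using DERIV_add[OF DERIV_const ext_y_deriv] by simp
  then show ?thesis
    unfolding grushin_exp_scale' ext_control_def
    using has_vector_derivative_Pair[OF ext_x_deriv[unfolded has_real_derivative_iff_has_vector_derivative]]
    by (simp add: has_real_derivative_iff_has_vector_derivative power2_eq_square mult_ac)
qed

lemma continuous_on_ext_x [continuous_intros]: "continuous_on S (ext_x a u v)" "continuous_on S (ext_dx a u v)"
  by (rule DERIV_continuous_on[OF ext_x_deriv], rule DERIV_continuous_on[OF ext_dx_deriv])

lemma grushin_exp_has_control: "has_control (\<lambda>s. grushin_exp q0 (s *\<^sub>R \<xi>)) (ext_control q0 \<xi>)"
proof (rule has_controlI)
  show "absolutely_continuous_curve (\<lambda>s. grushin_exp q0 (s *\<^sub>R \<xi>))"
    by (rule ac_curve_C1[OF grushin_exp_has_vector_derivative])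
       (auto simp: ext_control_def grushin_exp_scale' intro!: continuous_intros)
  have "continuous_on {0..1} (ext_control q0 \<xi>)"
    unfolding ext_control_def by (intro continuous_intros)
  then have "ext_control q0 \<xi> \<in> borel_measurable (lebesgue_on {0..1})"
    by (rule continuous_imp_measurable_on_sets_lebesgue) auto
  moreover have "integrable (lebesgue_on {0..1::real}) (\<lambda>t. (sqrt (speed_sq q0 \<xi>))\<^sup>2)"
    by (rule finite_measure.integrable_const[OF finite_measure_lebesgue_on]) auto
  ultimately show "ext_control q0 \<xi> \<in> l2_controls"
    by (simp add: l2_controls_def norm_ext_control)
qed (use grushin_exp_has_vector_derivative in auto)

lemma grushin_exp_horizontal: "horizontal (\<lambda>s. grushin_exp q0 (s *\<^sub>R \<xi>))"
  unfolding horizontal_def using grushin_exp_has_control by blast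

lemma grushin_exp_speed: "AE s in lebesgue_on {0..1}. speed (\<lambda>s. grushin_exp q0 (s *\<^sub>R \<xi>)) s = sqrt (speed_sq q0 \<xi>)"
  using speed_AE[OF grushin_exp_has_control[of q0 \<xi>]]
proof eventually_elim
  fix s assume "speed (\<lambda>s. grushin_exp q0 (s *\<^sub>R \<xi>)) s = sqrt ((fst (ext_control q0 \<xi> s))\<^sup>2 +
      (if fst (grushin_exp q0 (s *\<^sub>R \<xi>)) = 0 then 0 else (snd (ext_control q0 \<xi> s))\<^sup>2))"
  also have "\<dots> = norm (ext_control q0 \<xi> s)"
    unfolding norm_pair_real by (simp add: grushin_exp_scale' ext_control_def)
  finally show "speed (\<lambda>s. grushin_exp q0 (s *\<^sub>R \<xi>)) s = sqrt (speed_sq q0 \<xi>)" by (simp add: norm_ext_control)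
qed

lemma sr_length_const_speed:
  assumes "AE s in lebesgue_on {0..1}. speed \<gamma> s = c"
  shows "sr_length \<gamma> = c"
proof -
  have m: "(\<lambda>t. if t \<in> {0..1::real} then c else 0) \<in> borel_measurable lebesgue"
    by (rule iffD2[OF borel_measurable_if]) auto
  moreover have "AE t in lebesgue. (if t \<in> {0..1} then c else 0) = (if t \<in> {0..1} then speed \<gamma> t else 0)"
    using assms by (subst (asm) AE_restrict_space_iff) auto
  ultimately have "(\<lambda>t. if t \<in> {0..1} then speed \<gamma> t else 0) \<in> borel_measurable lebesgue"
    by (rule borel_measurable_AE)
  then have "speed \<gamma> \<in> borel_measurable (lebesgue_on {0..1})" by (rule borel_measurable_if_D)
  then have "sr_length \<gamma> = integral\<^sup>L (lebesgue_on {0..1::real}) (\<lambda>_. c)"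
    unfolding sr_length_def using assms by (intro integral_cong_AE) auto
  also have "\<dots> = c" by (simp add: measure_restrict_space)
  finally show ?thesis .
qed

lemma grushin_exp_length: "sr_length (\<lambda>s. grushin_exp q0 (s *\<^sub>R \<xi>)) = sqrt (speed_sq q0 \<xi>)"
  by (rule sr_length_const_speed[OF grushin_exp_speed])

text \<open>
  Extremals follow the gradient of the calibration: by the addition theorems
  \<open>x' cos \<delta> + v x sin \<delta>\<close> with \<open>\<delta> = v(s - 1/2)\<close> is constant, and its value at \<open>s = 1/2\<close> is \<open>\<beta>\<close>.
\<close>
lemma ext_control_eq_calib_momentum:
  fixes q0 :: plane
  assumes v: "\<bar>snd \<xi>\<bar> < pi" and s: "s \<in> {0..1}"
  defines "\<beta> \<equiv> ext_dx (fst q0) (fst \<xi>) (snd \<xi>) (1/2)"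
  shows "ext_control q0 \<xi> s = calib_momentum (snd \<xi>) \<beta> s (grushin_exp q0 (s *\<^sub>R \<xi>))"
proof -
  define a u v where "a = fst q0" and "u = fst \<xi>" and "v = snd \<xi>"
  define \<delta> where "\<delta> = v * (s - 1/2)"
  have c: "cos \<delta> \<noteq> 0" using cos_calib_pos[OF v s] by (simp add: \<delta>_def v_def)
  have vx: "v * ext_x a u v s = a * v * cos (v * s) + u * sin (v * s)"
    by (simp add: ext_x_def field_simps)
  have half: "v * (1/2) = v * s - \<delta>" by (simp add: \<delta>_def algebra_simps)
  have "\<beta> = ext_dx a u v s * cos \<delta> + (v * ext_x a u v s) * sin \<delta>"
    unfolding \<beta>_def vx ext_dx_def a_def[symmetric] u_def[symmetric] v_def[symmetric] half sin_diff cos_diff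
    by (simp add: algebra_simps)
  then have "ext_dx a u v s = \<beta> / cos \<delta> - v * tan \<delta> * ext_x a u v s"
    using c by (simp add: field_simps tan_def)
  then show ?thesis
    unfolding ext_control_def calib_momentum_def calib_quad_def calib_lin_def grushin_exp_scale' a_def[symmetric] u_def[symmetric] v_def[symmetric] \<delta>_def[symmetric]
    by simp
qed

text \<open>
  Along the extremal \<open>w = p\<close>, so the calibration grows at the constant rate \<open>\<bar>w\<bar>\<^sup>2 / 2\<close>.
\<close>
lemma calib_grushin_exp:
  fixes q0 :: plane
  assumes v: "\<bar>snd \<xi>\<bar> < pi"
  defines "\<beta> \<equiv> ext_dx (fst q0) (fst \<xi>) (snd \<xi>) (1/2)"
  shows "calib (snd \<xi>) \<beta> 1 (grushin_exp q0 \<xi>) - calib (snd \<xi>) \<beta> 0 q0 = speed_sq q0 \<xi> / 2"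
proof -
  have E0: "speed_sq q0 \<xi> \<ge> 0" by (simp add: speed_sq_def)
  have "((\<lambda>s. calib_momentum (snd \<xi>) \<beta> s (grushin_exp q0 (s *\<^sub>R \<xi>)) \<bullet> ext_control q0 \<xi> s - (norm (calib_momentum (snd \<xi>) \<beta> s (grushin_exp q0 (s *\<^sub>R \<xi>))))\<^sup>2 / 2 * 1)
     has_integral calib (snd \<xi>) \<beta> 1 (grushin_exp q0 (1 *\<^sub>R \<xi>)) - calib (snd \<xi>) \<beta> 0 (grushin_exp q0 (0 *\<^sub>R \<xi>))) {0..1}"
    by (rule calib_along[OF grushin_exp_has_control v, where \<tau> = "\<lambda>s. s"]) auto
  then have i1: "((\<lambda>s. calib_momentum (snd \<xi>) \<beta> s (grushin_exp q0 (s *\<^sub>R \<xi>)) \<bullet> ext_control q0 \<xi> s - (norm (calib_momentum (snd \<xi>) \<beta> s (grushin_exp q0 (s *\<^sub>R \<xi>))))\<^sup>2 / 2)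
     has_integral calib (snd \<xi>) \<beta> 1 (grushin_exp q0 \<xi>) - calib (snd \<xi>) \<beta> 0 q0) {0..1}"
    by simp
  have "((\<lambda>s::real. speed_sq q0 \<xi> / 2) has_integral calib (snd \<xi>) \<beta> 1 (grushin_exp q0 \<xi>) - calib (snd \<xi>) \<beta> 0 q0) {0..1}"
  proof (rule has_integral_eq[OF _ i1])
    fix s :: real assume s: "s \<in> {0..1}"
    show "calib_momentum (snd \<xi>) \<beta> s (grushin_exp q0 (s *\<^sub>R \<xi>)) \<bullet> ext_control q0 \<xi> s - (norm (calib_momentum (snd \<xi>) \<beta> s (grushin_exp q0 (s *\<^sub>R \<xi>))))\<^sup>2 / 2 = speed_sq q0 \<xi> / 2"
    proof -
      have e: "calib_momentum (snd \<xi>) \<beta> s (grushin_exp q0 (s *\<^sub>R \<xi>)) = ext_control q0 \<xi> s"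
        using ext_control_eq_calib_momentum[OF v s, of q0] by (simp add: \<beta>_def)
      have "ext_control q0 \<xi> s \<bullet> ext_control q0 \<xi> s = speed_sq q0 \<xi>"
        using E0 by (simp add: dot_square_norm norm_ext_control)
      then show ?thesis unfolding e using E0 by (simp add: norm_ext_control)
    qed
  qed
  moreover have "((\<lambda>s::real. speed_sq q0 \<xi> / 2) has_integral speed_sq q0 \<xi> / 2) {0..1}"
    using has_integral_const_real[of "speed_sq q0 \<xi> / 2" 0 1] by simp
  ultimately show ?thesis by (rule has_integral_unique)
qed

lemma d_SR_eqI:
  assumes "horizontal \<gamma>" "\<gamma> 0 = p" "\<gamma> 1 = q"
    and "\<And>\<eta>. horizontal \<eta> \<Longrightarrow> \<eta> 0 = p \<Longrightarrow> \<eta> 1 = q \<Longrightarrow> sr_length \<gamma> \<le> sr_length \<eta>"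
  shows "d_SR p q = sr_length \<gamma>"
  unfolding d_SR_def by (rule cInf_eq_minimum) (use assms in auto)

theorem grushin_exp_minimizing:
  assumes v: "\<bar>snd \<xi>\<bar> < pi"
  shows "d_SR q0 (grushin_exp q0 \<xi>) = sqrt (speed_sq q0 \<xi>)"
    and "minimizing_geodesic (\<lambda>s. grushin_exp q0 (s *\<^sub>R \<xi>))"
proof -
  have "d_SR q0 (grushin_exp q0 \<xi>) = sr_length (\<lambda>s. grushin_exp q0 (s *\<^sub>R \<xi>))"
  proof (rule d_SR_eqI[OF grushin_exp_horizontal])
    fix \<eta> assume \<eta>: "horizontal \<eta>" "\<eta> 0 = q0" "\<eta> 1 = grushin_exp q0 \<xi>"
    have "speed_sq q0 \<xi> \<le> (sr_length \<eta>)\<^sup>2"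
      using calib_length_bound[OF \<eta>(1) v, of "ext_dx (fst q0) (fst \<xi>) (snd \<xi>) (1/2)"] calib_grushin_exp[OF v, of q0] \<eta> by simp
    then show "sr_length (\<lambda>s. grushin_exp q0 (s *\<^sub>R \<xi>)) \<le> sr_length \<eta>"
      unfolding grushin_exp_length using sr_length_nonneg[OF \<eta>(1)] by (simp add: real_le_lsqrt)
  qed auto
  then show 1: "d_SR q0 (grushin_exp q0 \<xi>) = sqrt (speed_sq q0 \<xi>)" by (simp add: grushin_exp_length)
  show "minimizing_geodesic (\<lambda>s. grushin_exp q0 (s *\<^sub>R \<xi>))"
    unfolding minimizing_geodesic_def using grushin_exp_horizontal grushin_exp_speed[of q0 \<xi>] 1 by (auto simp: grushin_exp_length)
qed

text \<open>
  A minimizer attains equality in the calibration, hence follows its gradient.  The resulting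
  differential equation for \<open>x\<close> is linear, and the difference of two solutions is a multiple of
  \<open>cos(v(s - 1/2))\<close>; this factor has no zero, so equal starting points give equal abscissas, and then
  \<open>y' = v x\<^sup>2\<close> gives equal heights.
\<close>
theorem grushin_exp_unique:
  assumes v: "\<bar>snd \<xi>\<bar> < pi" and \<eta>: "minimizing_geodesic \<eta>" "\<eta> 0 = q0" "\<eta> 1 = grushin_exp q0 \<xi>" and s: "s \<in> {0..1}"
  shows "\<eta> s = grushin_exp q0 (s *\<^sub>R \<xi>)"
proof -
  let ?M = "lebesgue_on {0..1::real}"
  let ?\<gamma> = "\<lambda>s. grushin_exp q0 (s *\<^sub>R \<xi>)"
  define \<beta> where "\<beta> = ext_dx (fst q0) (fst \<xi>) (snd \<xi>) (1/2)"
  define v where "v = snd \<xi>"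
  have h: "horizontal \<eta>" and len: "sr_length \<eta> = sqrt (speed_sq q0 \<xi>)"
    using \<eta> grushin_exp_minimizing(1)[OF v, of q0] by (auto simp: minimizing_geodesic_def)
  obtain w where w: "has_control \<eta> w" "AE t in ?M. speed \<eta> t = norm (w t)"
    by (rule horizontal_normalised[OF h])
  obtain c where c: "AE t in ?M. speed \<eta> t = c" using \<eta>(1) by (auto simp: minimizing_geodesic_def)
  have ceq: "c = sqrt (speed_sq q0 \<xi>)" using sr_length_const_speed[OF c] len by simp
  have "AE t in ?M. norm (w t) = sqrt (speed_sq q0 \<xi>)" using w(2) c by eventually_elim (simp add: ceq)
  moreover have "(sqrt (speed_sq q0 \<xi>))\<^sup>2 = speed_sq q0 \<xi>" by (simp add: speed_sq_def)
  ultimately have weq: "AE t in ?M. w t = calib_momentum v \<beta> t (\<eta> t)"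
    using calib_equality[OF w(1) v] calib_grushin_exp[OF v, of q0] \<eta> by (simp add: v_def \<beta>_def)
  have "AE t in ?M. t \<in> {0..1::real}" by (metis AE_space space_lebesgue_on)
  then have ae: "AE t in ?M. t \<in> {0..1} \<and> (\<eta> has_vector_derivative (2 * calib_quad v t * fst (\<eta> t) + calib_lin v \<beta> t, v * (fst (\<eta> t))\<^sup>2)) (at t within {0..1})"
    using has_control_AE[OF w(1)] weq
    by eventually_elim (simp add: calib_momentum_def power2_eq_square mult_ac)
  have de: "(?\<gamma> has_vector_derivative (2 * calib_quad v t * fst (?\<gamma> t) + calib_lin v \<beta> t, v * (fst (?\<gamma> t))\<^sup>2)) (at t within {0..1})"
    if "t \<in> {0..1}" for t
    using grushin_exp_has_vector_derivative[of q0 \<xi> t "{0..1}"] ext_control_eq_calib_momentum[OF v that, of q0]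
    by (simp add: calib_momentum_def v_def \<beta>_def power2_eq_square mult_ac)
  have ac\<eta>: "absolutely_continuous_curve \<eta>" and ac\<gamma>: "absolutely_continuous_curve ?\<gamma>"
    using w(1) grushin_exp_has_control[of q0 \<xi>] by (auto simp: has_control_def)
  note acx = ac_curve_diff[OF ac_curve_fst[OF ac\<eta>] ac_curve_fst[OF ac\<gamma>]]
    and acy = ac_curve_diff[OF ac_curve_snd[OF ac\<eta>] ac_curve_snd[OF ac\<gamma>]]
  have x: "fst (\<eta> t) = fst (?\<gamma> t)" if t: "t \<in> {0..1}" for t
  proof -
    have dcos: "((\<lambda>s. 1 / cos (v * (s - 1/2))) has_real_derivative - 2 * calib_quad v r * (1 / cos (v * (r - 1/2)))) (at r within {0..1})"
      if "r \<in> {0..1}" for r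
      using calib_coeff_derivs(2)[OF v that, of 1] unfolding calib_lin_def[abs_def] v_def by (rule has_field_derivative_at_within)
    have "absolutely_continuous_curve (\<lambda>s. 1 / cos (v * (s - 1/2)))"
      by (rule ac_curve_C1[OF dcos[unfolded has_real_derivative_iff_has_vector_derivative]])
         (auto intro!: continuous_intros DERIV_continuous_on[OF has_field_derivative_at_within[OF calib_coeff_derivs(1)]]
            simp: v[folded v_def] dest!: cos_calib_pos[OF v, folded v_def])
    then have acz: "absolutely_continuous_curve (\<lambda>s. (fst (\<eta> s) - fst (?\<gamma> s)) * (1 / cos (v * (s - 1/2))))"
      by (rule ac_curve_mult[OF acx])
    have "AE r in ?M. ((\<lambda>s. (fst (\<eta> s) - fst (?\<gamma> s)) * (1 / cos (v * (s - 1/2)))) has_vector_derivative 0) (at r within {0..1})"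
      using ae
    proof eventually_elim
      fix r :: real assume *: "r \<in> {0..1} \<and> (\<eta> has_vector_derivative (2 * calib_quad v r * fst (\<eta> r) + calib_lin v \<beta> r, v * (fst (\<eta> r))\<^sup>2)) (at r within {0..1})"
      have "((\<lambda>s. fst (\<eta> s)) has_real_derivative 2 * calib_quad v r * fst (\<eta> r) + calib_lin v \<beta> r) (at r within {0..1})"
        "((\<lambda>s. fst (?\<gamma> s)) has_real_derivative 2 * calib_quad v r * fst (?\<gamma> r) + calib_lin v \<beta> r) (at r within {0..1})"
        using bounded_linear.has_vector_derivative[OF bounded_linear_fst *[THEN conjunct2]]
          bounded_linear.has_vector_derivative[OF bounded_linear_fst de[OF *[THEN conjunct1]]]
        by (simp_all add: has_real_derivative_iff_has_vector_derivative)
      note d = DERIV_mult[OF DERIV_diff[OF this] dcos[OF *[THEN conjunct1]]]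
      have ring: "(2 * A * x + B - (2 * A * y + B)) * k + (- 2 * A * k) * (x - y) = 0" for A B x y k :: real
        by (simp add: algebra_simps)
      show "((\<lambda>s. (fst (\<eta> s) - fst (?\<gamma> s)) * (1 / cos (v * (s - 1/2)))) has_vector_derivative 0) (at r within {0..1})"
        using d unfolding ring has_real_derivative_iff_has_vector_derivative .
    qed
    from ac_curve_const[OF acz this t] have "(fst (\<eta> t) - fst (?\<gamma> t)) * (1 / cos (v * (t - 1/2))) = 0"
      using \<eta>(2) by simp
    then show ?thesis using cos_calib_pos[OF v t] by (simp add: v_def)
  qed
  have "AE r in ?M. ((\<lambda>s. snd (\<eta> s) - snd (?\<gamma> s)) has_vector_derivative 0) (at r within {0..1})"
    using ae
  proof eventually_elim
    fix r :: real assume *: "r \<in> {0..1} \<and> (\<eta> has_vector_derivative (2 * calib_quad v r * fst (\<eta> r) + calib_lin v \<beta> r, v * (fst (\<eta> r))\<^sup>2)) (at r within {0..1})"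
    show "((\<lambda>s. snd (\<eta> s) - snd (?\<gamma> s)) has_vector_derivative 0) (at r within {0..1})"
      using has_vector_derivative_diff[OF bounded_linear.has_vector_derivative[OF bounded_linear_snd *[THEN conjunct2]]
          bounded_linear.has_vector_derivative[OF bounded_linear_snd de[OF *[THEN conjunct1]]]] x[OF *[THEN conjunct1]]
      by simp
  qed
  from ac_curve_const[OF acy this s] have "snd (\<eta> s) = snd (?\<gamma> s)" using \<eta>(2) by simp
  then show ?thesis using x[OF s] by (simp add: prod_eq_iff)
qed


section \<open>The Hamiltonian flow\<close>

lemma hamiltonian_field_grushin:
  "hamiltonian_field grushin_hamiltonian z =
     ((- (fst (snd z)) * (snd (fst z))\<^sup>2, 0), (fst (fst z), (fst (snd z))\<^sup>2 * snd (fst z)))"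
proof -
  obtain u v x y where z: "z = ((u, v), (x, y))" by (metis prod.exhaust)
  have "deriv (\<lambda>s. (u\<^sup>2 + s\<^sup>2 * v\<^sup>2) / 2) x = x * v\<^sup>2"
    by (rule DERIV_imp_deriv) (auto intro!: derivative_eq_intros)
  moreover have "deriv (\<lambda>s. (s\<^sup>2 + x\<^sup>2 * v\<^sup>2) / 2) u = u"
    by (rule DERIV_imp_deriv) (auto intro!: derivative_eq_intros)
  moreover have "deriv (\<lambda>s. (u\<^sup>2 + x\<^sup>2 * s\<^sup>2) / 2) v = x\<^sup>2 * v"
    by (rule DERIV_imp_deriv) (auto intro!: derivative_eq_intros)
  ultimately show ?thesis by (simp add: z)
qed

lemma has_vector_derivative_components:
  assumes "(c has_vector_derivative d) (at s)"
  shows "((\<lambda>s. fst (fst (c s))) has_real_derivative fst (fst d)) (at s)"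
    "((\<lambda>s. snd (fst (c s))) has_real_derivative snd (fst d)) (at s)"
    "((\<lambda>s. fst (snd (c s))) has_real_derivative fst (snd d)) (at s)"
    "((\<lambda>s. snd (snd (c s))) has_real_derivative snd (snd d)) (at s)"
proof -
  note f = bounded_linear.has_vector_derivative[OF bounded_linear_fst]
  note g = bounded_linear.has_vector_derivative[OF bounded_linear_snd]
  show "((\<lambda>s. fst (fst (c s))) has_real_derivative fst (fst d)) (at s)"
    "((\<lambda>s. snd (fst (c s))) has_real_derivative snd (fst d)) (at s)"
    "((\<lambda>s. fst (snd (c s))) has_real_derivative fst (snd d)) (at s)"
    "((\<lambda>s. snd (snd (c s))) has_real_derivative snd (snd d)) (at s)"
    unfolding has_real_derivative_iff_has_vector_derivative
    using f[OF f[OF assms]] g[OF f[OF assms]] f[OF g[OF assms]] g[OF g[OF assms]] by auto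
qed

text \<open>
  The momentum \<open>v\<close> is conserved, and the difference from the explicit solution is then a motion of the
  harmonic oscillator with frequency \<open>v\<close>.  Its energy \<open>E\<close> is conserved and vanishes at time \<open>0\<close>.
\<close>
lemma hamiltonian_integral_curve:
  assumes c0: "c 0 = (\<xi>, q0)"
    and d: "\<And>s. (c has_vector_derivative hamiltonian_field grushin_hamiltonian (c s)) (at s)"
  shows "snd (c s) = grushin_exp q0 (s *\<^sub>R \<xi>)" "fst (c s) = (ext_dx (fst q0) (fst \<xi>) (snd \<xi>) s, snd \<xi>)"
proof -
  define U where "U s = fst (fst (c s))" for s
  define V where "V s = snd (fst (c s))" for s
  define X where "X s = fst (snd (c s))" for s
  define Y where "Y s = snd (snd (c s))" for s
  define a u v where "a = fst q0" and "u = fst \<xi>" and "v = snd \<xi>"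
  have init: "U 0 = u" "V 0 = v" "X 0 = a" "Y 0 = snd q0"
    by (simp_all add: U_def V_def X_def Y_def c0 a_def u_def v_def)
  have dU: "(U has_real_derivative - X s * (V s)\<^sup>2) (at s)" and dV: "(V has_real_derivative 0) (at s)"
    and dX: "(X has_real_derivative U s) (at s)" and dY: "(Y has_real_derivative (X s)\<^sup>2 * V s) (at s)" for s
    using has_vector_derivative_components[OF d[of s]]
    unfolding hamiltonian_field_grushin U_def[abs_def] V_def[abs_def] X_def[abs_def] Y_def[abs_def] by simp_all
  have V: "V s = v" for s using DERIV_isconst_all[of V s 0] dV init by simp
  have start: "ext_x a u v 0 = a" "ext_y a u v 0 = 0" by (simp_all add: ext_x_def ext_y_def)
  define E where "E s = (U s - ext_dx a u v s)\<^sup>2 + v\<^sup>2 * (X s - ext_x a u v s)\<^sup>2" for s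
  have "(E has_real_derivative 0) (at s)" for s
  proof -
    have "(E has_real_derivative 2 * (U s - ext_dx a u v s) * (- X s * v\<^sup>2 - - v\<^sup>2 * ext_x a u v s)
        + v\<^sup>2 * (2 * (X s - ext_x a u v s) * (U s - ext_dx a u v s))) (at s)"
      unfolding E_def[abs_def] V[symmetric, of s]
      by (rule derivative_eq_intros dU dX ext_x_deriv ext_dx_deriv refl)+ (simp add: V algebra_simps)
    then show ?thesis by (simp add: algebra_simps)
  qed
  then have "E s = E 0" for s using DERIV_isconst_all[of E s 0] by simp
  moreover have "E 0 = 0" by (simp add: E_def init ext_x_def ext_dx_def)
  ultimately have E: "E s = 0" for s by simp
  have U: "U s = ext_dx a u v s" for s
    using E[of s] unfolding E_def by (simp add: add_nonneg_eq_0_iff)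
  have "((\<lambda>s. X s - ext_x a u v s) has_real_derivative 0) (at s)" for s
    using DERIV_diff[OF dX ext_x_deriv[of a u v s UNIV]] by (simp add: U)
  then have "X s - ext_x a u v s = X 0 - ext_x a u v 0" for s
    using DERIV_isconst_all[of "\<lambda>s. X s - ext_x a u v s" s 0] by simp
  then have X: "X s = ext_x a u v s" for s by (simp add: init start)
  have "((\<lambda>s. Y s - ext_y a u v s) has_real_derivative 0) (at s)" for s
    using DERIV_diff[OF dY ext_y_deriv[of a u v s UNIV]] by (simp add: X V mult.commute)
  then have "Y s - ext_y a u v s = Y 0 - ext_y a u v 0" for s
    using DERIV_isconst_all[of "\<lambda>s. Y s - ext_y a u v s" s 0] by simp
  then have Y: "Y s = snd q0 + ext_y a u v s" for s by (simp add: init start algebra_simps)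
  show "snd (c s) = grushin_exp q0 (s *\<^sub>R \<xi>)"
    unfolding grushin_exp_scale' using X[of s] Y[of s] by (simp add: X_def Y_def a_def u_def v_def prod_eq_iff)
  show "fst (c s) = (ext_dx (fst q0) (fst \<xi>) (snd \<xi>) s, snd \<xi>)"
    using U[of s] V[of s] by (simp add: U_def V_def a_def u_def v_def prod_eq_iff)
qed

lemma sr_exp_eq_grushin_exp: "sr_exp q0 \<xi> = grushin_exp q0 \<xi>"
proof -
  define a u v where "a = fst q0" and "u = fst \<xi>" and "v = snd \<xi>"
  define c where "c s = ((ext_dx a u v s, v), grushin_exp q0 (s *\<^sub>R \<xi>))" for s
  have c0: "c 0 = (\<xi>, q0)" by (simp add: c_def ext_dx_def u_def v_def)
  have dc: "(c has_vector_derivative hamiltonian_field grushin_hamiltonian (c s)) (at s)" for s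
  proof -
    have "(c has_vector_derivative ((- v\<^sup>2 * ext_x a u v s, 0), (fst (ext_control q0 \<xi> s), fst (grushin_exp q0 (s *\<^sub>R \<xi>)) * snd (ext_control q0 \<xi> s)))) (at s)"
      unfolding c_def[abs_def]
      by (intro has_vector_derivative_Pair grushin_exp_has_vector_derivative has_vector_derivative_const
          ext_dx_deriv[unfolded has_real_derivative_iff_has_vector_derivative])
    also have "((- v\<^sup>2 * ext_x a u v s, 0), (fst (ext_control q0 \<xi> s), fst (grushin_exp q0 (s *\<^sub>R \<xi>)) * snd (ext_control q0 \<xi> s)))
      = hamiltonian_field grushin_hamiltonian (c s)"
      unfolding hamiltonian_field_grushin c_def ext_control_def grushin_exp_scale' a_def u_def v_def
      by (simp add: power2_eq_square mult_ac)
    finally show ?thesis .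
  qed
  have "hamiltonian_flow grushin_hamiltonian 1 (\<xi>, q0) = c 1"
    unfolding hamiltonian_flow_def
  proof (rule the_equality)
    show "\<exists>c'. c' 0 = (\<xi>, q0) \<and> c' 1 = c 1 \<and> (\<forall>s. (c' has_vector_derivative hamiltonian_field grushin_hamiltonian (c' s)) (at s))"
      using c0 dc by blast
    fix w assume "\<exists>c'. c' 0 = (\<xi>, q0) \<and> c' 1 = w \<and> (\<forall>s. (c' has_vector_derivative hamiltonian_field grushin_hamiltonian (c' s)) (at s))"
    then obtain c' where c': "c' 0 = (\<xi>, q0)" "c' 1 = w"
      "\<And>s. (c' has_vector_derivative hamiltonian_field grushin_hamiltonian (c' s)) (at s)" by blast
    show "w = c 1"
      using hamiltonian_integral_curve[OF c'(1,3), of 1] c'(2) by (simp add: c_def a_def u_def v_def prod_eq_iff)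
  qed
  then show ?thesis by (simp add: sr_exp_def c_def)
qed


section \<open>The Jacobian of the exponential map: the comparison inequality\<close>

lemma sin_gt_mult_cos:
  fixes h :: real
  assumes "0 < h" "h < pi"
  shows "h * cos h < sin h"
proof -
  have "(\<lambda>x. sin x - x * cos x) 0 < (\<lambda>x. sin x - x * cos x) h"
  proof (rule DERIV_pos_imp_increasing_open[OF assms(1)])
    fix x :: real assume x: "0 < x" "x < h"
    have "((\<lambda>x. sin x - x * cos x) has_real_derivative x * sin x) (at x)"
      by (auto intro!: derivative_eq_intros)
    moreover have "x * sin x > 0" using x assms by (simp add: sin_gt_zero)
    ultimately show "\<exists>y. ((\<lambda>x. sin x - x * cos x) has_real_derivative y) (at x) \<and> 0 < y" by blast
  qed (intro continuous_intros)
  then show ?thesis by simp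
qed

text \<open>
  The quantity \<open>k = \<theta> cot \<theta>\<close> solves the Riccati equation \<open>\<theta> k' = k - k\<^sup>2 - \<theta>\<^sup>2\<close>, and the claim is
  \<open>k \<le> g\<close> for \<open>g = (17 - 5w)/(5 - w)\<close>, the smaller root of the quadratic in \<open>k\<close> that comes out of the
  discriminant in \<open>jac_form_decreasing\<close>.  Both sides are \<open>1\<close> at \<open>\<theta> = 0\<close>, and \<open>g\<close> is a supersolution.
  The auxiliary function \<open>F\<close> is \<open>\<theta> cos \<theta> - g sin \<theta>\<close> times an integrating factor; up to positive factors
  its derivative is the cubic \<open>4w\<^sup>2 - w\<^sup>3 - 3w - 8\<close>, which is negative for \<open>w \<ge> 3\<close>.
\<close>
lemma cot_bound:
  fixes \<theta> :: real
  assumes \<theta>: "0 < \<theta>" "\<theta> < pi"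
  defines "w \<equiv> sqrt (9 + \<theta>\<^sup>2)"
  shows "(5 - w) * \<theta> * cos \<theta> \<le> (17 - 5 * w) * sin \<theta>"
proof -
  define W where "W x = sqrt (9 + x\<^sup>2)" for x :: real
  define F where "F x = ((5 - W x) * x * cos x - (17 - 5 * W x) * sin x) * ((5 - W x) powr (3/2) * (W x + 3) powr (3/2))" for x
  have W: "3 \<le> W x" "W x < 4.4" "(W x)\<^sup>2 = 9 + x\<^sup>2" "0 < x \<Longrightarrow> 3 < W x" if "0 \<le> x" "x < pi" for x
  proof -
    show sq: "(W x)\<^sup>2 = 9 + x\<^sup>2" by (simp add: W_def)
    have "x < 3.2" using that order_le_less_trans[OF pi_approx(2), of "3.2"] by (simp add: field_simps)
    then have "x\<^sup>2 < 3.2\<^sup>2" using that by (intro power_strict_mono) auto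
    then have "W x < sqrt (4.4\<^sup>2)" unfolding W_def by (intro real_sqrt_less_mono) (simp add: power2_eq_square)
    then show "W x < 4.4" by simp
    have "sqrt (3\<^sup>2) \<le> W x" unfolding W_def by (intro real_sqrt_le_mono) simp
    then show "3 \<le> W x" by simp
    have "sqrt (3\<^sup>2) < W x" if "0 < x" unfolding W_def using that by (intro real_sqrt_less_mono) simp
    then show "0 < x \<Longrightarrow> 3 < W x" by simp
  qed
  have "F \<theta> \<le> F 0"
  proof (rule DERIV_nonpos_imp_decreasing_open[of 0 \<theta>])
    show "0 \<le> \<theta>" using \<theta> by simp
    show "continuous_on {0..\<theta>} F"
      unfolding F_def W_def
      by (intro continuous_intros) (use W \<theta> in \<open>force simp: W_def\<close>)+
    fix x :: real assume x: "0 < x" "x < \<theta>"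
    have x': "0 \<le> x" "x < pi" using x \<theta> by auto
    have Wx: "3 < W x" "W x < 4.4" "(W x)\<^sup>2 = 9 + x\<^sup>2" using W[OF x'] x by auto
    have dW: "(W has_real_derivative x / W x) (at x)"
    proof -
      have "9 + x\<^sup>2 > 0" by (simp add: add_pos_nonneg)
      moreover have "((\<lambda>x. 9 + x\<^sup>2) has_real_derivative 2 * x) (at x)"
        by (auto intro!: derivative_eq_intros)
      ultimately have "(W has_real_derivative inverse (sqrt (9 + x\<^sup>2)) / 2 * (2 * x)) (at x)"
        unfolding W_def by (intro DERIV_chain2[OF DERIV_real_sqrt])
      then show ?thesis by (simp add: W_def field_simps)
    qed
    define A where "A = (5 - W x) powr (1/2) * (W x + 3) powr (1/2)"
    define P where "P = (5 - W x) * x * cos x - (17 - 5 * W x) * sin x"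
    have p32: "z powr (3/2) = z powr (1/2) * z" if "z > 0" for z :: real
      using powr_add[of z "1/2" 1] that by simp
    define D where "D = ((5 - W x) * cos x - (5 - W x) * x * sin x - x / W x * x * cos x
              - (17 - 5 * W x) * cos x + 5 * (x / W x) * sin x) * ((5 - W x) powr (3/2) * (W x + 3) powr (3/2))
              + P * (3/2 * (5 - W x) powr (1/2) * (- (x / W x)) * (W x + 3) powr (3/2)
                   + (5 - W x) powr (3/2) * (3/2 * (W x + 3) powr (1/2) * (x / W x)))"
    have dF: "(F has_real_derivative D) (at x)"
    proof -
      have d1: "((\<lambda>x. (5 - W x) * x * cos x - (17 - 5 * W x) * sin x) has_real_derivative
        ((5 - W x) * cos x - (5 - W x) * x * sin x - x / W x * x * cos x
              - (17 - 5 * W x) * cos x + 5 * (x / W x) * sin x)) (at x)"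
        by (rule derivative_eq_intros dW refl)+ (simp add: algebra_simps)
      have d2: "((\<lambda>x. (5 - W x) powr (3/2)) has_real_derivative 3/2 * (5 - W x) powr (1/2) * (- (x / W x))) (at x)"
      proof -
        have "((\<lambda>x. 5 - W x) has_real_derivative - (x / W x)) (at x)"
          by (rule derivative_eq_intros dW refl)+ simp
        from DERIV_fun_powr[OF this, of "3/2"] show ?thesis using Wx by simp
      qed
      have d3: "((\<lambda>x. (W x + 3) powr (3/2)) has_real_derivative 3/2 * (W x + 3) powr (1/2) * (x / W x)) (at x)"
      proof -
        have "((\<lambda>x. W x + 3) has_real_derivative x / W x) (at x)"
          by (rule derivative_eq_intros dW refl)+ simp
        from DERIV_fun_powr[OF this, of "3/2"] show ?thesis using Wx by simp
      qed
      show ?thesis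
        unfolding F_def
        by (rule DERIV_cong[OF DERIV_mult[OF d1 DERIV_mult[OF d2 d3]]]) (simp add: D_def P_def algebra_simps)
    qed
    have "D * (W x * x) \<le> 0"
    proof -
      have D_eq: "D = A * (((5 - W x) * cos x - (5 - W x) * x * sin x - x / W x * x * cos x
              - (17 - 5 * W x) * cos x + 5 * (x / W x) * sin x) * ((5 - W x) * (W x + 3))
              + P * (3/2 * (- (x / W x)) * (W x + 3) + (5 - W x) * (3/2 * (x / W x))))"
      proof -
        have ring: "X * ((\<alpha> * y) * (\<beta> * z)) + P * (3/2 * \<alpha> * (- q) * (\<beta> * z) + (\<alpha> * y) * (3/2 * \<beta> * q))
          = (\<alpha> * \<beta>) * (X * (y * z) + P * (3/2 * (- q) * z + y * (3/2 * q)))" for X \<alpha> \<beta> y z q :: real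
          by (simp add: algebra_simps)
        have "5 - W x > 0" "W x + 3 > 0" using Wx by auto
        then show ?thesis unfolding D_def A_def by (simp only: p32 ring)
      qed
      then have "D * (W x * x) = A * (((W x * x * (5 - W x) * cos x - (5 - W x) * W x * x\<^sup>2 * sin x - x\<^sup>2 * x * cos x
              - (17 - 5 * W x) * W x * x * cos x + 5 * x\<^sup>2 * sin x)) * ((5 - W x) * (W x + 3))
              + P * (3/2 * (- x\<^sup>2) * (W x + 3) + (5 - W x) * (3/2 * x\<^sup>2)))"
      proof -
        have ring: "B * ((y * c - y * x * s - q * x * c - r * c + 5 * q * s) * (y * z) + p * (3/2 * (- q) * z + y * (3/2 * q))) * (w * x)
          = B * (((w * x * y * c - y * w * x\<^sup>2 * s - x\<^sup>2 * x * c - r * w * x * c + 5 * x\<^sup>2 * s)) * (y * z)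
              + p * (3/2 * (- x\<^sup>2) * z + y * (3/2 * x\<^sup>2)))" if "w * q = x" for B y c s q r z p w :: real
        proof -
          have "B * ((y * c - y * x * s - q * x * c - r * c + 5 * q * s) * (y * z) + p * (3/2 * (- q) * z + y * (3/2 * q))) * (w * x)
            = B * (((w * x * y * c - y * w * x\<^sup>2 * s - (w * q) * x * x * c - r * w * x * c + 5 * (w * q) * x * s)) * (y * z)
              + p * (3/2 * (- ((w * q) * x)) * z + y * (3/2 * ((w * q) * x))))"
            by (simp add: algebra_simps power2_eq_square)
          then show ?thesis unfolding that by (simp add: power2_eq_square mult.assoc)
        qed
        have "W x * (x / W x) = x" using Wx by simp
        from ring[OF this] show ?thesis by (simp only: D_eq)
      qed
      also have "x\<^sup>2 = (W x - 3) * (W x + 3)" using Wx(3) by (simp add: algebra_simps power2_eq_square)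
      finally have eq: "D * (W x * x) = A * (sin x * (W x - 3) * (W x - 3) * (4 * (W x)\<^sup>2 - (W x)^3 - 3 * W x - 8) * (W x + 3))"
        unfolding P_def by (simp add: field_simps power2_eq_square power3_eq_cube)
      \<comment> \<open>Taylor expansion at \<open>w = 3\<close>: the value there is \<open>-8\<close> and the remaining terms are negative.\<close>
    have neg: "4 * (W x)\<^sup>2 - (W x)^3 - 3 * W x - 8 \<le> 0"
      proof -
        have "4 * (W x)\<^sup>2 - (W x)^3 - 3 * W x - 8 = (W x - 3) * (W x - 3) * (- W x - 2) + (- 6 * (W x) +10)"
          by (simp add: algebra_simps power2_eq_square power3_eq_cube)
        moreover have "(W x - 3) * (W x - 3) * (- W x - 2) \<le> 0" using Wx by (intro mult_nonneg_nonpos) auto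
        ultimately show ?thesis using Wx by linarith
      qed
      have "A \<ge> 0" by (simp add: A_def)
      moreover have "sin x \<ge> 0" using x' by (simp add: sin_ge_zero)
      ultimately show ?thesis unfolding eq using neg Wx
        by (intro mult_nonneg_nonpos mult_nonpos_nonneg mult_nonneg_nonneg) auto
    qed
    then have "D \<le> 0" using x Wx by (simp add: mult_le_0_iff)
    then show "\<exists>y. (F has_real_derivative y) (at x) \<and> y \<le> 0" using dF by blast
  qed
  also have "F 0 = 0" by (simp add: F_def)
  finally have "F \<theta> \<le> 0" .
  moreover have "(5 - W \<theta>) powr (3/2) * (W \<theta> + 3) powr (3/2) > 0" using W[of \<theta>] \<theta> by simp
  ultimately have "(5 - W \<theta>) * \<theta> * cos \<theta> - (17 - 5 * W \<theta>) * sin \<theta> \<le> 0"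
    unfolding F_def using W[of \<theta>] \<theta> by (auto simp: mult_le_0_iff)
  then show ?thesis by (simp add: W_def w_def)
qed

text \<open>
  The Jacobian determinant of the exponential map from a point with abscissa \<open>a\<close>, in closed form.
\<close>
definition jac :: "real \<Rightarrow> real \<Rightarrow> real \<Rightarrow> real" where
  "jac a u v = (if v = 0 then a\<^sup>2 + a * u + u\<^sup>2 / 3
     else a\<^sup>2 * sinc v + a * u * sinc v + u\<^sup>2 * ((sin v - v * cos v) / v ^ 3))"

lemma jac_uminus: "jac a u (- v) = jac a u v"
  by (simp add: jac_def sinc_def field_simps)

lemma psd_form:
  fixes P M T a c :: real
  assumes "P > 0" "M\<^sup>2 \<le> 4 * P * T"
  shows "0 \<le> P * a\<^sup>2 + M * a * c + T * c\<^sup>2"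
proof -
  have "4 * P * (P * a\<^sup>2 + M * a * c + T * c\<^sup>2) = (2 * P * a + M * c)\<^sup>2 + (4 * P * T - M\<^sup>2) * c\<^sup>2"
    by (simp add: power2_eq_square algebra_simps)
  also have "\<dots> \<ge> 0" using assms by (intro add_nonneg_nonneg mult_nonneg_nonneg) auto
  finally show ?thesis using assms(1) by (simp add: zero_le_mult_iff)
qed

text \<open>
  The claim is that \<open>Q(\<theta>)/\<theta>\<^sup>4\<close> does not increase, that is \<open>4Q - \<theta>Q' \<ge> 0\<close>.  This is a quadratic form in
  \<open>(a, c)\<close> whose first coefficient is positive.  With \<open>w = \<surd>(9 + \<theta>\<^sup>2)\<close> its negated discriminant splits
  into two factors that are exchanged by \<open>w \<mapsto> -w\<close>: one is nonpositive by \<open>cot_bound\<close>, the other by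
  \<open>\<theta> cos \<theta> < sin \<theta>\<close>.
\<close>
lemma jac_form_decreasing:
  fixes a c v t :: real
  assumes v: "0 < v" "v < pi" and t: "0 < t" "t \<le> 1"
  defines "Q \<equiv> \<lambda>\<theta>. a\<^sup>2 * sin \<theta> + a * c * \<theta> * sin \<theta> + c\<^sup>2 * (sin \<theta> - \<theta> * cos \<theta>)"
  shows "t ^ 4 * Q v \<le> Q (t * v)"
proof -
  have tv: "0 < t * v" "t * v \<le> v" using v t by (auto simp: mult_left_le_one_le)
  have "Q v / v ^ 4 \<le> Q (t * v) / (t * v) ^ 4"
  proof (rule DERIV_nonpos_imp_nonincreasing[OF tv(2)])
    fix x assume x: "t * v \<le> x" "x \<le> v"
    then have x0: "0 < x" "x < pi" using tv v by linarith+
    define s where "s = sin x"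
    define k where "k = cos x"
    define Q' where "Q' = a\<^sup>2 * k + a * c * (s + x * k) + c\<^sup>2 * (x * s)"
    have dQ: "(Q has_real_derivative Q') (at x)"
      unfolding Q_def Q'_def s_def k_def
      by (rule derivative_eq_intros refl)+ (simp add: algebra_simps)
    have d: "((\<lambda>x. Q x / x ^ 4) has_real_derivative - (4 * Q x - x * Q') / x ^ 5) (at x)"
    proof -
      have "((\<lambda>x. Q x / x ^ 4) has_real_derivative (Q' * x ^ 4 - Q x * (4 * x ^ 3)) / (x ^ 4 * x ^ 4)) (at x)"
        using DERIV_divide[OF dQ, of "\<lambda>x. x ^ 4" "4 * x ^ 3"] x0 DERIV_pow[of 4 x] by simp
      also have "(Q' * x ^ 4 - Q x * (4 * x ^ 3)) / (x ^ 4 * x ^ 4) = - (4 * Q x - x * Q') / x ^ 5"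
        using x0 by (simp add: divide_simps) algebra
      finally show ?thesis .
    qed
    define w where "w = sqrt (9 + x\<^sup>2)"
    have w: "w\<^sup>2 = 9 + x\<^sup>2" "w \<ge> 0" by (auto simp: w_def)
    have s0: "s > 0" using x0 by (simp add: s_def sin_gt_zero)
    have xk: "x * k < s" using sin_gt_mult_cos[OF x0] by (simp add: s_def k_def)
    have n2: "(5 - w) * x * k \<le> (17 - 5 * w) * s"
      using cot_bound[OF x0] by (simp add: s_def k_def w_def)
    have n3: "(5 + w) * x * k \<le> (17 + 5 * w) * s"
    proof -
      have "(5 + w) * (x * k) \<le> (5 + w) * s" using xk w by (intro mult_left_mono) auto
      also have "\<dots> \<le> (17 + 5 * w) * s" using s0 w by (intro mult_right_mono) auto
      finally show ?thesis by (simp add: mult.assoc)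
    qed
    have "0 \<le> (4 * s - x * k) * a\<^sup>2 + (x * (3 * s - x * k)) * a * c + (4 * s - 4 * x * k - x\<^sup>2 * s) * c\<^sup>2"
    proof (rule psd_form)
      show "0 < 4 * s - x * k" using xk s0 by linarith
      have "4 * (4 * s - x * k) * (4 * s - 4 * x * k - x\<^sup>2 * s) - (x * (3 * s - x * k))\<^sup>2
        = (25 - (9 + x\<^sup>2)) * x\<^sup>2 * k\<^sup>2 - x * s * k * (170 - 10 * (9 + x\<^sup>2)) + (289 - 25 * (9 + x\<^sup>2)) * s\<^sup>2"
        by (simp add: algebra_simps power2_eq_square)
      also have "\<dots> = ((5 - w) * x * k - (17 - 5 * w) * s) * ((5 + w) * x * k - (17 + 5 * w) * s)"
        unfolding w(1)[symmetric] by (simp add: algebra_simps power2_eq_square)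
      also have "\<dots> \<ge> 0" using n2 n3 by (intro mult_nonpos_nonpos) auto
      finally show "(x * (3 * s - x * k))\<^sup>2 \<le> 4 * (4 * s - x * k) * (4 * s - 4 * x * k - x\<^sup>2 * s)" by simp
    qed
    also have "\<dots> = 4 * Q x - x * Q'"
      by (simp add: Q_def Q'_def s_def k_def algebra_simps power2_eq_square)
    finally have "- (4 * Q x - x * Q') / x ^ 5 \<le> 0" using x0 by (intro divide_nonpos_pos) auto
    then show "\<exists>y. ((\<lambda>x. Q x / x ^ 4) has_real_derivative y) (at x) \<and> y \<le> 0" using d by blast
  qed
  then have "Q v * (t * v) ^ 4 \<le> Q (t * v) * v ^ 4"
    using v tv t by (simp add: divide_le_eq pos_le_divide_eq field_simps)
  then have "(t ^ 4 * Q v) * v ^ 4 \<le> Q (t * v) * v ^ 4"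
    by (simp add: power_mult_distrib mult_ac)
  then show ?thesis using v by simp
qed

text \<open>
  For \<open>v > 0\<close> the determinant is \<open>Q(v)/v\<close> with \<open>c = u/v\<close>, and scaling the covector leaves \<open>c\<close> alone.  At
  \<open>v = 0\<close> both sides are polynomials, and their difference is \<open>1 - t\<close> times a nonnegative quadratic form.
\<close>
lemma jac_scaling:
  assumes v: "\<bar>v\<bar> < pi" and t: "0 < t" "t \<le> 1"
  shows "t ^ 3 * jac a u v \<le> jac a (t * u) (t * v)"
proof -
  have pos: "t ^ 3 * jac a u v \<le> jac a (t * u) (t * v)" if "0 < v" "v < pi" for v
  proof -
    have *: "t ^ 4 * (a\<^sup>2 * sin v + a * (u / v) * v * sin v + (u / v)\<^sup>2 * (sin v - v * cos v))
       \<le> a\<^sup>2 * sin (t * v) + a * (u / v) * (t * v) * sin (t * v) + (u / v)\<^sup>2 * (sin (t * v) - (t * v) * cos (t * v))"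
      using jac_form_decreasing[OF that t, of a "u / v"] .
    have "t ^ 3 * jac a u v = t ^ 4 * (a\<^sup>2 * sin v + a * (u / v) * v * sin v + (u / v)\<^sup>2 * (sin v - v * cos v)) / (t * v)"
      using that t by (simp add: jac_def sinc_def field_simps eval_nat_numeral)
    also have "\<dots> \<le> (a\<^sup>2 * sin (t * v) + a * (u / v) * (t * v) * sin (t * v) + (u / v)\<^sup>2 * (sin (t * v) - (t * v) * cos (t * v))) / (t * v)"
      using * that t by (intro divide_right_mono) auto
    also have "\<dots> = jac a (t * u) (t * v)"
      using that t by (simp add: jac_def sinc_def field_simps eval_nat_numeral)
    finally show ?thesis .
  qed
  consider "v > 0" | "v < 0" | "v = 0" by linarith
  then show ?thesis
  proof cases
    case 1
    then show ?thesis using pos v by simp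
  next
    case 2
    then show ?thesis using pos[of "- v"] v by (simp add: jac_uminus)
  next
    case 3
    have "0 \<le> 3 * (1 + t + t\<^sup>2) * a\<^sup>2 + 3 * t * (1 + t) * a * u + t\<^sup>2 * u\<^sup>2"
    proof (rule psd_form)
      show "0 < 3 * (1 + t + t\<^sup>2)" using t by (simp add: add_pos_nonneg)
      have "4 * (3 * (1 + t + t\<^sup>2)) * t\<^sup>2 - (3 * t * (1 + t))\<^sup>2 = 3 * t\<^sup>2 * (1 - t)\<^sup>2"
        by (simp add: algebra_simps power2_eq_square)
      also have "\<dots> \<ge> 0" by simp
      finally show "(3 * t * (1 + t))\<^sup>2 \<le> 4 * (3 * (1 + t + t\<^sup>2)) * t\<^sup>2" by simp
    qed
    then have "0 \<le> (1 - t) * (3 * (1 + t + t\<^sup>2) * a\<^sup>2 + 3 * t * (1 + t) * a * u + t\<^sup>2 * u\<^sup>2) / 3"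
      using t by (intro divide_nonneg_pos mult_nonneg_nonneg) auto
    also have "\<dots> = jac a (t * u) (t * v) - t ^ 3 * jac a u v"
      using 3 by (simp add: jac_def field_simps eval_nat_numeral)
    finally show ?thesis by simp
  qed
qed

text \<open>
  In terms of the midpoint values \<open>X = x(1/2)\<close> and \<open>Y = x'(1/2)/v\<close> the quadratic form becomes diagonal, and
  its coefficients are positive because \<open>h cos h < sin h\<close>.
\<close>
lemma jac_pos:
  assumes v: "\<bar>v\<bar> < pi" and au: "a \<noteq> 0 \<or> u \<noteq> 0"
  shows "0 < jac a u v"
proof -
  have pos: "0 < jac a u v" if v: "0 < v" "v < pi" for v
  proof -
    define h where "h = v / 2"
    define X where "X = a * cos h + u / v * sin h"
    define Y where "Y = u / v * cos h - a * sin h"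
    have h: "0 < h" "h < pi / 2" "h < pi" using v by (auto simp: h_def)
    have sh: "sin h > 0" "cos h > 0" "sin h - h * cos h > 0"
      using h sin_gt_mult_cos[of h] by (auto intro: sin_gt_zero cos_gt_zero)
    have sum1: "sin h * sin h = 1 - cos h * cos h"
      using sin_cos_squared_add[of h] by (simp add: power2_eq_square)
    have XY: "X\<^sup>2 + Y\<^sup>2 = a\<^sup>2 + (u / v)\<^sup>2"
    proof -
      have "(a * C + b * S)\<^sup>2 + (b * C - a * S)\<^sup>2 = a\<^sup>2 + b\<^sup>2" if "S * S = 1 - C * C" for b S C :: real
        using that by algebra
      from this[OF sum1] show ?thesis by (simp only: X_def Y_def)
    qed
    have "X\<^sup>2 + Y\<^sup>2 > 0" unfolding XY using au v by (auto simp: sum_power2_gt_zero_iff)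
    then have XY0: "X \<noteq> 0 \<or> Y \<noteq> 0" by auto
    have sv: "sin v = 2 * sin h * cos h" using sin_double[of h] by (simp add: h_def)
    have cv: "cos v = 2 * cos h * cos h - 1" using cos_double_cos[of h] by (simp add: h_def power2_eq_square)
    have Q: "jac a u v * v = a\<^sup>2 * sin v + a * (u / v) * v * sin v + (u / v)\<^sup>2 * (sin v - v * cos v)"
      using v by (simp add: jac_def sinc_def field_simps eval_nat_numeral)
    also have "\<dots> = 2 * (X\<^sup>2 * (sin h * (cos h + h * sin h)) + Y\<^sup>2 * (cos h * (sin h - h * cos h)))"
    proof -
      have vh: "v = 2 * h" by (simp add: h_def)
      define b where "b = u / v"
      define S where "S = sin h"
      define C where "C = cos h"
      have SS: "S * S = 1 - C * C" using sum1 by (simp add: S_def C_def)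
      have "a\<^sup>2 * sin v + a * b * v * sin v + b\<^sup>2 * (sin v - v * cos v)
         = a\<^sup>2 * (2 * S * C) + a * b * (2 * h) * (2 * S * C) + b\<^sup>2 * (2 * S * C - 2 * h * (2 * C * C - 1))"
        unfolding sv cv S_def C_def by (simp add: vh)
      also have "\<dots> = 2 * ((a * C + b * S)\<^sup>2 * (S * (C + h * S)) + (b * C - a * S)\<^sup>2 * (C * (S - h * C)))"
        using SS by algebra
      finally show ?thesis unfolding X_def Y_def S_def C_def b_def .
    qed
    also have "\<dots> > 0"
    proof -
      have p1: "sin h * (cos h + h * sin h) > 0" and p2: "cos h * (sin h - h * cos h) > 0"
        using sh h by (simp_all add: add_pos_nonneg)
      show ?thesis using XY0
      proof
        assume "X \<noteq> 0"
        then have "X\<^sup>2 * (sin h * (cos h + h * sin h)) > 0" using p1 by simp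
        moreover have "Y\<^sup>2 * (cos h * (sin h - h * cos h)) \<ge> 0" using p2 by simp
        ultimately show ?thesis by (simp add: add_pos_nonneg)
      next
        assume "Y \<noteq> 0"
        then have "Y\<^sup>2 * (cos h * (sin h - h * cos h)) > 0" using p2 by simp
        moreover have "X\<^sup>2 * (sin h * (cos h + h * sin h)) \<ge> 0" using p1 by simp
        ultimately show ?thesis by (simp add: add_nonneg_pos)
      qed
    qed
    finally show ?thesis using v by (simp add: zero_less_mult_iff)
  qed
  consider "v > 0" | "v < 0" | "v = 0" by linarith
  then show ?thesis
  proof cases
    case 1
    then show ?thesis using pos v by simp
  next
    case 2
    then show ?thesis using pos[of "- v"] v by (simp add: jac_uminus)
  next
    case 3
    have "jac a u v = (a + u / 2)\<^sup>2 + u\<^sup>2 / 12"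
      using 3 by (simp add: jac_def power2_eq_square field_simps)
    then show ?thesis using au by (cases "u = 0") (auto simp: add_nonneg_pos)
  qed
qed


section \<open>The differential of the exponential map\<close>

text \<open>
  The sine series without its first \<open>k\<close> terms, divided by \<open>x\<^sup>k\<close>.  Being power series, these functions
  are smooth at \<open>0\<close>, and the quotients in the exponential map are among them.
\<close>
definition sin_tail :: "nat \<Rightarrow> real \<Rightarrow> real" where
  "sin_tail k x = (\<Sum>n. sin_coeff (n + k) * x ^ n)"

lemma summable_sin_tail: "summable (\<lambda>n. sin_coeff (n + k) * x ^ n :: real)"
proof (cases "x = 0")
  case True
  then show ?thesis by (simp add: summable_0_powser)
next
  case False
  have "summable (\<lambda>n. sin_coeff n * x ^ n)" using summable_norm_cancel[OF summable_norm_sin[of x]] by simp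
  then have "summable (\<lambda>n. sin_coeff (n + k) * x ^ (n + k))" by (rule summable_ignore_initial_segment)
  then have "summable (\<lambda>n. inverse (x ^ k) * (sin_coeff (n + k) * x ^ (n + k)))" by (rule summable_mult)
  moreover have "inverse (x ^ k) * (sin_coeff (n + k) * x ^ (n + k)) = sin_coeff (n + k) * x ^ n" for n
    using False by (simp add: power_add field_simps)
  ultimately show ?thesis by simp
qed

lemma sin_tail_step: "sin_tail k x = sin_coeff k + x * sin_tail (Suc k) x"
proof -
  have "sin_tail k x = (\<Sum>n. sin_coeff (Suc n + k) * x ^ Suc n) + sin_coeff (0 + k) * x ^ 0"
    using suminf_split_head[OF summable_sin_tail, of k x] unfolding sin_tail_def by simp
  also have "(\<Sum>n. sin_coeff (Suc n + k) * x ^ Suc n) = (\<Sum>n. x * (sin_coeff (n + Suc k) * x ^ n))"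
    by (simp add: mult_ac)
  also have "\<dots> = x * sin_tail (Suc k) x"
    unfolding sin_tail_def by (rule suminf_mult[OF summable_sin_tail])
  finally show ?thesis by simp
qed

lemma sin_tail_0: "sin_tail 0 x = sin x"
  unfolding sin_tail_def sin_def by simp

lemma sinc_eq: "sinc = sin_tail 1"
proof
  fix v :: real
  have "sin v = v * sin_tail 1 v" using sin_tail_step[of 0 v] by (simp add: sin_tail_0 sin_coeff_def)
  moreover have "sin_tail 1 0 = 1" using sin_tail_step[of 1 0] by (simp add: sin_coeff_def)
  ultimately show "sinc v = sin_tail 1 v" by (simp add: sinc_def)
qed

lemma sin_rem_eq: "sin_rem v = - sin_tail 2 (2 * v)"
proof -
  have "sin (2 * v) = 2 * v + (2 * v)\<^sup>2 * sin_tail 2 (2 * v)"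
    using sin_tail_step[of 0 "2 * v"] sin_tail_step[of 1 "2 * v"]
    by (simp add: sin_tail_0 sin_coeff_def numeral_2_eq_2 algebra_simps)
  moreover have "sin_tail 2 0 = 0" using sin_tail_step[of 2 0] by (simp add: sin_coeff_def)
  ultimately show ?thesis by (simp add: sin_rem_def field_simps)
qed

definition sin_tail' :: "nat \<Rightarrow> real \<Rightarrow> real" where
  "sin_tail' k x = (\<Sum>n. diffs (\<lambda>n. sin_coeff (n + k)) n * x ^ n)"

lemma sin_tail_deriv: "(sin_tail k has_real_derivative sin_tail' k x) (at x)"
  unfolding sin_tail_def[abs_def] sin_tail'_def
  by (rule termdiffs_strong_converges_everywhere[OF summable_sin_tail])

lemma sin_tail'_cont: "isCont (sin_tail' k) x"
  unfolding sin_tail'_def[abs_def]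
  by (rule DERIV_isCont[OF termdiffs_strong_converges_everywhere[OF termdiff_converges_all[OF summable_sin_tail]]])

lemma sin_tail'_0: "sin_tail' k 0 = sin_coeff (Suc k)"
  unfolding sin_tail'_def by (simp add: powser_zero diffs_def)

definition sinc' :: "real \<Rightarrow> real" where "sinc' = sin_tail' 1"
definition sin_rem' :: "real \<Rightarrow> real" where "sin_rem' v = - 2 * sin_tail' 2 (2 * v)"

lemma sinc_deriv: "(sinc has_real_derivative sinc' v) (at v)"
  unfolding sinc_eq sinc'_def by (rule sin_tail_deriv)

lemma sin_rem_deriv: "(sin_rem has_real_derivative sin_rem' v) (at v)"
proof -
  have "((\<lambda>v. - sin_tail 2 (2 * v)) has_real_derivative - (sin_tail' 2 (2 * v) * 2)) (at v)"
    by (intro DERIV_minus DERIV_chain2[OF sin_tail_deriv]) (auto intro!: derivative_eq_intros)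
  then show ?thesis unfolding sin_rem_eq[abs_def] sin_rem'_def by (simp add: mult.commute)
qed

lemma continuous_sinc [continuous_intros]:
  "continuous_on S f \<Longrightarrow> continuous_on S (\<lambda>x. sinc (f x))"
  "continuous_on S f \<Longrightarrow> continuous_on S (\<lambda>x. sin_rem (f x))"
  "continuous_on S f \<Longrightarrow> continuous_on S (\<lambda>x. sinc' (f x))"
  "continuous_on S f \<Longrightarrow> continuous_on S (\<lambda>x. sin_rem' (f x))"
proof -
  have 1: "continuous_on UNIV sinc" "continuous_on UNIV sin_rem" "continuous_on UNIV sinc'"
    unfolding sinc'_def
    by (intro continuous_at_imp_continuous_on ballI DERIV_isCont[OF sinc_deriv] DERIV_isCont[OF sin_rem_deriv] sin_tail'_cont)+
  have "continuous_on UNIV (\<lambda>v. sin_tail' 2 (2 * v))"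
    by (intro continuous_at_imp_continuous_on ballI isCont_o2[OF _ sin_tail'_cont] continuous_intros)
  then have 2: "continuous_on UNIV sin_rem'" unfolding sin_rem'_def[abs_def] by (intro continuous_intros)
  show "continuous_on S f \<Longrightarrow> continuous_on S (\<lambda>x. sinc (f x))"
    "continuous_on S f \<Longrightarrow> continuous_on S (\<lambda>x. sin_rem (f x))"
    "continuous_on S f \<Longrightarrow> continuous_on S (\<lambda>x. sinc' (f x))"
    "continuous_on S f \<Longrightarrow> continuous_on S (\<lambda>x. sin_rem' (f x))"
    using continuous_on_compose2[OF 1(1)] continuous_on_compose2[OF 1(2)] continuous_on_compose2[OF 1(3)]
      continuous_on_compose2[OF 2] by auto
qed

lemma sinc'_sin_rem'_zero: "sinc' 0 = 0" "sin_rem' 0 = 1 / 3"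
proof -
  show "sinc' 0 = 0" by (simp add: sinc'_def sin_tail'_0 sin_coeff_def)
  have "sin_coeff 3 = (- 1 / 6 :: real)" by (simp add: sin_coeff_def fact_numeral)
  then show "sin_rem' 0 = 1 / 3" by (simp add: sin_rem'_def sin_tail'_0 numeral_3_eq_3[symmetric])
qed

lemma sinc'_nonzero: "v \<noteq> 0 \<Longrightarrow> sinc' v = (v * cos v - sin v) / v\<^sup>2"
proof (rule DERIV_unique[OF sinc_deriv])
  assume v: "v \<noteq> 0"
  have "((\<lambda>v. sin v / v) has_real_derivative (v * cos v - sin v) / v\<^sup>2) (at v)"
    using v by (auto intro!: derivative_eq_intros simp: field_simps power2_eq_square)
  then show "(sinc has_real_derivative (v * cos v - sin v) / v\<^sup>2) (at v)"
    by (rule has_field_derivative_transform_within_open[where S = "- {0}"]) (use v in \<open>auto simp: sinc_def\<close>)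
qed

lemma sin_rem'_nonzero: "v \<noteq> 0 \<Longrightarrow> sin_rem' v = ((sin v)\<^sup>2 * v - (v - sin v * cos v)) / v ^ 3"
proof (rule DERIV_unique[OF sin_rem_deriv])
  assume v: "v \<noteq> 0"
  have s2: "cos v * cos v = 1 - sin v * sin v" using sin_cos_squared_add[of v] by (simp add: power2_eq_square)
  have "((\<lambda>v. (v - sin v * cos v) / (2 * v\<^sup>2)) has_real_derivative
      ((1 - (cos v * cos v - sin v * sin v)) * (2 * v\<^sup>2) - (v - sin v * cos v) * (4 * v)) / ((2 * v\<^sup>2) * (2 * v\<^sup>2))) (at v)"
    using v by (auto intro!: derivative_eq_intros)
  also have "((1 - (cos v * cos v - sin v * sin v)) * (2 * v\<^sup>2) - (v - sin v * cos v) * (4 * v)) / ((2 * v\<^sup>2) * (2 * v\<^sup>2))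
      = ((sin v)\<^sup>2 * v - (v - sin v * cos v)) / v ^ 3"
    unfolding s2 using v by (simp add: field_simps eval_nat_numeral)
  finally show "(sin_rem has_real_derivative ((sin v)\<^sup>2 * v - (v - sin v * cos v)) / v ^ 3) (at v)"
    by (rule has_field_derivative_transform_within_open[where S = "- {0}"]) (use v in \<open>auto simp: sin_rem_alt\<close>)
qed

definition dx_du where "dx_du a \<xi> = sinc (snd \<xi> :: real)" for a :: real and \<xi> :: "real \<times> real"
definition dx_dv :: "real \<Rightarrow> real \<times> real \<Rightarrow> real" where
  "dx_dv a \<xi> = - a * sin (snd \<xi>) + fst \<xi> * sinc' (snd \<xi>)"
definition dy_du :: "real \<Rightarrow> real \<times> real \<Rightarrow> real" where
  "dy_du a \<xi> = a * sin (snd \<xi>) * sinc (snd \<xi>) + 2 * fst \<xi> * sin_rem (snd \<xi>)"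
definition dy_dv :: "real \<Rightarrow> real \<times> real \<Rightarrow> real" where
  "dy_dv a \<xi> = a\<^sup>2 * (cos (snd \<xi>))\<^sup>2 + a * fst \<xi> * (cos (snd \<xi>) * sinc (snd \<xi>) + sin (snd \<xi>) * sinc' (snd \<xi>))
     + (fst \<xi>)\<^sup>2 * sin_rem' (snd \<xi>)"

lemma grushin_exp_has_derivative:
  "(grushin_exp q0 has_derivative (\<lambda>h. (dx_du (fst q0) \<xi> * fst h + dx_dv (fst q0) \<xi> * snd h,
      dy_du (fst q0) \<xi> * fst h + dy_dv (fst q0) \<xi> * snd h))) (at \<xi>)"
proof -
  define a where "a = fst q0"
  have dS: "((\<lambda>\<xi>. sinc (snd \<xi>)) has_derivative (\<lambda>h. snd h * sinc' (snd \<xi>))) (at \<xi>)"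
    by (rule DERIV_compose_FDERIV[OF sinc_deriv]) (auto intro!: derivative_eq_intros)
  have dR: "((\<lambda>\<xi>. sin_rem (snd \<xi>)) has_derivative (\<lambda>h. snd h * sin_rem' (snd \<xi>))) (at \<xi>)"
    by (rule DERIV_compose_FDERIV[OF sin_rem_deriv]) (auto intro!: derivative_eq_intros)
  have dc: "((\<lambda>\<xi>. cos (snd \<xi>)) has_derivative (\<lambda>h. snd h * - sin (snd \<xi>))) (at \<xi>)"
    by (rule DERIV_compose_FDERIV[OF DERIV_cos]) (auto intro!: derivative_eq_intros)
  have ds: "((\<lambda>\<xi>. sin (snd \<xi>)) has_derivative (\<lambda>h. snd h * cos (snd \<xi>))) (at \<xi>)"
    by (rule DERIV_compose_FDERIV[OF DERIV_sin]) (auto intro!: derivative_eq_intros)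
  have du: "(fst has_derivative fst) (at \<xi>)" and dv: "(snd has_derivative snd) (at \<xi>)"
    by (auto intro!: derivative_eq_intros)
  have s2: "(cos (snd \<xi>))\<^sup>2 = 1 - (sin (snd \<xi>))\<^sup>2" by (simp add: cos_squared_eq)
  have 1: "((\<lambda>\<xi>. a * cos (snd \<xi>) + fst \<xi> * sinc (snd \<xi>)) has_derivative (\<lambda>h. dx_du a \<xi> * fst h + dx_dv a \<xi> * snd h)) (at \<xi>)"
    by (rule derivative_eq_intros dS dc du refl)+ (simp add: dx_du_def dx_dv_def algebra_simps)
  have 2: "((\<lambda>\<xi>. snd q0 + (a\<^sup>2 / 2) * (snd \<xi> + sin (snd \<xi>) * cos (snd \<xi>))
       + a * (fst \<xi> * (sin (snd \<xi>) * sinc (snd \<xi>))) + (fst \<xi> * fst \<xi>) * sin_rem (snd \<xi>)) has_derivative (\<lambda>h. dy_du a \<xi> * fst h + dy_dv a \<xi> * snd h)) (at \<xi>)"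
    by (rule dS dR ds dc du dv derivative_eq_intros refl)+
       (simp add: fun_eq_iff dy_du_def dy_dv_def s2 field_simps, simp add: power2_eq_square algebra_simps s2[unfolded power2_eq_square])
  have 2: "((\<lambda>\<xi>. snd q0 + a\<^sup>2 * (snd \<xi> + sin (snd \<xi>) * cos (snd \<xi>)) / 2
       + a * fst \<xi> * sin (snd \<xi>) * sinc (snd \<xi>) + (fst \<xi>)\<^sup>2 * sin_rem (snd \<xi>)) has_derivative (\<lambda>h. dy_du a \<xi> * fst h + dy_dv a \<xi> * snd h)) (at \<xi>)"
    using 2 by (simp add: mult_ac power2_eq_square)
  show ?thesis
    unfolding grushin_exp_def[abs_def] a_def[symmetric] by (rule has_derivative_Pair[OF 1 2])
qed

lemma grushin_exp_jacobian: "dx_du a \<xi> * dy_dv a \<xi> - dx_dv a \<xi> * dy_du a \<xi> = jac a (fst \<xi>) (snd \<xi>)"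
proof (cases "snd \<xi> = 0")
  case True
  then show ?thesis by (simp add: dx_du_def dx_dv_def dy_du_def dy_dv_def jac_def sinc'_sin_rem'_zero sin_rem_def sinc_def power2_eq_square)
next
  case False
  define u v s c where "u = fst \<xi>" and "v = snd \<xi>" and "s = sin v" and "c = cos v"
  define w where "w = 1 / v"
  have vw: "v * w = 1" using False by (simp add: w_def v_def)
  have cc: "c * c = 1 - s * s" using sin_cos_squared_add[of v] by (simp add: s_def c_def power2_eq_square)
  have e: "sinc v = s * w" "sinc' v = (v * c - s) * w\<^sup>2" "sin_rem v = (v - s * c) * w\<^sup>2 / 2" "sin_rem' v = (s\<^sup>2 * v - (v - s * c)) * w ^ 3"
    "jac a u v = a\<^sup>2 * (s * w) + a * u * (s * w) + u\<^sup>2 * ((s - v * c) * w ^ 3)"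
    using False by (simp_all add: sinc_def sinc'_nonzero sin_rem_alt sin_rem'_nonzero jac_def w_def v_def s_def c_def field_simps)
  have "dx_du a \<xi> * dy_dv a \<xi> - dx_dv a \<xi> * dy_du a \<xi> =
     s * w * (a\<^sup>2 * (c * c) + a * u * (c * (s * w) + s * ((v * c - s) * w\<^sup>2)) + u\<^sup>2 * ((s\<^sup>2 * v - (v - s * c)) * w ^ 3))
     - (- a * s + u * ((v * c - s) * w\<^sup>2)) * (a * s * (s * w) + u * ((v - s * c) * w\<^sup>2))"
    unfolding dx_du_def dx_dv_def dy_du_def dy_dv_def u_def[symmetric] v_def[symmetric] s_def[symmetric] c_def[symmetric] e
    by (simp add: power2_eq_square)
  also have "\<dots> = a\<^sup>2 * (s * w) + a * u * (s * w) + u\<^sup>2 * ((s - v * c) * w ^ 3)"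
    using vw cc by algebra
  finally show ?thesis using e(5) by (simp add: u_def v_def)
qed


section \<open>Minimizers between arbitrary points and the cut locus\<close>

lemma grushin_exp_zero' [simp]: "grushin_exp q0 (0, 0) = q0"
  using grushin_exp_zero[of q0] by (simp add: zero_prod_def)

lemma grushin_exp_reflect: "grushin_exp q0 (u, - v) = (fst (grushin_exp q0 (u, v)), 2 * snd q0 - snd (grushin_exp q0 (u, v)))"
  by (simp add: grushin_exp_def sinc_def sin_rem_def field_simps)

lemma sinc_pos:
  assumes "\<bar>v\<bar> < pi" shows "0 < sinc v"
proof -
  consider "v = 0" | "v > 0" | "v < 0" by linarith
  then show ?thesis
  proof cases
    case 3
    then have "sin (- v) > 0" using assms by (intro sin_gt_zero) auto
    then show ?thesis using 3 by (simp add: sinc_def divide_neg_neg)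
  qed (use assms in \<open>auto simp: sinc_def sin_gt_zero\<close>)
qed

lemma continuous_grushin_exp_fst_snd:
  fixes S :: "real set"
  assumes "continuous_on S u" "continuous_on S v"
  shows "continuous_on S (\<lambda>s. snd (grushin_exp q0 (u s, v s)))"
  unfolding grushin_exp_def by (simp, intro continuous_intros assms) auto

text \<open>
  The height gained is \<open>(K\<^sup>2 (v + sin v) + Y\<^sup>2 (v - sin v)) / 2\<close> with \<open>K = x(1/2)\<close> and \<open>Y = x'(1/2)/v\<close>, and the
  midpoint satisfies \<open>2 K cos(v/2) = a + b\<close>.  So the height is unbounded as \<open>v\<close> approaches \<open>\<pi>\<close>, unless
  \<open>b = - a\<close>.
\<close>
lemma grushin_exp_height_lower_bound:
  assumes v: "0 < v" "v < pi" and b: "fst (grushin_exp q0 (u, v)) = b"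
  shows "(fst q0 + b)\<^sup>2 / 4 * tan (v / 2) \<le> snd (grushin_exp q0 (u, v)) - snd q0"
proof -
  define a h c where "a = fst q0" and "h = v / 2" and "c = u / v"
  define S C where "S = sin h" and "C = cos h"
  define K Y where "K = a * C + c * S" and "Y = c * C - a * S"
  have h: "0 < h" "h < pi / 2" using v by (auto simp: h_def)
  have C0: "C > 0" using h by (simp add: C_def cos_gt_zero)
  have SS: "S * S = 1 - C * C" using sin_cos_squared_add[of h] by (simp add: S_def C_def power2_eq_square)
  have sv: "sin v = 2 * S * C" using sin_double[of h] by (simp add: h_def S_def C_def)
  have cv: "cos v = 2 * C * C - 1" using cos_double_cos[of h] by (simp add: h_def C_def power2_eq_square)
  have g: "fst (grushin_exp q0 (u, v)) = a * cos v + c * sin v"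
    "snd (grushin_exp q0 (u, v)) - snd q0 = a\<^sup>2 * (v + sin v * cos v) / 2 + a * c * (sin v)\<^sup>2 + c\<^sup>2 * (v - sin v * cos v) / 2"
    using grushin_exp_scale'[of q0 1 "(u, v)"] v by (simp_all add: ext_x_def ext_y_def a_def c_def)
  have KC: "2 * (K * C) = a + b"
    using b unfolding g(1) sv cv K_def by (simp add: algebra_simps)
  have "2 * (a\<^sup>2 * (v + sin v * cos v) / 2 + a * c * (sin v)\<^sup>2 + c\<^sup>2 * (v - sin v * cos v) / 2)
      = a\<^sup>2 * (v + sin v * cos v) + 2 * a * c * (sin v)\<^sup>2 + c\<^sup>2 * (v - sin v * cos v)"
    by (simp add: field_simps)
  also have "\<dots> = K\<^sup>2 * (v + sin v) + Y\<^sup>2 * (v - sin v)"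
    unfolding sv cv K_def Y_def using SS by algebra
  also have "\<dots> \<ge> K\<^sup>2 * sin v"
  proof -
    have "sin v \<le> v" using v by (intro sin_x_le_x) auto
    then have "0 \<le> K\<^sup>2 * v + Y\<^sup>2 * (v - sin v)" using v by simp
    then show ?thesis by (simp add: algebra_simps)
  qed
  finally have "K\<^sup>2 * sin v \<le> 2 * (snd (grushin_exp q0 (u, v)) - snd q0)" unfolding g(2) .
  moreover have "K\<^sup>2 * sin v = 2 * ((a + b)\<^sup>2 / 4 * tan h)"
    unfolding sv KC[symmetric] using C0 by (simp add: tan_def S_def[symmetric] C_def[symmetric] field_simps power2_eq_square)
  ultimately show ?thesis by (simp add: a_def h_def mult.commute)
qed

text \<open>
  For every \<open>v\<close> there is a unique \<open>u\<close> with the prescribed final abscissa.  The height then depends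
  continuously on \<open>v\<close>, starts at \<open>0\<close> and exceeds every bound, so the intermediate value theorem applies.
\<close>
lemma grushin_exp_reaches_off_axis:
  assumes ab: "fst q \<noteq> - fst q0"
  shows "\<exists>\<xi>. \<bar>snd \<xi>\<bar> < pi \<and> grushin_exp q0 \<xi> = q"
proof -
  define a b where "a = fst q0" and "b = fst q"
  have pos: "\<exists>u v. \<bar>v\<bar> < pi \<and> fst (grushin_exp q0 (u, v)) = b \<and> snd (grushin_exp q0 (u, v)) - snd q0 = \<Delta>" if "\<Delta> \<ge> 0" for \<Delta>
  proof -
    \<comment> \<open>Chosen so that the lower bound for the height equals \<open>\<Delta>\<close>.\<close>
    define v1 where "v1 = 2 * arctan (4 * \<Delta> / (a + b)\<^sup>2)"
    have ab2: "(a + b)\<^sup>2 > 0" using ab by (auto simp: a_def b_def)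
    have v1: "0 \<le> v1" "v1 < pi" using that ab2 arctan_ubound[of "4 * \<Delta> / (a + b)\<^sup>2"] by (auto simp: v1_def)
    define u where "u v = (b - a * cos v) / sinc v" for v
    have S0: "sinc v \<noteq> 0" if "v \<in> {0..v1}" for v using sinc_pos[of v] that v1 by auto
    have fst_eq: "fst (grushin_exp q0 (u v, v)) = b" if "v \<in> {0..v1}" for v
      using S0[OF that] by (simp add: grushin_exp_def u_def a_def)
    have cont: "continuous_on {0..v1} (\<lambda>v. snd (grushin_exp q0 (u v, v)) - snd q0)"
      unfolding u_def by (intro continuous_intros continuous_grushin_exp_fst_snd) (use S0 in auto)
    have 0: "snd (grushin_exp q0 (u 0, 0)) - snd q0 \<le> \<Delta>" using that by (simp add: grushin_exp_def sin_rem_def)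
    have 1: "\<Delta> \<le> snd (grushin_exp q0 (u v1, v1)) - snd q0"
    proof (cases "\<Delta> = 0")
      case True
      then show ?thesis by (simp add: v1_def grushin_exp_def sin_rem_def)
    next
      case False
      then have "v1 > 0" using that ab2 by (simp add: v1_def)
      then have "(a + b)\<^sup>2 / 4 * tan (v1 / 2) \<le> snd (grushin_exp q0 (u v1, v1)) - snd q0"
        using grushin_exp_height_lower_bound[OF _ v1(2) fst_eq] v1 by (simp add: a_def)
      moreover have "(a + b)\<^sup>2 / 4 * tan (v1 / 2) = \<Delta>"
        using ab2 by (simp add: v1_def tan_arctan)
      ultimately show ?thesis by simp
    qed
    obtain v where v: "0 \<le> v" "v \<le> v1" "snd (grushin_exp q0 (u v, v)) - snd q0 = \<Delta>"
      using IVT'[OF 0 1 v1(1) cont] by blast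
    then show ?thesis using fst_eq[of v] v1 by (intro exI[of _ "u v"] exI[of _ v]) auto
  qed
  show ?thesis
  proof (cases "snd q - snd q0 \<ge> 0")
    case True
    from pos[OF this] obtain u v where "\<bar>v\<bar> < pi" "fst (grushin_exp q0 (u, v)) = b" "snd (grushin_exp q0 (u, v)) - snd q0 = snd q - snd q0" by blast
    then show ?thesis by (intro exI[of _ "(u, v)"]) (simp add: prod_eq_iff b_def)
  next
    case False
    then have "- (snd q - snd q0) \<ge> 0" by simp
    from pos[OF this] obtain u v where "\<bar>v\<bar> < pi" "fst (grushin_exp q0 (u, v)) = b" "snd (grushin_exp q0 (u, v)) - snd q0 = - (snd q - snd q0)" by blast
    then show ?thesis by (intro exI[of _ "(u, - v)"]) (simp add: prod_eq_iff b_def grushin_exp_reflect)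
  qed
qed

text \<open>
  Here \<open>u(v)\<close> extends continuously to \<open>v = \<pi>\<close>, where it vanishes and the height is \<open>\<pi> a\<^sup>2 / 2\<close>.
\<close>
lemma grushin_exp_reaches_opposite:
  assumes b: "fst q = - fst q0" and \<Delta>: "\<bar>snd q - snd q0\<bar> < pi * (fst q0)\<^sup>2 / 2"
  shows "\<exists>\<xi>. \<bar>snd \<xi>\<bar> < pi \<and> grushin_exp q0 \<xi> = q"
proof -
  define a where "a = fst q0"
  have pos: "\<exists>u v. \<bar>v\<bar> < pi \<and> fst (grushin_exp q0 (u, v)) = - a \<and> snd (grushin_exp q0 (u, v)) - snd q0 = \<Delta>"
    if "0 \<le> \<Delta>" "\<Delta> < pi * a\<^sup>2 / 2" for \<Delta>
  proof -
    define u where "u v = - 2 * a * cos (v / 2) / sinc (v / 2)" for v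
    have S0: "sinc (v / 2) \<noteq> 0" if "v \<in> {0..pi}" for v
    proof -
      have "\<bar>v / 2\<bar> < pi" using that pi_gt_zero unfolding atLeastAtMost_iff by linarith
      then show ?thesis using sinc_pos by (metis less_irrefl)
    qed
    have fst_eq: "fst (grushin_exp q0 (u v, v)) = - a" if "v \<in> {0..pi}" for v
    proof -
      have "sinc v = sinc (v / 2) * cos (v / 2)"
        using sin_double[of "v / 2"] by (simp add: sinc_def)
      moreover have "cos v = 2 * cos (v / 2) * cos (v / 2) - 1" using cos_double_cos[of "v / 2"] by (simp add: power2_eq_square)
      ultimately have "fst (grushin_exp q0 (u v, v)) = a * (2 * cos (v / 2) * cos (v / 2) - 1)
          + (- 2 * a * cos (v / 2) / sinc (v / 2)) * (sinc (v / 2) * cos (v / 2))"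
        by (simp add: grushin_exp_def u_def a_def[symmetric])
      also have "\<dots> = - a" using S0[OF that] by (simp add: algebra_simps)
      finally show ?thesis .
    qed
    have cont: "continuous_on {0..pi} (\<lambda>v. snd (grushin_exp q0 (u v, v)) - snd q0)"
      unfolding u_def by (intro continuous_intros continuous_grushin_exp_fst_snd) (use S0 in auto)
    have 0: "snd (grushin_exp q0 (u 0, 0)) - snd q0 \<le> \<Delta>" using that by (simp add: grushin_exp_def sin_rem_def)
    have top: "snd (grushin_exp q0 (u pi, pi)) - snd q0 = pi * a\<^sup>2 / 2"
      by (simp add: grushin_exp_def u_def a_def)
    then have 1: "\<Delta> \<le> snd (grushin_exp q0 (u pi, pi)) - snd q0" using that by simp
    obtain v where v: "0 \<le> v" "v \<le> pi" "snd (grushin_exp q0 (u v, v)) - snd q0 = \<Delta>"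
      using IVT'[OF 0 1 _ cont] by auto
    have "v \<noteq> pi" using v(3) top that by auto
    then show ?thesis using fst_eq[of v] v by (intro exI[of _ "u v"] exI[of _ v]) auto
  qed
  show ?thesis
  proof (cases "snd q - snd q0 \<ge> 0")
    case True
    from pos[OF this] \<Delta> True obtain u v where "\<bar>v\<bar> < pi" "fst (grushin_exp q0 (u, v)) = - a" "snd (grushin_exp q0 (u, v)) - snd q0 = snd q - snd q0" by (auto simp: a_def)
    then show ?thesis using b by (intro exI[of _ "(u, v)"]) (simp add: prod_eq_iff a_def)
  next
    case False
    then have "- (snd q - snd q0) \<ge> 0" by simp
    from pos[OF this] \<Delta> False obtain u v where "\<bar>v\<bar> < pi" "fst (grushin_exp q0 (u, v)) = - a" "snd (grushin_exp q0 (u, v)) - snd q0 = - (snd q - snd q0)" by (auto simp: a_def)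
    then show ?thesis using b by (intro exI[of _ "(u, - v)"]) (simp add: prod_eq_iff a_def grushin_exp_reflect)
  qed
qed

text \<open>
  The calibration bound in the limit \<open>v \<rightarrow> \<plusminus>\<pi>\<close>.  The parameter \<open>\<beta>\<close> is chosen to maximise the increment of
  the calibration, which makes the diverging tangent terms cancel.
\<close>
lemma length_opposite_points:
  assumes h: "horizontal \<eta>" and ends: "\<eta> 0 = q0" "fst (\<eta> 1) = - fst q0" and \<sigma>: "\<sigma> = 1 \<or> \<sigma> = -1"
  shows "pi * (\<sigma> * (snd (\<eta> 1) - snd q0)) \<le> (sr_length \<eta>)\<^sup>2 / 2"
proof -
  define a \<Delta> where "a = fst q0" and "\<Delta> = snd (\<eta> 1) - snd q0"
  have le: "t * (\<sigma> * \<Delta>) + a\<^sup>2 * t * cos (t / 2) / sin (t / 2) \<le> (sr_length \<eta>)\<^sup>2 / 2" if t: "0 < t" "t < pi" for t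
  proof -
    define v where "v = \<sigma> * t"
    define S C where "S = sin (v / 2)" and "C = cos (v / 2)"
    define \<beta> where "\<beta> = - a * v / S"
    have v: "\<bar>v\<bar> < pi" "v \<noteq> 0" using t \<sigma> by (auto simp: v_def)
    have C0: "C \<noteq> 0" using cos_calib_pos[OF v(1), of 1] by (simp add: C_def)
    have st: "sin (t / 2) > 0" using t by (intro sin_gt_zero) auto
    have S0: "S \<noteq> 0" using st \<sigma> by (auto simp: S_def v_def)
    have SS: "S * S = 1 - C * C" using sin_cos_squared_add[of "v / 2"] by (simp add: S_def C_def power2_eq_square)
    have "calib v \<beta> 1 (\<eta> 1) - calib v \<beta> 0 (\<eta> 0)
       = v * \<Delta> - v * (S / C) * a\<^sup>2 - 2 * a * (\<beta> / C) - \<beta>\<^sup>2 * (S / C) / v"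
      using v(2) ends by (simp add: calib_def calib_quad_def calib_lin_def calib_const_def tan_def S_def C_def a_def \<Delta>_def field_simps)
    also have "\<dots> = v * \<Delta> + a\<^sup>2 * v * (2 / (S * C) - 1 / (S * C) - S / C)"
      unfolding \<beta>_def using v(2) C0 S0 by (simp add: field_simps power2_eq_square)
    also have "2 / (S * C) - 1 / (S * C) - S / C = C / S"
      using C0 S0 SS by (simp add: field_simps) algebra
    also have "v * \<Delta> + a\<^sup>2 * v * (C / S) = t * (\<sigma> * \<Delta>) + a\<^sup>2 * t * cos (t / 2) / sin (t / 2)"
      using \<sigma> by (auto simp: v_def S_def C_def)
    finally show ?thesis using calib_length_bound[OF h v(1), of \<beta>] by simp
  qed
  have "isCont (\<lambda>t. t * (\<sigma> * \<Delta>) + a\<^sup>2 * t * cos (t / 2) / sin (t / 2)) pi"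
    by (intro continuous_intros) auto
  then have lim: "((\<lambda>t. t * (\<sigma> * \<Delta>) + a\<^sup>2 * t * cos (t / 2) / sin (t / 2)) \<longlongrightarrow> pi * (\<sigma> * \<Delta>)) (at_left pi)"
    by (simp add: isCont_def filterlim_at_split)
  have "\<forall>\<^sub>F t in at_left pi. t * (\<sigma> * \<Delta>) + a\<^sup>2 * t * cos (t / 2) / sin (t / 2) \<le> (sr_length \<eta>)\<^sup>2 / 2"
    by (rule eventually_mono[OF eventually_at_left_real[OF pi_gt_zero]]) (rule le; simp)
  from tendsto_upperbound[OF lim this] show ?thesis by (simp add: \<Delta>_def)
qed

lemma grushin_exp_at_pi:
  assumes \<sigma>: "\<sigma> = 1 \<or> \<sigma> = -1"
  shows "grushin_exp q0 (u, \<sigma> * pi) = (- fst q0, snd q0 + \<sigma> * ((fst q0)\<^sup>2 * pi / 2 + u\<^sup>2 / (2 * pi)))"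
proof -
  have "sin (2 * pi) = 0" by (rule sin_two_pi)
  then show ?thesis
    using \<sigma> by (auto simp: grushin_exp_def sinc_def sin_rem_def power2_eq_square field_simps)
qed

lemma grushin_exp_minimizing_at_pi:
  assumes \<sigma>: "\<sigma> = 1 \<or> \<sigma> = -1"
  shows "minimizing_geodesic (\<lambda>s. grushin_exp q0 (s *\<^sub>R (u, \<sigma> * pi)))"
proof -
  have "d_SR q0 (grushin_exp q0 (u, \<sigma> * pi)) = sr_length (\<lambda>s. grushin_exp q0 (s *\<^sub>R (u, \<sigma> * pi)))"
  proof (rule d_SR_eqI[OF grushin_exp_horizontal])
    fix \<eta> assume \<eta>: "horizontal \<eta>" "\<eta> 0 = q0" "\<eta> 1 = grushin_exp q0 (u, \<sigma> * pi)"
    have "pi * (\<sigma> * (\<sigma> * ((fst q0)\<^sup>2 * pi / 2 + u\<^sup>2 / (2 * pi)))) \<le> (sr_length \<eta>)\<^sup>2 / 2"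
      using length_opposite_points[OF \<eta>(1,2) _ \<sigma>] \<eta>(3) by (simp add: grushin_exp_at_pi[OF \<sigma>])
    moreover have "2 * (pi * (\<sigma> * (\<sigma> * ((fst q0)\<^sup>2 * pi / 2 + u\<^sup>2 / (2 * pi))))) = speed_sq q0 (u, \<sigma> * pi)"
      using \<sigma> by (auto simp: speed_sq_def field_simps power2_eq_square)
    ultimately have "speed_sq q0 (u, \<sigma> * pi) \<le> (sr_length \<eta>)\<^sup>2" by linarith
    then show "sr_length (\<lambda>s. grushin_exp q0 (s *\<^sub>R (u, \<sigma> * pi))) \<le> sr_length \<eta>"
      unfolding grushin_exp_length using sr_length_nonneg[OF \<eta>(1)] by (simp add: real_le_lsqrt)
  qed auto
  then show ?thesis
    unfolding minimizing_geodesic_def using grushin_exp_horizontal[of q0 "(u, \<sigma> * pi)"] grushin_exp_speed[of q0 "(u, \<sigma> * pi)"] by auto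
qed

text \<open>
  At \<open>v = \<plusminus>\<pi>\<close> the end point depends on \<open>u\<close> only through \<open>u\<^sup>2\<close>, so both signs of \<open>u\<close> reach it.
\<close>
lemma opposite_far_is_grushin_exp:
  assumes b: "fst q = - fst q0" and \<Delta>: "pi * (fst q0)\<^sup>2 / 2 \<le> \<bar>snd q - snd q0\<bar>"
  obtains u \<sigma> where "\<sigma> = 1 \<or> \<sigma> = (-1 :: real)" "q = grushin_exp q0 (u, \<sigma> * pi)" "q = grushin_exp q0 (- u, \<sigma> * pi)"
proof -
  \<comment> \<open>The sign of \<open>v\<close> is that of the height difference.\<close>
  define \<sigma> :: real where "\<sigma> = (if snd q - snd q0 \<ge> 0 then 1 else -1)"
  define u where "u = sqrt (2 * pi * \<bar>snd q - snd q0\<bar> - pi\<^sup>2 * (fst q0)\<^sup>2)"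
  have \<sigma>: "\<sigma> = 1 \<or> \<sigma> = -1" by (simp add: \<sigma>_def)
  have sg: "\<sigma> * \<bar>snd q - snd q0\<bar> = snd q - snd q0" by (simp add: \<sigma>_def)
  have "2 * pi * (pi * (fst q0)\<^sup>2 / 2) \<le> 2 * pi * \<bar>snd q - snd q0\<bar>"
    using \<Delta> by (intro mult_left_mono) auto
  then have "u\<^sup>2 = 2 * pi * \<bar>snd q - snd q0\<bar> - pi\<^sup>2 * (fst q0)\<^sup>2"
    unfolding u_def by (simp add: power2_eq_square)
  then have "(fst q0)\<^sup>2 * pi / 2 + u\<^sup>2 / (2 * pi) = \<bar>snd q - snd q0\<bar>"
    by (simp add: field_simps power2_eq_square)
  then have "q = grushin_exp q0 (u, \<sigma> * pi)" "q = grushin_exp q0 (- u, \<sigma> * pi)"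
    using b sg by (simp_all add: grushin_exp_at_pi[OF \<sigma>] prod_eq_iff)
  with \<sigma> that show ?thesis by blast
qed

lemma grushin_exp_surj: "\<exists>\<xi>. grushin_exp q0 \<xi> = q"
  using grushin_exp_reaches_off_axis[of q q0] grushin_exp_reaches_opposite[of q q0] opposite_far_is_grushin_exp[of q q0]
  by (metis linorder_not_le)

lemma not_surj_first_row_zero:
  "\<not> surj (\<lambda>h :: real \<times> real. (0 * fst h + 0 * snd h, f h))"
  by (auto simp: surj_def intro!: exI[of _ "(1, 0)"])

text \<open>
  At the exceptional points of the opposite line there are two minimizers when \<open>u \<noteq> 0\<close>.  When \<open>u = 0\<close> the
  abscissa of the exponential map has vanishing differential, so the point is conjugate.  This includes
  \<open>q = q0\<close> on the axis, whose constant curve is the extremal with \<open>u = 0\<close>, \<open>v = \<pi>\<close>.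
\<close>
theorem smooth_point_is_grushin_exp:
  assumes "q \<notin> Cut q0"
  obtains \<xi> where "\<bar>snd \<xi>\<bar> < pi" "fst q0 \<noteq> 0 \<or> fst \<xi> \<noteq> 0" "q = grushin_exp q0 \<xi>"
proof -
  have nondeg: "fst q0 \<noteq> 0 \<or> fst \<xi> \<noteq> 0" if "grushin_exp q0 \<xi> = q" "fst q \<noteq> - fst q0 \<or> fst q0 \<noteq> 0" for \<xi>
    using that by (auto simp: grushin_exp_def)
  consider "fst q \<noteq> - fst q0" | "fst q = - fst q0" "\<bar>snd q - snd q0\<bar> < pi * (fst q0)\<^sup>2 / 2"
    | "fst q = - fst q0" "pi * (fst q0)\<^sup>2 / 2 \<le> \<bar>snd q - snd q0\<bar>" by linarith
  then show ?thesis
  proof cases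
    case 1
    then show ?thesis using grushin_exp_reaches_off_axis[OF 1] nondeg that by metis
  next
    case 2
    then have "fst q0 \<noteq> 0" by auto
    then show ?thesis using grushin_exp_reaches_opposite[OF 2] that by metis
  next
    case 3
    obtain u \<sigma> where \<sigma>: "\<sigma> = 1 \<or> \<sigma> = (-1 :: real)" and q: "q = grushin_exp q0 (u, \<sigma> * pi)" "q = grushin_exp q0 (- u, \<sigma> * pi)"
      using opposite_far_is_grushin_exp[OF 3] .
    have "smooth_point q0 q" using assms by (simp add: Cut_def)
    then obtain \<gamma> where \<gamma>: "\<gamma> 0 = q0" "\<not> conjugate_along \<gamma>"
      and uniq: "\<And>\<eta>. minimizing_geodesic \<eta> \<Longrightarrow> \<eta> 0 = q0 \<Longrightarrow> \<eta> 1 = q \<Longrightarrow> \<forall>t\<in>{0..1}. \<eta> t = \<gamma> t"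
      unfolding smooth_point_def by blast
    have e: "\<forall>t\<in>{0..1}. grushin_exp q0 (t *\<^sub>R (u, \<sigma> * pi)) = \<gamma> t" "\<forall>t\<in>{0..1}. grushin_exp q0 (t *\<^sub>R (- u, \<sigma> * pi)) = \<gamma> t"
      using uniq[OF grushin_exp_minimizing_at_pi[OF \<sigma>, of q0 u]] uniq[OF grushin_exp_minimizing_at_pi[OF \<sigma>, of q0 "- u"]] q by simp_all
    have "grushin_exp q0 ((1/2) *\<^sub>R (u, \<sigma> * pi)) = grushin_exp q0 ((1/2) *\<^sub>R (- u, \<sigma> * pi))"
      using bspec[OF e(1), of "1/2"] bspec[OF e(2), of "1/2"] by simp
    then have "u = 0" using \<sigma> unfolding grushin_exp_scale' by (auto simp: ext_x_def)
    have "critical_point (sr_exp q0) (u, \<sigma> * pi)"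
      unfolding critical_point_def
    proof (intro exI conjI)
      show "(sr_exp q0 has_derivative (\<lambda>h. (dx_du (fst q0) (u, \<sigma> * pi) * fst h + dx_dv (fst q0) (u, \<sigma> * pi) * snd h,
            dy_du (fst q0) (u, \<sigma> * pi) * fst h + dy_dv (fst q0) (u, \<sigma> * pi) * snd h))) (at (u, \<sigma> * pi))"
        unfolding sr_exp_eq_grushin_exp[abs_def] by (rule grushin_exp_has_derivative)
      have "dx_du (fst q0) (u, \<sigma> * pi) = 0" "dx_dv (fst q0) (u, \<sigma> * pi) = 0"
        using \<sigma> \<open>u = 0\<close> by (auto simp: dx_du_def dx_dv_def sinc_def)
      then show "\<not> surj (\<lambda>h. (dx_du (fst q0) (u, \<sigma> * pi) * fst h + dx_dv (fst q0) (u, \<sigma> * pi) * snd h,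
            dy_du (fst q0) (u, \<sigma> * pi) * fst h + dy_dv (fst q0) (u, \<sigma> * pi) * snd h))"
        using not_surj_first_row_zero by simp
    qed
    then have "conjugate_along \<gamma>"
      unfolding conjugate_along_def using e(1) \<gamma>(1) by (intro exI[of _ "(u, \<sigma> * pi)"]) (simp add: sr_exp_eq_grushin_exp)
    then show ?thesis using \<gamma>(2) by simp
  qed
qed

text \<open>
  Velocities determine the covector: \<open>x'\<close> is the first control, and where \<open>x \<noteq> 0\<close> the momentum \<open>v\<close> is
  \<open>y' / x\<^sup>2\<close>.
\<close>
lemma grushin_exp_same_curve_velocity:
  assumes eq: "\<And>s. s \<in> {0..1} \<Longrightarrow> grushin_exp q0 (s *\<^sub>R \<zeta>) = grushin_exp q0 (s *\<^sub>R \<xi>)" and s: "s \<in> {0..1}"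
  shows "fst (ext_control q0 \<zeta> s) = fst (ext_control q0 \<xi> s)"
    and "fst (grushin_exp q0 (s *\<^sub>R \<xi>)) \<noteq> 0 \<Longrightarrow> snd \<zeta> = snd \<xi>"
proof -
  have "((\<lambda>s. grushin_exp q0 (s *\<^sub>R \<xi>)) has_vector_derivative
   (fst (ext_control q0 \<zeta> s), fst (grushin_exp q0 (s *\<^sub>R \<zeta>)) * snd (ext_control q0 \<zeta> s))) (at s within {0..1})"
    by (rule has_vector_derivative_transform[OF s _ grushin_exp_has_vector_derivative]) (use eq in auto)
  from vector_derivative_unique_within_closed_interval[of 0 1 s, unfolded box_real, OF _ _ this grushin_exp_has_vector_derivative]
  have v: "(fst (ext_control q0 \<zeta> s), fst (grushin_exp q0 (s *\<^sub>R \<zeta>)) * snd (ext_control q0 \<zeta> s))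
     = (fst (ext_control q0 \<xi> s), fst (grushin_exp q0 (s *\<^sub>R \<xi>)) * snd (ext_control q0 \<xi> s))"
    using s by simp
  then show "fst (ext_control q0 \<zeta> s) = fst (ext_control q0 \<xi> s)" by simp
  assume nz: "fst (grushin_exp q0 (s *\<^sub>R \<xi>)) \<noteq> 0"
  then have "snd (ext_control q0 \<zeta> s) = snd (ext_control q0 \<xi> s)" using v eq[OF s] by simp
  moreover have "ext_x (fst q0) (fst \<zeta>) (snd \<zeta>) s = ext_x (fst q0) (fst \<xi>) (snd \<xi>) s"
    using eq[OF s] unfolding grushin_exp_scale' by simp
  ultimately show "snd \<zeta> = snd \<xi>" using nz unfolding grushin_exp_scale' by (simp add: ext_control_def)
qed

lemma grushin_exp_same_curve:
  assumes eq: "\<And>s. s \<in> {0..1} \<Longrightarrow> grushin_exp q0 (s *\<^sub>R \<zeta>) = grushin_exp q0 (s *\<^sub>R \<xi>)"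
    and s: "s \<in> {0..1}" "fst (grushin_exp q0 (s *\<^sub>R \<xi>)) \<noteq> 0"
  shows "\<zeta> = \<xi>"
proof -
  have "fst \<zeta> = fst \<xi>" using grushin_exp_same_curve_velocity(1)[OF eq, of 0] by (simp add: ext_control_def ext_dx_def)
  then show ?thesis using grushin_exp_same_curve_velocity(2)[OF eq s] by (simp add: prod_eq_iff)
qed

text \<open>
  Two covectors with the same end point generate the same curve, since the minimizer is unique.
\<close>
theorem grushin_exp_inj:
  assumes "\<bar>snd \<xi>\<bar> < pi" "\<bar>snd \<zeta>\<bar> < pi" "fst q0 \<noteq> 0 \<or> fst \<xi> \<noteq> 0" "grushin_exp q0 \<xi> = grushin_exp q0 \<zeta>"
  shows "\<xi> = \<zeta>"
proof -
  have eq: "grushin_exp q0 (s *\<^sub>R \<zeta>) = grushin_exp q0 (s *\<^sub>R \<xi>)" if "s \<in> {0..1}" for s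
    using grushin_exp_unique[OF assms(1) grushin_exp_minimizing(2)[OF assms(2)] _ _ that] assms(4) by simp
  have "\<exists>s\<in>{0..1}. ext_x (fst q0) (fst \<xi>) (snd \<xi>) s \<noteq> 0"
  proof (cases "fst q0 = 0")
    case False
    then show ?thesis by (intro bexI[of _ 0]) (auto simp: ext_x_def)
  next
    case True
    then have "fst \<xi> \<noteq> 0" using assms(3) by simp
    moreover have "\<bar>snd \<xi> / 2\<bar> < pi" using assms(1) by simp
    then have "sinc (snd \<xi> / 2) \<noteq> 0" using sinc_pos by (metis less_irrefl)
    ultimately show ?thesis using True by (intro bexI[of _ "1/2"]) (auto simp: ext_x_def sinc_def split: if_splits)
  qed
  then obtain s where s: "s \<in> {0..1}" "ext_x (fst q0) (fst \<xi>) (snd \<xi>) s \<noteq> 0" by blast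
  then have "fst (grushin_exp q0 (s *\<^sub>R \<xi>)) \<noteq> 0" unfolding grushin_exp_scale' by simp
  from grushin_exp_same_curve[OF eq s(1) this] show ?thesis by simp
qed


section \<open>Small balls and the distortion coefficient\<close>

lemma d_SR_less_imp_curve:
  assumes "d_SR p q < r"
  obtains \<gamma> where "horizontal \<gamma>" "\<gamma> 0 = p" "\<gamma> 1 = q" "sr_length \<gamma> < r"
proof -
  obtain \<xi> where "grushin_exp p \<xi> = q" using grushin_exp_surj by blast
  then have "sr_length (\<lambda>s. grushin_exp p (s *\<^sub>R \<xi>)) \<in> {sr_length \<gamma> | \<gamma>. horizontal \<gamma> \<and> \<gamma> 0 = p \<and> \<gamma> 1 = q}"
    using grushin_exp_horizontal[of p \<xi>] by (auto intro!: exI[of _ "\<lambda>s. grushin_exp p (s *\<^sub>R \<xi>)"])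
  then have ne: "{sr_length \<gamma> | \<gamma>. horizontal \<gamma> \<and> \<gamma> 0 = p \<and> \<gamma> 1 = q} \<noteq> {}" by blast
  from cInf_lessD[OF ne assms[unfolded d_SR_def]] that show ?thesis by blast
qed

definition ball_size :: "plane \<Rightarrow> real \<Rightarrow> real" where
  "ball_size q r = r + (r / 2 + tan (r / 2) / 2 * ((fst q)\<^sup>2 + (\<bar>fst q\<bar> + r)\<^sup>2))"

text \<open>
  Two applications of the calibration bound: \<open>v = 0\<close> controls the horizontal displacement, and
  \<open>v = \<plusminus>r\<close> the vertical one, with an error that vanishes as \<open>r\<close> tends to \<open>0\<close>.
\<close>
lemma sr_ball_bounded:
  assumes r: "0 < r" "r < pi"
  shows "sr_ball r q \<subseteq> cball q (ball_size q r)"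
proof
  fix p assume "p \<in> sr_ball r q"
  then obtain \<gamma> where \<gamma>: "horizontal \<gamma>" "\<gamma> 0 = q" "\<gamma> 1 = p" "sr_length \<gamma> < r"
    using d_SR_less_imp_curve unfolding sr_ball_def by blast
  have L0: "0 \<le> sr_length \<gamma>" by (rule sr_length_nonneg[OF \<gamma>(1)])
  then have L2: "(sr_length \<gamma>)\<^sup>2 \<le> r\<^sup>2" using \<gamma>(4) by (intro power_mono) auto
  define X Y where "X = fst p - fst q" and "Y = snd p - snd q"
  have "calib 0 X 1 p - calib 0 X 0 q \<le> (sr_length \<gamma>)\<^sup>2 / 2"
    using calib_length_bound[OF \<gamma>(1), of 0 X] \<gamma> by simp
  moreover have "calib 0 X 1 p - calib 0 X 0 q = X * (fst p - fst q) - X\<^sup>2 / 2"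
    by (simp add: calib_def calib_quad_def calib_lin_def calib_const_def algebra_simps)
  ultimately have "X\<^sup>2 \<le> (sr_length \<gamma>)\<^sup>2"
    by (simp add: X_def[symmetric] power2_eq_square)
  then have "X\<^sup>2 \<le> r\<^sup>2" using L2 by simp
  then have X: "\<bar>X\<bar> \<le> r" using r by (simp add: abs_le_square_iff[symmetric])
  have "\<bar>fst p\<bar> \<le> \<bar>fst q\<bar> + r" using X unfolding X_def by linarith
  then have p2: "(fst p)\<^sup>2 \<le> (\<bar>fst q\<bar> + r)\<^sup>2" by (metis abs_ge_zero power2_abs power_mono)
  define T where "T = tan (r / 2) / 2 * ((fst q)\<^sup>2 + (\<bar>fst q\<bar> + r)\<^sup>2)"
  have tan0: "tan (r / 2) \<ge> 0" using r by (intro tan_pos_pi2_le) auto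
  have Ys: "\<sigma> * Y \<le> r / 2 + T" if \<sigma>: "\<sigma> = 1 \<or> \<sigma> = -1" for \<sigma> :: real
  proof -
    have "calib (\<sigma> * r) 0 1 p - calib (\<sigma> * r) 0 0 q \<le> (sr_length \<gamma>)\<^sup>2 / 2"
      using calib_length_bound[OF \<gamma>(1), of "\<sigma> * r" 0] \<gamma> \<sigma> r by auto
    moreover have "calib (\<sigma> * r) 0 1 p - calib (\<sigma> * r) 0 0 q = r * (\<sigma> * Y) - r * (tan (r / 2) / 2 * ((fst q)\<^sup>2 + (fst p)\<^sup>2))"
      using \<sigma> r by (auto simp: calib_def calib_quad_def calib_lin_def calib_const_def Y_def field_simps)
    ultimately have "r * (\<sigma> * Y) \<le> r * (r / 2) + r * (tan (r / 2) / 2 * ((fst q)\<^sup>2 + (fst p)\<^sup>2))"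
      using L2 by (simp add: power2_eq_square)
    also have "\<dots> \<le> r * (r / 2) + r * T"
      unfolding T_def using r tan0 p2 by (intro add_left_mono mult_left_mono) auto
    also have "\<dots> = r * (r / 2 + T)" by (simp add: algebra_simps)
    finally show ?thesis using r by simp
  qed
  have "\<bar>Y\<bar> \<le> r / 2 + T" using Ys[of 1] Ys[of "-1"] by auto
  have "dist q p \<le> ball_size q r"
  proof -
    have "dist q p = norm (X, Y)"
      by (subst dist_commute) (simp add: X_def Y_def dist_norm minus_prod_def)
    also have "\<dots> \<le> \<bar>X\<bar> + \<bar>Y\<bar>" using norm_Pair_le[of X Y] by simp
    finally show ?thesis using X \<open>\<bar>Y\<bar> \<le> r / 2 + T\<close> unfolding ball_size_def T_def by linarith
  qed
  then show "p \<in> cball q (ball_size q r)" by simp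
qed

lemma sr_ball_eventually_subset:
  assumes "open V" "q \<in> V"
  shows "\<forall>\<^sub>F r in at_right 0. sr_ball r q \<subseteq> V"
proof -
  obtain e where e: "e > 0" "ball q e \<subseteq> V" using assms by (auto simp: open_contains_ball)
  have "isCont (ball_size q) 0" unfolding ball_size_def[abs_def] by (intro continuous_intros) auto
  then have "(ball_size q \<longlongrightarrow> 0) (at_right 0)"
    by (simp add: isCont_def filterlim_at_split ball_size_def)
  then have "\<forall>\<^sub>F r in at_right 0. ball_size q r < e" using e(1) by (rule order_tendstoD)
  moreover have "\<forall>\<^sub>F r in at_right 0. r \<in> {0<..<pi}" by (rule eventually_at_right_real) simp
  ultimately show ?thesis
  proof eventually_elim
    fix r assume "ball_size q r < e" "r \<in> {0<..<pi}"
    then have "cball q (ball_size q r) \<subseteq> ball q e" by auto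
    then show "sr_ball r q \<subseteq> V" using sr_ball_bounded[of r q] \<open>r \<in> {0<..<pi}\<close> e(2) by auto
  qed
qed

lemma continuous_on_grushin_exp: "continuous_on S (grushin_exp q0)"
  by (intro continuous_at_imp_continuous_on ballI has_derivative_continuous[OF grushin_exp_has_derivative])

text \<open>
  Covectors whose extremal minimizes up to time \<open>1\<close> uniquely.  The excluded ones with \<open>a = u = 0\<close> give
  the constant curve for every \<open>v\<close>.
\<close>
definition injectivity_covectors :: "plane \<Rightarrow> (real \<times> real) set" where
  "injectivity_covectors q0 = {\<xi>. \<bar>snd \<xi>\<bar> < pi \<and> (fst q0 \<noteq> 0 \<or> fst \<xi> \<noteq> 0)}"

lemma open_injectivity_covectors: "open (injectivity_covectors q0)"
  unfolding injectivity_covectors_def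
  by (cases "fst q0 = 0") (simp_all, (intro open_Collect_conj open_Collect_less open_Collect_neq continuous_intros)+)

lemma inj_on_grushin_exp: "inj_on (grushin_exp q0) (injectivity_covectors q0)"
proof (rule inj_onI)
  fix \<xi> \<zeta> assume "\<xi> \<in> injectivity_covectors q0" "\<zeta> \<in> injectivity_covectors q0" "grushin_exp q0 \<xi> = grushin_exp q0 \<zeta>"
  then show "\<xi> = \<zeta>" using grushin_exp_inj[of \<xi> \<zeta> q0] unfolding injectivity_covectors_def mem_Collect_eq by blast
qed

text \<open>
  The ball contains the image of an open set of covectors with short extremals, and this image is open
  by invariance of domain.
\<close>
lemma sr_ball_outer_measure_pos:
  assumes r: "0 < r"
  shows "0 < outer_measure_of lebesgue (sr_ball r q)"
proof -
  define \<Omega> where "\<Omega> = injectivity_covectors q \<inter> {\<xi>. speed_sq q \<xi> < r\<^sup>2}"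
  have "open {\<xi>. speed_sq q \<xi> < r\<^sup>2}" unfolding speed_sq_def by (intro open_Collect_less continuous_intros)
  then have op: "open \<Omega>" unfolding \<Omega>_def using open_injectivity_covectors by blast
  have "(r / 2, 0) \<in> \<Omega>" using r by (simp add: \<Omega>_def injectivity_covectors_def speed_sq_def power2_eq_square)
  then have ne: "grushin_exp q ` \<Omega> \<noteq> {}" by blast
  have opi: "open (grushin_exp q ` \<Omega>)"
    by (rule invariance_of_domain[OF continuous_on_grushin_exp op inj_on_subset[OF inj_on_grushin_exp]]) (simp add: \<Omega>_def)
  have "grushin_exp q ` \<Omega> \<subseteq> sr_ball r q"
  proof (rule image_subsetI)
    fix \<xi> :: "real \<times> real" assume "\<xi> \<in> \<Omega>"
    then have E: "speed_sq q \<xi> < r\<^sup>2" "\<bar>snd \<xi>\<bar> < pi"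
      by (auto simp: \<Omega>_def injectivity_covectors_def)
    have "sqrt (speed_sq q \<xi>) < sqrt (r\<^sup>2)" using E(1) by (rule real_sqrt_less_mono)
    with E(2) show "grushin_exp q \<xi> \<in> sr_ball r q" using r by (simp add: sr_ball_def grushin_exp_minimizing(1))
  qed
  then have "outer_measure_of lebesgue (grushin_exp q ` \<Omega>) \<le> outer_measure_of lebesgue (sr_ball r q)"
    by (rule outer_measure_of_mono)
  moreover have "outer_measure_of lebesgue (grushin_exp q ` \<Omega>) \<noteq> 0"
  proof
    assume "outer_measure_of lebesgue (grushin_exp q ` \<Omega>) = 0"
    then have "negligible (grushin_exp q ` \<Omega>)" using opi by (simp add: negligible_iff_null_sets null_sets_def borel_open)
    then show False using open_not_negligible[OF opi ne] by simp
  qed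
  ultimately show ?thesis by (simp add: zero_less_iff_neq_zero) (metis le_zero_eq)
qed

lemma sr_ball_outer_measure_finite:
  assumes "0 < r" "r < pi"
  shows "outer_measure_of lebesgue (sr_ball r q) < top"
proof -
  have "outer_measure_of lebesgue (sr_ball r q) \<le> outer_measure_of lebesgue (cball q (ball_size q r))"
    by (rule outer_measure_of_mono[OF sr_ball_bounded[OF assms]])
  also have "\<dots> < top" using emeasure_bounded_finite[OF bounded_cball, of q "ball_size q r"] by simp
  finally show ?thesis .
qed

definition jac_at :: "plane \<Rightarrow> real \<times> real \<Rightarrow> real" where
  "jac_at q0 \<xi> = jac (fst q0) (fst \<xi>) (snd \<xi>)"

lemma jac_at_eq: "jac_at q0 \<xi> = dx_du (fst q0) \<xi> * dy_dv (fst q0) \<xi> - dx_dv (fst q0) \<xi> * dy_du (fst q0) \<xi>"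
  by (simp only: jac_at_def grushin_exp_jacobian)

lemma continuous_on_jac_at [continuous_intros]:
  fixes f :: "'a::t2_space \<Rightarrow> real \<times> real"
  assumes "continuous_on S f"
  shows "continuous_on S (\<lambda>x. jac_at q0 (f x))"
proof -
  have "continuous_on S (\<lambda>x. dx_du a (f x))" "continuous_on S (\<lambda>x. dx_dv a (f x))"
    "continuous_on S (\<lambda>x. dy_du a (f x))" "continuous_on S (\<lambda>x. dy_dv a (f x))" for a
    unfolding dx_du_def dx_dv_def dy_du_def dy_dv_def by (intro continuous_intros assms)+
  then show ?thesis by (simp only: jac_at_eq) (intro continuous_intros)
qed

text \<open>
  The chain rule brings in the factor \<open>t\<^sup>2\<close>.
\<close>
lemma grushin_exp_image_outer_measure:
  assumes t: "0 < t" "t \<le> 1" and U: "open U" "bounded U" "U \<subseteq> injectivity_covectors q0"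
    and m: "0 < m" "\<And>\<xi>. \<xi> \<in> U \<Longrightarrow> m \<le> t\<^sup>2 * jac_at q0 (t *\<^sub>R \<xi>)"
    and M: "0 < M" "\<And>\<xi>. \<xi> \<in> U \<Longrightarrow> t\<^sup>2 * jac_at q0 (t *\<^sub>R \<xi>) \<le> M"
    and W: "W \<subseteq> U"
  shows "ennreal m * outer_measure_of lebesgue W \<le> outer_measure_of lebesgue ((\<lambda>\<xi>. grushin_exp q0 (t *\<^sub>R \<xi>)) ` W)"
    and "outer_measure_of lebesgue ((\<lambda>\<xi>. grushin_exp q0 (t *\<^sub>R \<xi>)) ` W) \<le> ennreal M * outer_measure_of lebesgue W"
proof -
  define a where "a = fst q0"
  have nice: "t *\<^sub>R \<xi> \<in> injectivity_covectors q0" if "\<xi> \<in> U" for \<xi>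
  proof -
    have "\<bar>t * snd \<xi>\<bar> \<le> 1 * \<bar>snd \<xi>\<bar>" unfolding abs_mult using t by (intro mult_right_mono) auto
    then show ?thesis using U(3) that t by (force simp: injectivity_covectors_def)
  qed
  have inj: "inj_on (\<lambda>\<xi>. grushin_exp q0 (t *\<^sub>R \<xi>)) U"
  proof (rule inj_onI)
    fix \<xi> \<zeta> assume "\<xi> \<in> U" "\<zeta> \<in> U" "grushin_exp q0 (t *\<^sub>R \<xi>) = grushin_exp q0 (t *\<^sub>R \<zeta>)"
    then have "t *\<^sub>R \<xi> = t *\<^sub>R \<zeta>" using inj_onD[OF inj_on_grushin_exp _ nice nice] by blast
    then show "\<xi> = \<zeta>" using t by simp
  qed
  have det: "(t * dx_du a (t *\<^sub>R \<xi>)) * (t * dy_dv a (t *\<^sub>R \<xi>)) - (t * dx_dv a (t *\<^sub>R \<xi>)) * (t * dy_du a (t *\<^sub>R \<xi>))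
      = t\<^sup>2 * jac_at q0 (t *\<^sub>R \<xi>)" for \<xi>
  proof -
    have "(t * dx_du a (t *\<^sub>R \<xi>)) * (t * dy_dv a (t *\<^sub>R \<xi>)) - (t * dx_dv a (t *\<^sub>R \<xi>)) * (t * dy_du a (t *\<^sub>R \<xi>))
      = t\<^sup>2 * (dx_du a (t *\<^sub>R \<xi>) * dy_dv a (t *\<^sub>R \<xi>) - dx_dv a (t *\<^sub>R \<xi>) * dy_du a (t *\<^sub>R \<xi>))"
      by (simp add: algebra_simps power2_eq_square)
    then show ?thesis unfolding grushin_exp_jacobian jac_at_def a_def .
  qed
  have der: "((\<lambda>\<xi>. grushin_exp q0 (t *\<^sub>R \<xi>)) has_derivative
      (\<lambda>h. (t * dx_du a (t *\<^sub>R \<xi>) * fst h + t * dx_dv a (t *\<^sub>R \<xi>) * snd h, t * dy_du a (t *\<^sub>R \<xi>) * fst h + t * dy_dv a (t *\<^sub>R \<xi>) * snd h))) (at \<xi>)" for \<xi>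
  proof -
    have "((\<lambda>\<xi>. t *\<^sub>R \<xi>) has_derivative (\<lambda>h. t *\<^sub>R h)) (at \<xi>)" by (auto intro!: derivative_eq_intros)
    from diff_chain_at[OF this grushin_exp_has_derivative[of q0 "t *\<^sub>R \<xi>"]] show ?thesis
      by (simp add: o_def a_def mult_ac)
  qed
  have abs_eq: "\<bar>t\<^sup>2 * jac_at q0 (t *\<^sub>R \<xi>)\<bar> = t\<^sup>2 * jac_at q0 (t *\<^sub>R \<xi>)" if "\<xi> \<in> U" for \<xi>
    using m(1) m(2)[OF that] by simp
  have cont: "continuous_on U (\<lambda>\<xi>. (t * dx_du a (t *\<^sub>R \<xi>)) * (t * dy_dv a (t *\<^sub>R \<xi>)) - (t * dx_dv a (t *\<^sub>R \<xi>)) * (t * dy_du a (t *\<^sub>R \<xi>)))"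
    unfolding det by (intro continuous_intros)
  note im = injective_image_outer_measure[OF U(1,2) inj der cont, unfolded det, OF _ _ m(1) M(1) W]
  show "ennreal m * outer_measure_of lebesgue W \<le> outer_measure_of lebesgue ((\<lambda>\<xi>. grushin_exp q0 (t *\<^sub>R \<xi>)) ` W)"
    "outer_measure_of lebesgue ((\<lambda>\<xi>. grushin_exp q0 (t *\<^sub>R \<xi>)) ` W) \<le> ennreal M * outer_measure_of lebesgue W"
    by (rule im; simp add: abs_eq m(2) M(2))+
qed

text \<open>
  Uniqueness of minimizers gives one inclusion, minimality of extremals the other.
\<close>
lemma Z_eq_image:
  assumes U: "U \<subseteq> injectivity_covectors q0" and B: "B \<subseteq> grushin_exp q0 ` U" and t: "t \<in> {0..1}"
  shows "Z t {q0} B = (\<lambda>\<xi>. grushin_exp q0 (t *\<^sub>R \<xi>)) ` (U \<inter> grushin_exp q0 -` B)"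
proof (rule set_eqI, rule iffI)
  fix z assume "z \<in> Z t {q0} B"
  then obtain \<gamma> where \<gamma>: "minimizing_geodesic \<gamma>" "\<gamma> 0 = q0" "\<gamma> 1 \<in> B" "z = \<gamma> t" by (auto simp: Z_def)
  then obtain \<xi> where \<xi>: "\<xi> \<in> U" "\<gamma> 1 = grushin_exp q0 \<xi>" using B by auto
  then have "\<bar>snd \<xi>\<bar> < pi" using U by (auto simp: injectivity_covectors_def)
  from grushin_exp_unique[OF this \<gamma>(1,2) \<xi>(2) t] show "z \<in> (\<lambda>\<xi>. grushin_exp q0 (t *\<^sub>R \<xi>)) ` (U \<inter> grushin_exp q0 -` B)"
    using \<gamma> \<xi> by auto
next
  fix z assume "z \<in> (\<lambda>\<xi>. grushin_exp q0 (t *\<^sub>R \<xi>)) ` (U \<inter> grushin_exp q0 -` B)"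
  then obtain \<xi> where \<xi>: "\<xi> \<in> U" "grushin_exp q0 \<xi> \<in> B" "z = grushin_exp q0 (t *\<^sub>R \<xi>)" by auto
  then have "\<bar>snd \<xi>\<bar> < pi" using U by (auto simp: injectivity_covectors_def)
  from grushin_exp_minimizing(2)[OF this, of q0] show "z \<in> Z t {q0} B"
    unfolding Z_def using \<xi> by (auto intro!: exI[of _ "\<lambda>s. grushin_exp q0 (s *\<^sub>R \<xi>)"])
qed

lemma jac_at_pos: "\<xi> \<in> injectivity_covectors q0 \<Longrightarrow> 0 < jac_at q0 \<xi>"
  unfolding injectivity_covectors_def jac_at_def by (auto intro: jac_pos)

text \<open>
  Near \<open>\<xi>\<close> the Jacobians of \<open>\<zeta> \<mapsto> exp(t\<zeta>)\<close> and of \<open>exp\<close> differ from their values at \<open>\<xi>\<close> by at most a factor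
  \<open>\<kappa>\<close>.  A small ball and its set of intermediate points are the images under these two maps of the same
  set \<open>W\<close> of covectors, so the measure of \<open>W\<close> cancels from the ratio.
\<close>
lemma beta_ratio_bounds:
  assumes \<xi>: "\<xi> \<in> injectivity_covectors q0" and t: "0 < t" "t \<le> 1" and \<kappa>: "1 < \<kappa>"
  defines "D \<equiv> t\<^sup>2 * jac_at q0 (t *\<^sub>R \<xi>) / jac_at q0 \<xi>" and "q \<equiv> grushin_exp q0 \<xi>"
  shows "\<forall>\<^sub>F r in at_right 0.
     ennreal (D / \<kappa>\<^sup>2) \<le> outer_measure_of lebesgue (Z t {q0} (sr_ball r q)) / outer_measure_of lebesgue (sr_ball r q) \<and>
     outer_measure_of lebesgue (Z t {q0} (sr_ball r q)) / outer_measure_of lebesgue (sr_ball r q) \<le> ennreal (D * \<kappa>\<^sup>2)"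
proof -
  define J where "J t \<zeta> = t\<^sup>2 * jac_at q0 (t *\<^sub>R \<zeta>)" for t \<zeta>
  have t\<xi>: "t *\<^sub>R \<xi> \<in> injectivity_covectors q0"
  proof -
    have "\<bar>t * snd \<xi>\<bar> \<le> 1 * \<bar>snd \<xi>\<bar>" unfolding abs_mult using t by (intro mult_right_mono) auto
    then show ?thesis using \<xi> t by (force simp: injectivity_covectors_def)
  qed
  have pos: "0 < J t \<xi>" "0 < J 1 \<xi>" using jac_at_pos[OF \<xi>] jac_at_pos[OF t\<xi>] t by (auto simp: J_def)
  define V where "V = ball \<xi> 1 \<inter> injectivity_covectors q0 \<inter>
     ({\<zeta>. J t \<xi> / \<kappa> < J t \<zeta>} \<inter> {\<zeta>. J t \<zeta> < J t \<xi> * \<kappa>}) \<inter> ({\<zeta>. J 1 \<xi> / \<kappa> < J 1 \<zeta>} \<inter> {\<zeta>. J 1 \<zeta> < J 1 \<xi> * \<kappa>})"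
  have opV: "open V"
    unfolding V_def J_def by (intro open_Int open_ball open_injectivity_covectors open_Collect_less continuous_intros)
  have V: "bounded V" "V \<subseteq> injectivity_covectors q0" unfolding V_def by (auto intro: bounded_subset[OF bounded_ball[of \<xi> 1]])
  have \<xi>V: "\<xi> \<in> V" using \<xi> pos \<kappa> by (simp add: V_def divide_less_eq)
  have opi: "open (grushin_exp q0 ` V)"
    by (rule invariance_of_domain[OF continuous_on_grushin_exp opV inj_on_subset[OF inj_on_grushin_exp V(2)]])
  have "\<forall>\<^sub>F r in at_right 0. sr_ball r q \<subseteq> grushin_exp q0 ` V"
    by (rule sr_ball_eventually_subset[OF opi]) (use \<xi>V in \<open>auto simp: q_def\<close>)
  moreover have "\<forall>\<^sub>F r in at_right 0. r \<in> {0<..<pi}" by (rule eventually_at_right_real) simp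
  ultimately show ?thesis
  proof eventually_elim
    fix r assume B: "sr_ball r q \<subseteq> grushin_exp q0 ` V" and r: "r \<in> {0<..<pi}"
    define W where "W = V \<inter> grushin_exp q0 -` sr_ball r q"
    let ?o = "outer_measure_of lebesgue"
    have Zeq: "Z t {q0} (sr_ball r q) = (\<lambda>\<zeta>. grushin_exp q0 (t *\<^sub>R \<zeta>)) ` W"
      unfolding W_def by (rule Z_eq_image[OF V(2) B]) (use t in auto)
    have Beq: "sr_ball r q = (\<lambda>\<zeta>. grushin_exp q0 (1 *\<^sub>R \<zeta>)) ` W" unfolding W_def using B by auto
    have k0: "0 < J t \<xi> / \<kappa>" "0 < J t \<xi> * \<kappa>" "0 < J 1 \<xi> / \<kappa>" "0 < J 1 \<xi> * \<kappa>" using pos \<kappa> by simp_all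
    have WV: "W \<subseteq> V" by (simp add: W_def)
    have zt: "ennreal (J t \<xi> / \<kappa>) * ?o W \<le> ?o (Z t {q0} (sr_ball r q))"
      "?o (Z t {q0} (sr_ball r q)) \<le> ennreal (J t \<xi> * \<kappa>) * ?o W"
      unfolding Zeq
      by (rule grushin_exp_image_outer_measure[OF t opV V k0(1) _ k0(2) _ WV]; auto simp: V_def J_def)+
    have z1: "ennreal (J 1 \<xi> / \<kappa>) * ?o W \<le> ?o (sr_ball r q)"
      "?o (sr_ball r q) \<le> ennreal (J 1 \<xi> * \<kappa>) * ?o W"
      unfolding Beq
      by (rule grushin_exp_image_outer_measure[OF _ _ opV V k0(3) _ k0(4) _ WV]; auto simp: V_def J_def)+
    have ob: "?o (sr_ball r q) > 0" "?o (sr_ball r q) < top"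
      using sr_ball_outer_measure_pos sr_ball_outer_measure_finite r by auto
    have J1: "J 1 \<xi> = jac_at q0 \<xi>" by (simp add: J_def)
    have D: "D = J t \<xi> / J 1 \<xi>" by (simp add: D_def J_def)
    have "?o (Z t {q0} (sr_ball r q)) \<le> ennreal (D * \<kappa>\<^sup>2) * (ennreal (J 1 \<xi> / \<kappa>) * ?o W)"
    proof -
      have "J t \<xi> * \<kappa> = D * \<kappa>\<^sup>2 * (J 1 \<xi> / \<kappa>)" using pos \<kappa> by (simp add: D power2_eq_square)
      then have "ennreal (J t \<xi> * \<kappa>) = ennreal (D * \<kappa>\<^sup>2) * ennreal (J 1 \<xi> / \<kappa>)"
        using k0 pos \<kappa> by (simp add: ennreal_mult[symmetric] D)
      then show ?thesis using zt(2) by (simp add: mult.assoc)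
    qed
    also have "\<dots> \<le> ennreal (D * \<kappa>\<^sup>2) * ?o (sr_ball r q)" by (intro mult_left_mono z1) auto
    finally have up: "?o (Z t {q0} (sr_ball r q)) / ?o (sr_ball r q) \<le> ennreal (D * \<kappa>\<^sup>2)"
      by (intro divide_le_posI_ennreal ob(1)) (simp add: mult.commute)
    have "ennreal (D / \<kappa>\<^sup>2) * ?o (sr_ball r q) \<le> ennreal (D / \<kappa>\<^sup>2) * (ennreal (J 1 \<xi> * \<kappa>) * ?o W)"
      by (intro mult_left_mono z1) auto
    also have "\<dots> = ennreal (J t \<xi> / \<kappa>) * ?o W"
    proof -
      have "J t \<xi> / \<kappa> = D / \<kappa>\<^sup>2 * (J 1 \<xi> * \<kappa>)" using pos \<kappa> by (simp add: D power2_eq_square)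
      then have "ennreal (J t \<xi> / \<kappa>) = ennreal (D / \<kappa>\<^sup>2) * ennreal (J 1 \<xi> * \<kappa>)"
        using k0 pos \<kappa> by (simp add: ennreal_mult[symmetric] D)
      then show ?thesis by (simp add: mult.assoc)
    qed
    also have "\<dots> \<le> ?o (Z t {q0} (sr_ball r q))" by (rule zt)
    finally have "ennreal (D / \<kappa>\<^sup>2) * ?o (sr_ball r q) / ?o (sr_ball r q) \<le> ?o (Z t {q0} (sr_ball r q)) / ?o (sr_ball r q)"
      by (rule divide_right_mono_ennreal)
    then show "ennreal (D / \<kappa>\<^sup>2) \<le> ?o (Z t {q0} (sr_ball r q)) / ?o (sr_ball r q) \<and>
       ?o (Z t {q0} (sr_ball r q)) / ?o (sr_ball r q) \<le> ennreal (D * \<kappa>\<^sup>2)"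
      using up ob by (simp add: mult_divide_eq_ennreal)
  qed
qed

theorem beta_grushin_exp:
  assumes \<xi>: "\<xi> \<in> injectivity_covectors q0" and t: "0 < t" "t \<le> 1"
  shows "beta t q0 (grushin_exp q0 \<xi>) = ennreal (t\<^sup>2 * jac_at q0 (t *\<^sub>R \<xi>) / jac_at q0 \<xi>)"
proof -
  define D where "D = t\<^sup>2 * jac_at q0 (t *\<^sub>R \<xi>) / jac_at q0 \<xi>"
  have nb: "at_right (0::real) \<noteq> bot" by simp
  have low: "ennreal (D / \<kappa>\<^sup>2) \<le> beta t q0 (grushin_exp q0 \<xi>)" if "1 < \<kappa>" for \<kappa>
    unfolding beta_def
    by (rule le_Limsup[OF nb]) (use beta_ratio_bounds[OF \<xi> t that] in \<open>auto elim: eventually_mono simp: D_def\<close>)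
  have up: "beta t q0 (grushin_exp q0 \<xi>) \<le> ennreal (D * \<kappa>\<^sup>2)" if "1 < \<kappa>" for \<kappa>
    unfolding beta_def
    by (rule Limsup_bounded) (use beta_ratio_bounds[OF \<xi> t that] in \<open>auto elim: eventually_mono simp: D_def\<close>)
  define \<kappa> where "\<kappa> n = 1 + 1 / real (Suc n)" for n
  have \<kappa>1: "1 < \<kappa> n" for n by (simp add: \<kappa>_def)
  have lim: "\<kappa> \<longlonglongrightarrow> 1 + 0" unfolding \<kappa>_def[abs_def] by (intro tendsto_intros LIMSEQ_Suc[OF lim_1_over_n])
  have "(\<lambda>n. ennreal (D / (\<kappa> n)\<^sup>2)) \<longlonglongrightarrow> ennreal (D / 1\<^sup>2)"
    using lim by (intro tendsto_ennrealI tendsto_intros) auto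
  then have "ennreal (D / 1\<^sup>2) \<le> beta t q0 (grushin_exp q0 \<xi>)"
    by (rule LIMSEQ_le_const2) (use low \<kappa>1 in auto)
  moreover have "(\<lambda>n. ennreal (D * (\<kappa> n)\<^sup>2)) \<longlonglongrightarrow> ennreal (D * 1\<^sup>2)"
    using lim by (intro tendsto_ennrealI tendsto_intros) auto
  then have "beta t q0 (grushin_exp q0 \<xi>) \<le> ennreal (D * 1\<^sup>2)"
    by (rule LIMSEQ_le_const) (use up \<kappa>1 in auto)
  ultimately show ?thesis by (simp add: D_def)
qed


section \<open>A segment for which the exponent five is attained\<close>

text \<open>
  First the abscissas agree, because \<open>x' = w\<^sub>1\<close>; then so do the right-hand sides \<open>x w\<^sub>2\<close> of the equation
  for the heights.
\<close>
lemma control_determines_curve: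
  assumes c: "has_control \<gamma> w" "has_control \<eta> w" and start: "\<eta> 0 = \<gamma> 0" and t: "t \<in> {0..1}"
  shows "\<eta> t = \<gamma> t"
proof -
  let ?M = "lebesgue_on {0..1::real}"
  have ac: "absolutely_continuous_curve \<gamma>" "absolutely_continuous_curve \<eta>"
    using c by (auto simp: has_control_def)
  note acx = ac_curve_diff[OF ac_curve_fst[OF ac(2)] ac_curve_fst[OF ac(1)]]
    and acy = ac_curve_diff[OF ac_curve_snd[OF ac(2)] ac_curve_snd[OF ac(1)]]
  note dfst = bounded_linear.has_vector_derivative[OF bounded_linear_fst]
    and dsnd = bounded_linear.has_vector_derivative[OF bounded_linear_snd]
  have "AE s in ?M. ((\<lambda>s. fst (\<eta> s) - fst (\<gamma> s)) has_vector_derivative 0) (at s within {0..1})"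
    using has_control_AE[OF c(1)] has_control_AE[OF c(2)]
  proof eventually_elim
    fix s :: real assume *: "(\<gamma> has_vector_derivative (fst (w s), fst (\<gamma> s) * snd (w s))) (at s within {0..1})"
      "(\<eta> has_vector_derivative (fst (w s), fst (\<eta> s) * snd (w s))) (at s within {0..1})"
    show "((\<lambda>s. fst (\<eta> s) - fst (\<gamma> s)) has_vector_derivative 0) (at s within {0..1})"
      using has_vector_derivative_diff[OF dfst[OF *(2)] dfst[OF *(1)]] by simp
  qed
  from ac_curve_const[OF acx this] have x: "fst (\<eta> s) = fst (\<gamma> s)" if "s \<in> {0..1}" for s
    using that start by simp
  have "AE s in ?M. s \<in> {0..1::real}" by (metis AE_space space_lebesgue_on)
  then have "AE s in ?M. ((\<lambda>s. snd (\<eta> s) - snd (\<gamma> s)) has_vector_derivative 0) (at s within {0..1})"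
    using has_control_AE[OF c(1)] has_control_AE[OF c(2)]
  proof eventually_elim
    fix s :: real assume s: "s \<in> {0..1}"
      and *: "(\<gamma> has_vector_derivative (fst (w s), fst (\<gamma> s) * snd (w s))) (at s within {0..1})"
      "(\<eta> has_vector_derivative (fst (w s), fst (\<eta> s) * snd (w s))) (at s within {0..1})"
    show "((\<lambda>s. snd (\<eta> s) - snd (\<gamma> s)) has_vector_derivative 0) (at s within {0..1})"
      using has_vector_derivative_diff[OF dsnd[OF *(2)] dsnd[OF *(1)]] x[OF s] by simp
  qed
  from ac_curve_const[OF acy this t] start have "snd (\<eta> t) = snd (\<gamma> t)" by simp
  with x[OF t] show ?thesis by (simp add: prod_eq_iff)
qed

lemma end_point_eqI:
  assumes "has_control \<gamma> w" "\<gamma> 0 = q0"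
  shows "end_point q0 w = \<gamma> 1"
  unfolding end_point_def
proof (rule the_equality)
  show "\<exists>\<eta>. has_control \<eta> w \<and> \<eta> 0 = q0 \<and> \<eta> 1 = \<gamma> 1" using assms by blast
  fix q assume "\<exists>\<eta>. has_control \<eta> w \<and> \<eta> 0 = q0 \<and> \<eta> 1 = q"
  then obtain \<eta> where "has_control \<eta> w" "\<eta> 0 = q0" "\<eta> 1 = q" by blast
  then show "q = \<gamma> 1" using control_determines_curve[OF assms(1), of \<eta> 1] assms(2) by simp
qed

lemma const_l2_control: "(\<lambda>t. c) \<in> l2_controls"
  unfolding l2_controls_def
  using finite_measure.integrable_const[OF finite_measure_lebesgue_on[of "{0..1::real}"]] by auto

lemma l2_controls_add:
  assumes u: "u \<in> l2_controls" and w: "w \<in> l2_controls"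
  shows "(\<lambda>t. u t + w t) \<in> l2_controls"
proof -
  have m: "(\<lambda>t. u t + w t) \<in> borel_measurable (lebesgue_on {0..1})"
    using u w by (auto simp: l2_controls_def)
  have "integrable (lebesgue_on {0..1}) (\<lambda>t. 2 * (norm (u t))\<^sup>2 + 2 * (norm (w t))\<^sup>2)"
    using u w by (auto simp: l2_controls_def)
  then have "integrable (lebesgue_on {0..1}) (\<lambda>t. (norm (u t + w t))\<^sup>2)"
  proof (rule Bochner_Integration.integrable_bound)
    show "(\<lambda>t. (norm (u t + w t))\<^sup>2) \<in> borel_measurable (lebesgue_on {0..1})" using m by measurable
    have "(norm (u t + w t))\<^sup>2 \<le> 2 * (norm (u t))\<^sup>2 + 2 * (norm (w t))\<^sup>2" for t
    proof -
      have "(norm (u t + w t))\<^sup>2 \<le> (norm (u t) + norm (w t))\<^sup>2"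
        by (rule power_mono[OF norm_triangle_ineq]) simp
      also have "\<dots> \<le> 2 * (norm (u t))\<^sup>2 + 2 * (norm (w t))\<^sup>2"
        using zero_le_power2[of "norm (u t) - norm (w t)"] by (simp add: power2_eq_square algebra_simps)
      finally show ?thesis .
    qed
    then show "AE t in lebesgue_on {0..1}. norm ((norm (u t + w t))\<^sup>2) \<le> norm (2 * (norm (u t))\<^sup>2 + 2 * (norm (w t))\<^sup>2)"
      by (intro AE_I2) simp
  qed
  with m show ?thesis by (simp add: l2_controls_def)
qed

lemma l2_norm_scale_const: "l2_norm (\<lambda>t. \<epsilon> *\<^sub>R c) = \<bar>\<epsilon>\<bar> * norm c"
  unfolding l2_norm_def
  by (simp add: power_mult_distrib measure_restrict_space real_sqrt_mult)

text \<open>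
  The value of a Frechet derivative in a constant direction can be read off from the behaviour of the
  function along a single ray.
\<close>
lemma l2_derivative_directional:
  assumes L: "has_l2_derivative F L u"
    and dir: "\<And>\<epsilon>. \<epsilon> > 0 \<Longrightarrow> F (\<lambda>t. u t + \<epsilon> *\<^sub>R c) = F u + \<epsilon> *\<^sub>R z"
  shows "L (\<lambda>t. c) = z"
proof (rule ccontr)
  assume ne: "L (\<lambda>t. c) \<noteq> z"
  define m where "m = norm c + 1"
  have m: "m > 0" "norm c \<le> m" by (auto simp: m_def add_nonneg_pos)
  define k where "k = norm (z - L (\<lambda>t. c)) / (2 * m)"
  have k0: "k > 0" using ne m by (simp add: k_def)
  then obtain \<delta> where \<delta>: "\<delta> > 0" "\<And>w. w \<in> l2_controls \<Longrightarrow> l2_norm w < \<delta> \<Longrightarrow>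
        norm (F (\<lambda>t. u t + w t) - F u - L w) \<le> k * l2_norm w"
    using L unfolding has_l2_derivative_def by blast
  define \<epsilon> where "\<epsilon> = \<delta> / (2 * m)"
  have \<epsilon>0: "\<epsilon> > 0" using \<delta>(1) m by (simp add: \<epsilon>_def)
  have "\<epsilon> * norm c \<le> \<epsilon> * m" using \<epsilon>0 m by simp
  also have "\<dots> = \<delta> / 2" using m by (simp add: \<epsilon>_def)
  finally have small: "l2_norm (\<lambda>t. \<epsilon> *\<^sub>R c) < \<delta>" using \<delta>(1) \<epsilon>0 by (simp add: l2_norm_scale_const)
  have "\<forall>r. \<forall>w\<in>l2_controls. L (\<lambda>t. r *\<^sub>R w t) = r *\<^sub>R L w"
    using L unfolding has_l2_derivative_def by (elim conjE)
  from this[rule_format, OF const_l2_control] have "L (\<lambda>t. \<epsilon> *\<^sub>R c) = \<epsilon> *\<^sub>R L (\<lambda>t. c)" .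
  then have "norm (\<epsilon> *\<^sub>R (z - L (\<lambda>t. c))) \<le> k * (\<epsilon> * norm c)"
    using \<delta>(2)[OF const_l2_control small] dir[OF \<epsilon>0] \<epsilon>0 by (simp add: l2_norm_scale_const scaleR_diff_right)
  then have "norm (z - L (\<lambda>t. c)) \<le> k * norm c" using \<epsilon>0 by (simp add: mult.left_commute)
  also have "\<dots> < k * (2 * m)" using k0 m by (intro mult_strict_left_mono) linarith+
  also have "\<dots> = norm (z - L (\<lambda>t. c))" using m by (simp add: k_def)
  finally show False by simp
qed

text \<open>
  A segment of the horizontal line through the origin, with \<open>v = 0\<close>.  For such extremals \<open>J(t\<xi>)\<close> is the mean of \<open>x\<^sup>2\<close>
  over \<open>[0,t]\<close>, and \<open>t x(t)\<^sup>2 \<le> 4 \<integral>\<^sub>0\<^sup>t x\<^sup>2\<close> is an equality at \<open>t = 1\<close> exactly when \<open>x(1) = - 2 x(0)\<close>.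
\<close>
definition long_segment :: "real \<Rightarrow> plane" where "long_segment t = (1 - 3 * t, 0)"

lemma long_segment_grushin_exp: "long_segment t = grushin_exp (1, 0) (t *\<^sub>R (-3, 0))"
  unfolding grushin_exp_scale' by (simp add: long_segment_def ext_x_def ext_y_def)

lemma long_segment_control:
  assumes u: "has_control long_segment u"
  shows "AE t in lebesgue_on {0..1}. u t = (-3, 0)"
proof -
  have N: "{1/3::real} \<in> null_sets (lebesgue_on {0..1})"
    by (auto simp: null_sets_restrict_space)
  have "AE t in lebesgue_on {0..1}. t \<noteq> (1/3::real)"
    by (rule AE_I'[OF N]) auto
  moreover have "AE t in lebesgue_on {0..1}. t \<in> {0..1::real}" by (metis AE_space space_lebesgue_on)
  ultimately show ?thesis using has_control_AE[OF u]
  proof eventually_elim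
    fix t :: real assume t: "t \<noteq> 1/3" "t \<in> {0..1}"
      and d: "(long_segment has_vector_derivative (fst (u t), fst (long_segment t) * snd (u t))) (at t within {0..1})"
    have "((\<lambda>t. (1 - 3 * t, 0)) has_vector_derivative (-3, 0::real)) (at t within {0..1})"
      by (auto intro!: derivative_eq_intros)
    then have "(long_segment has_vector_derivative (-3, 0)) (at t within {0..1})"
      unfolding long_segment_def[abs_def] .
    from vector_derivative_unique_within_closed_interval[of 0 1 t, unfolded box_real, OF _ _ d this]
    show "u t = (-3, 0)" using t by (auto simp: long_segment_def prod_eq_iff)
  qed
qed

text \<open>
  The control of the segment is \<open>(-3, 0)\<close> almost everywhere, since \<open>x\<close> vanishes only once.  Adding a
  constant produces a parabola that can be written down.
\<close>
lemma end_point_near_long_segment: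
  assumes u: "has_control long_segment u"
  shows "end_point (1, 0) (\<lambda>t. u t + (\<alpha>, \<beta>)) = (\<alpha> - 2, \<beta> * (\<alpha> - 1) / 2)"
proof -
  define \<eta> where "\<eta> s = (1 + (\<alpha> - 3) * s, \<beta> * (s + (\<alpha> - 3) * s\<^sup>2 / 2))" for s :: real
  have d: "(\<eta> has_vector_derivative (\<alpha> - 3, \<beta> * (1 + (\<alpha> - 3) * s))) (at s within {0..1})" for s
  proof -
    have "((\<lambda>s. 1 + (\<alpha> - 3) * s) has_real_derivative \<alpha> - 3) (at s within {0..1})"
      "((\<lambda>s. \<beta> * (s + (\<alpha> - 3) * s\<^sup>2 / 2)) has_real_derivative \<beta> * (1 + (\<alpha> - 3) * s)) (at s within {0..1})"
      by (auto intro!: derivative_eq_intros)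
    then show ?thesis
      unfolding \<eta>_def[abs_def] has_real_derivative_iff_has_vector_derivative by (rule has_vector_derivative_Pair)
  qed
  have "has_control \<eta> (\<lambda>t. u t + (\<alpha>, \<beta>))"
  proof (rule has_controlI)
    show "absolutely_continuous_curve \<eta>" by (rule ac_curve_C1[OF d]) (intro continuous_intros)
    show "(\<lambda>t. u t + (\<alpha>, \<beta>)) \<in> l2_controls"
      using u by (intro l2_controls_add const_l2_control) (simp add: has_control_def)
    show "AE t in lebesgue_on {0..1}. (\<eta> has_vector_derivative
        (fst (u t + (\<alpha>, \<beta>)), fst (\<eta> t) * snd (u t + (\<alpha>, \<beta>)))) (at t within {0..1})"
      using long_segment_control[OF u]
    proof eventually_elim
      fix t assume "u t = (-3, 0)"
      then show "(\<eta> has_vector_derivative (fst (u t + (\<alpha>, \<beta>)), fst (\<eta> t) * snd (u t + (\<alpha>, \<beta>)))) (at t within {0..1})"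
        using d[of t] by (simp add: \<eta>_def mult.commute)
    qed
  qed
  from end_point_eqI[OF this, of "(1, 0)"] show ?thesis by (simp add: \<eta>_def field_simps)
qed

text \<open>
  The derivative of the end-point map takes the constant perturbations \<open>(1, 0)\<close> and \<open>(0, 1)\<close> to linearly
  independent vectors.
\<close>
lemma long_segment_not_abnormal: "\<not> abnormal long_segment"
proof
  assume "abnormal long_segment"
  then obtain u L where u: "has_control long_segment u"
    and L: "has_l2_derivative (end_point (1, 0)) L u" "L ` l2_controls \<noteq> UNIV"
    unfolding abnormal_def l2_critical_point_def by (auto simp: long_segment_def)
  have F0: "end_point (1, 0) u = (-2, 0)"
    using end_point_near_long_segment[OF u, of 0 0] by (simp add: zero_prod_def[symmetric])
  have L1: "L (\<lambda>t. (1, 0)) = (1, 0)"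
    by (rule l2_derivative_directional[OF L(1)]) (simp add: F0 end_point_near_long_segment[OF u])
  have L2: "L (\<lambda>t. (0, 1)) = (0, -1/2)"
    by (rule l2_derivative_directional[OF L(1)]) (simp add: F0 end_point_near_long_segment[OF u])
  have "z \<in> L ` l2_controls" for z
  proof -
    have lin: "\<And>v w. v \<in> l2_controls \<Longrightarrow> w \<in> l2_controls \<Longrightarrow> L (\<lambda>t. v t + w t) = L v + L w"
      "\<And>c w. w \<in> l2_controls \<Longrightarrow> L (\<lambda>t. c *\<^sub>R w t) = c *\<^sub>R L w"
      using L(1) unfolding has_l2_derivative_def by blast+
    have "L (\<lambda>t. fst z *\<^sub>R (1, 0) + (-2 * snd z) *\<^sub>R (0, 1)) = fst z *\<^sub>R (1, 0) + (-2 * snd z) *\<^sub>R (0, -1/2)"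
      using lin(1)[OF const_l2_control[of "fst z *\<^sub>R (1, 0)"] const_l2_control[of "(-2 * snd z) *\<^sub>R (0, 1)"]]
        lin(2)[OF const_l2_control[of "(1, 0)"], of "fst z"] lin(2)[OF const_l2_control[of "(0, 1)"], of "-2 * snd z"] L1 L2
      by simp
    then have "L (\<lambda>t. fst z *\<^sub>R (1, 0) + (-2 * snd z) *\<^sub>R (0, 1)) = z" by (simp add: prod_eq_iff)
    then show ?thesis using const_l2_control by (metis imageI)
  qed
  then show False using L(2) by blast
qed

lemma surj_of_det:
  fixes A B C D :: real
  assumes "A * D - B * C \<noteq> 0"
  shows "surj (\<lambda>h :: real \<times> real. (A * fst h + B * snd h, C * fst h + D * snd h))"
  unfolding surj_def
proof
  fix y :: "real \<times> real"
  define d where "d = A * D - B * C"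
  have d: "d \<noteq> 0" using assms by (simp add: d_def)
  have "A * ((D * fst y - B * snd y) / d) + B * ((A * snd y - C * fst y) / d) = fst y * (A * D - B * C) / d"
    "C * ((D * fst y - B * snd y) / d) + D * ((A * snd y - C * fst y) / d) = snd y * (A * D - B * C) / d"
    using d by (simp_all add: field_simps)
  then have "y = (A * ((D * fst y - B * snd y) / d) + B * ((A * snd y - C * fst y) / d),
      C * ((D * fst y - B * snd y) / d) + D * ((A * snd y - C * fst y) / d))"
    using d unfolding d_def[symmetric] by (simp add: prod_eq_iff)
  then show "\<exists>x. y = (A * fst x + B * snd x, C * fst x + D * snd x)"
    by (intro exI[of _ "((D * fst y - B * snd y) / d, (A * snd y - C * fst y) / d)"]) simp
qed

lemma long_segment_not_conjugate: "\<not> conjugate_along long_segment"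
proof
  assume "conjugate_along long_segment"
  then obtain \<xi> where \<xi>: "\<And>t. t \<in> {0..1} \<Longrightarrow> long_segment t = grushin_exp (1, 0) (t *\<^sub>R \<xi>)"
    and crit: "critical_point (grushin_exp (1, 0)) \<xi>"
    unfolding conjugate_along_def sr_exp_eq_grushin_exp[abs_def] by (auto simp: long_segment_def)
  have same: "grushin_exp (1, 0) (t *\<^sub>R \<xi>) = grushin_exp (1, 0) (t *\<^sub>R (-3, 0))" if "t \<in> {0..1}" for t
    using \<xi>[OF that] unfolding long_segment_grushin_exp by (rule sym)
  have "\<xi> = (-3, 0)" by (rule grushin_exp_same_curve[OF same, of 0]) auto
  obtain D where D: "(grushin_exp (1, 0) has_derivative D) (at \<xi>)" "\<not> surj D"
    using crit by (auto simp: critical_point_def)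
  have "D = (\<lambda>h. (dx_du 1 \<xi> * fst h + dx_dv 1 \<xi> * snd h, dy_du 1 \<xi> * fst h + dy_dv 1 \<xi> * snd h))"
    using has_derivative_unique[OF D(1) grushin_exp_has_derivative] by simp
  moreover have "dx_du 1 \<xi> * dy_dv 1 \<xi> - dx_dv 1 \<xi> * dy_du 1 \<xi> \<noteq> 0"
    unfolding grushin_exp_jacobian by (simp add: \<open>\<xi> = (-3, 0)\<close> jac_def)
  ultimately show False using D(2) surj_of_det[of "dx_du 1 \<xi>" "dy_dv 1 \<xi>" "dx_dv 1 \<xi>" "dy_du 1 \<xi>"] by simp
qed

lemma long_segment_smooth: "(-2, 0) \<notin> Cut (1, 0)"
proof -
  have curve: "long_segment = (\<lambda>s. grushin_exp (1, 0) (s *\<^sub>R (-3, 0)))" using long_segment_grushin_exp by blast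
  have "minimizing_geodesic long_segment" unfolding curve by (rule grushin_exp_minimizing) simp
  moreover have "\<eta> t = long_segment t"
    if "minimizing_geodesic \<eta>" "\<eta> 0 = (1, 0)" "\<eta> 1 = (-2, 0)" "t \<in> {0..1}" for \<eta> t
    unfolding curve
    by (rule grushin_exp_unique[OF _ that(1,2) _ that(4)]) (use that(3) long_segment_grushin_exp[of 1] in \<open>simp_all add: long_segment_def\<close>)
  moreover have "long_segment 0 = (1, 0)" "long_segment 1 = (-2, 0)" by (simp_all add: long_segment_def)
  ultimately have "smooth_point (1, 0) (-2, 0)"
    unfolding smooth_point_def using long_segment_not_abnormal long_segment_not_conjugate by blast
  then show ?thesis by (simp add: Cut_def)
qed

lemma beta_long_segment:
  assumes "0 < t" "t \<le> 1"
  shows "beta t (1, 0) (-2, 0) = ennreal (t\<^sup>2 * (1 - 3 * t + 3 * t\<^sup>2))"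
proof -
  have "(-3, 0) \<in> injectivity_covectors (1, 0)" by (simp add: injectivity_covectors_def)
  moreover have "grushin_exp (1, 0) (-3, 0) = (-2, 0)" using long_segment_grushin_exp[of 1] by (simp add: long_segment_def)
  ultimately show ?thesis
    using beta_grushin_exp[of "(-3, 0)" "(1, 0)" t] assms by (simp add: jac_at_def jac_def power2_eq_square mult_ac)
qed


section \<open>The sharp exponent\<close>

lemma beta_lower_bound:
  assumes "q \<notin> Cut q0" "0 < t" "t \<le> 1"
  shows "ennreal (t ^ 5) \<le> beta t q0 q"
proof -
  obtain \<xi> where \<xi>: "\<bar>snd \<xi>\<bar> < pi" "fst q0 \<noteq> 0 \<or> fst \<xi> \<noteq> 0" "q = grushin_exp q0 \<xi>"
    using smooth_point_is_grushin_exp[OF assms(1)] .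
  then have nice: "\<xi> \<in> injectivity_covectors q0" by (simp add: injectivity_covectors_def)
  have "t ^ 3 * jac_at q0 \<xi> \<le> jac_at q0 (t *\<^sub>R \<xi>)"
    using jac_scaling[OF \<xi>(1) assms(2,3)] by (simp add: jac_at_def)
  then have "t\<^sup>2 * (t ^ 3 * jac_at q0 \<xi>) \<le> t\<^sup>2 * jac_at q0 (t *\<^sub>R \<xi>)" by (intro mult_left_mono) auto
  moreover have "t\<^sup>2 * (t ^ 3 * jac_at q0 \<xi>) = t ^ 5 * jac_at q0 \<xi>"
    by (simp add: eval_nat_numeral)
  ultimately have "t ^ 5 \<le> t\<^sup>2 * jac_at q0 (t *\<^sub>R \<xi>) / jac_at q0 \<xi>"
    using jac_at_pos[OF nice] by (simp add: pos_le_divide_eq)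
  then show ?thesis unfolding \<xi>(3) beta_grushin_exp[OF nice assms(2,3)] by (rule ennreal_leI)
qed

theorem proposition62:
  fixes N :: real
  shows "(\<forall>q0 q. q \<notin> Cut q0 \<longrightarrow> (\<forall>t\<in>{0..1}. beta t q0 q \<ge> ennreal (t powr N))) \<longleftrightarrow> N \<ge> 5"
proof
  assume all: "\<forall>q0 q. q \<notin> Cut q0 \<longrightarrow> (\<forall>t\<in>{0..1}. beta t q0 q \<ge> ennreal (t powr N))"
  show "N \<ge> 5"
  proof (rule ccontr)
    assume "\<not> N \<ge> 5"
    \<comment> \<open>\<open>\<beta>\<^sub>t\<close> and \<open>t\<^sup>N\<close> agree at \<open>t = 1\<close>, where their derivatives are \<open>5\<close> and \<open>N\<close>.\<close>
    define \<psi> where "\<psi> t = t\<^sup>2 * (1 - 3 * t + 3 * t\<^sup>2) - t powr N" for t :: real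
    have "(\<psi> has_real_derivative 5 - N) (at 1)"
      unfolding \<psi>_def[abs_def] by (auto intro!: derivative_eq_intros)
    from DERIV_pos_inc_left[OF this] \<open>\<not> N \<ge> 5\<close> obtain d where d: "d > 0" "\<And>h. 0 < h \<Longrightarrow> h < d \<Longrightarrow> \<psi> (1 - h) < \<psi> 1"
      by auto
    define t where "t = 1 - min (d / 2) (1 / 2)"
    have t: "0 < t" "t < 1" "\<psi> t < \<psi> 1" using d(1) d(2)[of "min (d / 2) (1 / 2)"] by (auto simp: t_def)
    have "ennreal (t powr N) \<le> ennreal (t\<^sup>2 * (1 - 3 * t + 3 * t\<^sup>2))"
      using all[rule_format, OF long_segment_smooth, of t] beta_long_segment[of t] t by simp
    moreover have "0 < t powr N" using t by simp
    ultimately have "t powr N \<le> t\<^sup>2 * (1 - 3 * t + 3 * t\<^sup>2)"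
      by (metis ennreal_le_iff2 not_le order_less_imp_le)
    moreover have "\<psi> t < 0" using t(3) by (simp add: \<psi>_def)
    ultimately show False by (simp add: \<psi>_def)
  qed
next
  assume N: "N \<ge> 5"
  show "\<forall>q0 q. q \<notin> Cut q0 \<longrightarrow> (\<forall>t\<in>{0..1}. beta t q0 q \<ge> ennreal (t powr N))"
  proof (intro allI impI ballI)
    fix q0 q :: plane and t :: real assume q: "q \<notin> Cut q0" and t: "t \<in> {0..1}"
    show "ennreal (t powr N) \<le> beta t q0 q"
    proof (cases "t = 0")
      case True
      then show ?thesis by simp
    next
      case False
      then have t': "0 < t" "t \<le> 1" using t by auto
      have "t powr N \<le> t powr 5" using powr_mono'[OF N] t' by simp
      also have "\<dots> = t ^ 5" using t' by (simp add: powr_numeral)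
      finally have "ennreal (t powr N) \<le> ennreal (t ^ 5)" by (rule ennreal_leI)
      then show ?thesis using beta_lower_bound[OF q t'] by (rule order_trans)
    qed
  qed
qed

end
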